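(* Let $\Sigma$ be a finite alphabet of constant symbols with $\star\notin\Sigma$ and let $L\subseteq\Sigma^*$. If $L\in\mathrm{coNL}$ (co-nondeterministic logarithmic space), then there is an observation $O\in\mathrm{Matr}_\Sigma(\mathcal O)$ with $\mathcal L(O)=L$. Moreover, if $L\in\mathrm{L}$ (deterministic logarithmic space), then $O$ can be chosen to be a deterministic wiring.
   Context: Terms: first-order terms built from an infinite set of variables, a binary function symbol $\bullet$ written infix (not associative; by convention right-associating, $t\bullet u\bullet v:=t\bullet(u\bullet v)$), infinitely many constant symbols including a distinguished constant $\star$, and for each $n\ge1$ at least one $n$-ary function symbol. $\mathrm{var}(t)$ is the set of variables of $t$; $t$ is closed if $\mathrm{var}(t)=\emptyset$. The height $h(t)$ is the maximal distance from the root to a node in the tree of $t$; the height of an occurrence of a variable in $t$ is its distance from the root. A renaming is a bijective substitution mapping variables to variables. A flow is a pair of terms written $t\leftarrow u$ with $\mathrm{var}(t)\subseteq\mathrm{var}(u)$, considered up to renaming ($t\leftarrow u=t\alpha\leftarrow u\alpha$ for every renaming $\alpha$). A fact is a flow $t\leftarrow\star$ (so $t$ is closed). The product of flows $u\leftarrow v$ and $t\leftarrow w$ (representatives chosen with disjoint variable sets) is defined iff $v$ and $t$ are unifiable, and then equals $u\theta\leftarrow w\theta$ with $\theta$ a most general unifier of $v,t$. A wiring is a finite set of flows, written as a formal sum $f_1+\dots+f_n$, with $0$ the empty wiring; the product of wirings is $FG=\{fg: f\in F, g\in G, fg\text{ defined}\}$ and $F^n$ is the $n$-fold product. For a fact $\mathbf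 u$, $F\mathbf u$ denotes the wiring $F\{\mathbf u\}$ (a set of facts). $F$ is nilpotent if $F^n=0$ for some $n\in\mathbb N$. $F$ is deterministic if $|F\mathbf u|\le 1$ for every fact $\mathbf u$. A flow $t\leftarrow u$ is balanced if for every variable $x$, all occurrences of $x$ in $t$ and in $u$ have the same height; a wiring is balanced if all its flows are; $\mathcal B$ denotes the set of balanced wirings. A semiring here means a set of wirings containing $0$ and closed under finite sums (unions) and products. Tensor product of flows (variables renamed apart): $(u\leftarrow v)\otimes(t\leftarrow w):=u\bullet t\leftarrow v\bullet w$; extended to wirings by $(\sum_i f_i)\otimes(\sum_j g_j)=\sum_{i,j}f_i\otimes g_j$, and to semirings by $\mathcal A\otimes\mathcal B=\{\sum_i F_i\otimes G_i: F_i\in\mathcal A, G_i\in\mathcal B\}$; $\otimes$ on semirings is also right-associating. For a set $E$ of closed terms, $\mathcal C(E)=\{\sum_i t_i\leftarrow u_i: t_i,u_i\in E\}$ (finite sums). For a set of symbols $\mathbf S$ and semiring $\mathcal A$, $\mathcal R_{\mathbf S}(\mathcal A)$ is the set of wirings of $\mathcal A$ not using symbols of $\mathbf S$. $\mathcal I=\{x\leftarrow x\}$ is the unit semiring. Fix disjoint infinite sets of constants $\mathbf P$ (position constants) and $\mathbf S$ (states), a unary function symbol $\mathrm M$, and constants $\mathrm L,\mathrm R$; $\mathrm M(\mathbf P)=\{\mathrm M(p):p\in\mathbf P\}$. The observation semiring is $\mathcal O:=\mathcal C(\mathbf S)\otimes\mathcal R_{\mathbf P}(\mathcal B)$. For a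 set of constants $\Sigma$ (with $\star\notin\Sigma$) and semiring $\mathcal A$, $\mathrm{Matr}_\Sigma(\mathcal A):=\mathcal C(\Sigma\cup\{\star\})\otimes\mathcal C(\{\mathrm L,\mathrm R\})\otimes\mathcal A$. An observation over $\Sigma$ is any element of $\mathrm{Matr}_\Sigma(\mathcal O)$. Word representation: write $t\rightleftarrows u$ for the wiring $t\leftarrow u+u\leftarrow t$. For a word $W=c_1\cdots c_n$ over $\Sigma$ and pairwise distinct $p=(p_0,\dots,p_n)\in\mathbf P^{n+1}$, set $p_{n+1}=p_0$, $c_0=c_{n+1}=\star$, and, with $x,y$ variables, $\bar W_p=\sum_{i=0}^n\big(c_i\bullet\mathrm L\bullet x\bullet y\bullet\mathrm M(p_i)\ \rightleftarrows\ c_{i+1}\bullet\mathrm R\bullet x\bullet y\bullet\mathrm M(p_{i+1})\big)$. The language of an observation $O$ is $\mathcal L(O)=\{W\in\Sigma^*:\ O\bar W_p\text{ is nilpotent for every such }p\}$. *)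

theory Defs
  imports Main
begin

text \<open>Constants: the distinguished constant Star, the constants L and R, the
position constants Pos n (the set P), the states St n (the set S), and
infinitely many further constants Oth n.\<close>
datatype con = Star | CL | CR | Pos nat | St nat | Oth nat

text \<open>Terms: variables, constants, the binary symbol bullet, and function
symbols Fn k [t1,...,tn] (name k, arity n = length of the argument list);
so for every n there are (infinitely many) n-ary function symbols.\<close>
datatype trm = Var nat | Cst con | Bul trm trm (infixr "\<bullet>" 65) | Fn nat "trm list"

definition MM :: "trm \<Rightarrow> trm" where "MM t = Fn 0 [t]"

fun vars :: "trm \<Rightarrow> nat set" where
  "vars (Var x) = {x}"
| "vars (Cst c) = {}"
| "vars (Bul a b) = vars a \<union> vars b"
| "vars (Fn f ts) = (\<Union>t\<in>set ts. vars t)"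

fun cons_of :: "trm \<Rightarrow> con set" where
  "cons_of (Var x) = {}"
| "cons_of (Cst c) = {c}"
| "cons_of (Bul a b) = cons_of a \<union> cons_of b"
| "cons_of (Fn f ts) = (\<Union>t\<in>set ts. cons_of t)"

definition closed_trm :: "trm \<Rightarrow> bool" where "closed_trm t \<longleftrightarrow> vars t = {}"

fun occs :: "trm \<Rightarrow> (nat \<times> nat) set" where
  "occs (Var x) = {(x, 0)}"
| "occs (Cst c) = {}"
| "occs (Bul a b) = (\<lambda>(x,d). (x, Suc d)) ` (occs a \<union> occs b)"
| "occs (Fn f ts) = (\<lambda>(x,d). (x, Suc d)) ` (\<Union>t\<in>set ts. occs t)"

fun subst :: "(nat \<Rightarrow> trm) \<Rightarrow> trm \<Rightarrow> trm" where
  "subst \<sigma> (Var x) = \<sigma> x"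
| "subst \<sigma> (Cst c) = Cst c"
| "subst \<sigma> (Bul a b) = Bul (subst \<sigma> a) (subst \<sigma> b)"
| "subst \<sigma> (Fn f ts) = Fn f (map (subst \<sigma>) ts)"

definition rename :: "(nat \<Rightarrow> nat) \<Rightarrow> trm \<Rightarrow> trm" where
  "rename \<rho> = subst (Var \<circ> \<rho>)"

definition unifier :: "(nat \<Rightarrow> trm) \<Rightarrow> trm \<Rightarrow> trm \<Rightarrow> bool" where
  "unifier \<sigma> s t \<longleftrightarrow> subst \<sigma> s = subst \<sigma> t"

definition mgu :: "(nat \<Rightarrow> trm) \<Rightarrow> trm \<Rightarrow> trm \<Rightarrow> bool" where
  "mgu \<theta> s t \<longleftrightarrow> unifier \<theta> s t \<and>
     (\<forall>\<sigma>. unifier \<sigma> s t \<longrightarrow> (\<exists>\<tau>. \<forall>x. \<sigma> x = subst \<tau> (\<theta> x)))"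

text \<open>A flow t <- u is represented by the pair (t,u); flows are considered up to
renaming, which is harmless here since every notion used below (nilpotency,
the set of facts F u, membership in the semirings, which are closed under
renaming of representatives) is invariant under the choice of representatives.\<close>
type_synonym flow = "trm \<times> trm"
type_synonym wiring = "flow set"

definition is_flow :: "flow \<Rightarrow> bool" where
  "is_flow f \<longleftrightarrow> vars (fst f) \<subseteq> vars (snd f)"

definition is_wiring :: "wiring \<Rightarrow> bool" where
  "is_wiring F \<longleftrightarrow> finite F \<and> (\<forall>f\<in>F. is_flow f)"

text \<open>Renaming apart: the left factor gets even variables, the right factor odd ones.\<close>
definition ev :: "nat \<Rightarrow> nat" where "ev x = 2 * x"
definition od :: "nat \<Rightarrow> nat" where "od x = 2 * x + 1"

definition fprod :: "flow \<Rightarrow> flow \<Rightarrow> flow option" where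
  "fprod f g =
    (let u = rename ev (fst f); v = rename ev (snd f);
         t = rename od (fst g); w = rename od (snd g) in
     if (\<exists>\<sigma>. unifier \<sigma> v t)
     then (let \<theta> = (SOME \<theta>. mgu \<theta> v t) in Some (subst \<theta> u, subst \<theta> w))
     else None)"

definition wprod :: "wiring \<Rightarrow> wiring \<Rightarrow> wiring" where
  "wprod F G = {h. \<exists>f\<in>F. \<exists>g\<in>G. fprod f g = Some h}"

definition unit_wiring :: wiring where "unit_wiring = {(Var 0, Var 0)}"

fun wpow :: "wiring \<Rightarrow> nat \<Rightarrow> wiring" where
  "wpow F 0 = unit_wiring"
| "wpow F (Suc n) = wprod F (wpow F n)"

definition nilpotent :: "wiring \<Rightarrow> bool" where
  "nilpotent F \<longleftrightarrow> (\<exists>n. wpow F n = {})"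

definition fact :: "trm \<Rightarrow> flow" where "fact t = (t, Cst Star)"

definition deterministic :: "wiring \<Rightarrow> bool" where
  "deterministic F \<longleftrightarrow> (\<forall>u. closed_trm u \<longrightarrow> card (wprod F {fact u}) \<le> 1)"

definition balanced :: "flow \<Rightarrow> bool" where
  "balanced f \<longleftrightarrow> (\<forall>x d1 d2. (x, d1) \<in> occs (fst f) \<union> occs (snd f) \<longrightarrow>
                             (x, d2) \<in> occs (fst f) \<union> occs (snd f) \<longrightarrow> d1 = d2)"

definition Bal :: "wiring set" where
  "Bal = {F. is_wiring F \<and> (\<forall>f\<in>F. balanced f)}"

definition ftensor :: "flow \<Rightarrow> flow \<Rightarrow> flow" where
  "ftensor f g = (Bul (rename ev (fst f)) (rename od (fst g)),
                  Bul (rename ev (snd f)) (rename od (snd g)))"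

definition wtensor :: "wiring \<Rightarrow> wiring \<Rightarrow> wiring" where
  "wtensor F G = {ftensor f g | f g. f \<in> F \<and> g \<in> G}"

definition stensor :: "wiring set \<Rightarrow> wiring set \<Rightarrow> wiring set" where
  "stensor A B = {F. \<exists>I. finite I \<and> I \<subseteq> A \<times> B \<and> F = (\<Union>(X,Y)\<in>I. wtensor X Y)}"

definition Cw :: "con set \<Rightarrow> wiring set" where
  "Cw E = {F. finite F \<and> F \<subseteq> (Cst ` E) \<times> (Cst ` E)}"

definition RP :: "wiring set \<Rightarrow> wiring set" where
  "RP A = {F \<in> A. \<forall>f\<in>F. \<forall>p. Pos p \<notin> cons_of (fst f) \<union> cons_of (snd f)}"

definition Obs :: "wiring set" where
  "Obs = stensor (Cw (range St)) (RP Bal)"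

definition Matr :: "con set \<Rightarrow> wiring set \<Rightarrow> wiring set" where
  "Matr Sig A = stensor (Cw (Sig \<union> {Star})) (stensor (Cw {CL, CR}) A)"

definition both :: "trm \<Rightarrow> trm \<Rightarrow> wiring" where
  "both t u = {(t, u), (u, t)}"

definition wordrep :: "con list \<Rightarrow> nat list \<Rightarrow> wiring" where
  "wordrep W p =
    (let n = length W;
         c = (\<lambda>i. if i = 0 \<or> i = n + 1 then Star else W ! (i - 1));
         q = (\<lambda>i. if i = n + 1 then p ! 0 else p ! i)
     in \<Union>i\<in>{0..n}.
          both (Cst (c i) \<bullet> Cst CL \<bullet> Var 0 \<bullet> Var 1 \<bullet> MM (Cst (Pos (q i))))
               (Cst (c (i+1)) \<bullet> Cst CR \<bullet> Var 0 \<bullet> Var 1 \<bullet> MM (Cst (Pos (q (i+1))))))"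

definition lang :: "con set \<Rightarrow> wiring \<Rightarrow> con list set" where
  "lang Sig Ob = {W. set W \<subseteq> Sig \<and>
      (\<forall>p. length p = length W + 1 \<and> distinct p \<longrightarrow> nilpotent (wprod Ob (wordrep W p)))}"

text \<open>A machine with a read-only two-way input tape (with end markers, read as None)
and one one-way-infinite read/write work tape. States and work symbols are
natural numbers; Q and Gam are the (finite) sets of states and work symbols,
blank = 0. Moves are -1, 0, 1.\<close>
record tm =
  Q :: "nat set"
  q0 :: nat
  qacc :: nat
  Gam :: "nat set"
  delta :: "nat \<Rightarrow> con option \<Rightarrow> nat \<Rightarrow> (nat \<times> nat \<times> int \<times> int) set"

definition wf_tm :: "tm \<Rightarrow> bool" where
  "wf_tm M \<longleftrightarrow> finite (Q M) \<and> q0 M \<in> Q M \<and> qacc M \<in> Q M \<and> finite (Gam M) \<and> 0 \<in> Gam M \<and>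
     (\<forall>q\<in>Q M. \<forall>a g. g \<in> Gam M \<longrightarrow> (\<forall>(q', g', di, dw) \<in> delta M q a g.
        q' \<in> Q M \<and> g' \<in> Gam M \<and> di \<in> {-1, 0, 1} \<and> dw \<in> {-1, 0, 1}))"

definition deterministic_tm :: "tm \<Rightarrow> bool" where
  "deterministic_tm M \<longleftrightarrow> (\<forall>q a g. card (delta M q a g) \<le> 1 \<and> finite (delta M q a g))"

type_synonym config = "nat \<times> nat \<times> (nat \<Rightarrow> nat) \<times> nat"
  (* state, input head position (0..n+1), work tape contents, work head position *)

definition inp :: "con list \<Rightarrow> nat \<Rightarrow> con option" where
  "inp w i = (if i = 0 \<or> i > length w then None else Some (w ! (i - 1)))"

definition tm_step :: "tm \<Rightarrow> con list \<Rightarrow> config \<Rightarrow> config \<Rightarrow> bool" where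
  "tm_step M w c c' \<longleftrightarrow> (case c of (q, i, tp, j) \<Rightarrow>
     (\<exists>q' g' di dw. (q', g', di, dw) \<in> delta M q (inp w i) (tp j) \<and>
        0 \<le> int i + di \<and> int i + di \<le> int (length w) + 1 \<and> 0 \<le> int j + dw \<and>
        c' = (q', nat (int i + di), tp(j := g'), nat (int j + dw))))"

definition tm_init :: "tm \<Rightarrow> config" where
  "tm_init M = (q0 M, 0, \<lambda>_. 0, 0)"

definition tm_accepts :: "tm \<Rightarrow> con list \<Rightarrow> bool" where
  "tm_accepts M w \<longleftrightarrow> (\<exists>q i tp j. (tm_step M w)\<^sup>*\<^sup>* (tm_init M) (q, i, tp, j) \<and> q = qacc M)"

text \<open>Logarithmic space bound: on every reachable configuration the work head
position j satisfies 2^j <= (n+2)^k, i.e. j <= k log2(n+2).\<close>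
definition logspace_tm :: "tm \<Rightarrow> con set \<Rightarrow> bool" where
  "logspace_tm M Sig \<longleftrightarrow> (\<exists>k::nat. \<forall>w. set w \<subseteq> Sig \<longrightarrow>
     (\<forall>q i tp j. (tm_step M w)\<^sup>*\<^sup>* (tm_init M) (q, i, tp, j) \<longrightarrow> 2 ^ j \<le> (length w + 2) ^ k))"

definition in_NL :: "con set \<Rightarrow> con list set \<Rightarrow> bool" where
  "in_NL Sig Lg \<longleftrightarrow> (\<exists>M. wf_tm M \<and> logspace_tm M Sig \<and>
      (\<forall>w. set w \<subseteq> Sig \<longrightarrow> (w \<in> Lg \<longleftrightarrow> tm_accepts M w)))"

definition in_coNL :: "con set \<Rightarrow> con list set \<Rightarrow> bool" where
  "in_coNL Sig Lg \<longleftrightarrow> in_NL Sig (lists Sig - Lg)"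

definition in_L :: "con set \<Rightarrow> con list set \<Rightarrow> bool" where
  "in_L Sig Lg \<longleftrightarrow> (\<exists>M. wf_tm M \<and> deterministic_tm M \<and> logspace_tm M Sig \<and>
      (\<forall>w. set w \<subseteq> Sig \<longrightarrow> (w \<in> Lg \<longleftrightarrow> tm_accepts M w)))"

end

theory Submission
  imports Defs
begin

text \<open>Read from input to output, a flow is a relation on terms, products are relational compositions
by the universal property of most general unifiers, and a wiring is nilpotent iff chains of its
relation have bounded length. A position term \<open>y \<bullet> M(z)\<close> with
\<open>y = f(z\<^sub>1, \<dots>, z\<^sub>k)\<close> may be permuted by a balanced flow, so observations are
multihead two-way automata on the circular word.

Such automata simulate logarithmic space: the two halves of the work tape are numbers in a fixed base,
pushed and popped by counter loops, and a counter of polynomial size is an odometer of heads.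

Nilpotency quantifies over all configurations, hence a further odometer clocks the simulation: every
computation must end or restart, with all heads reset, within a bounded number of steps. In the
nondeterministic case acceptance restarts the machine, so a cycle exists iff the word is accepted by the
machine for the complement. In the deterministic case everything but acceptance restarts it.\<close>

section \<open>Flows as relations on terms\<close>

text \<open>An observation may not mention position constants, so all that a head can learn is the
  letter of its cell. As \<open>Star\<close> is no letter of the word, it marks a single cell of the
  circle, and the test for \<open>Star\<close> yields every other test: a head is reset by moving it
  until it reads \<open>Star\<close>, an odometer digit has wrapped around if it reads
  \<open>Star\<close>, a counter is zero if all its digits do.

  Arbitrary configurations are handled by blocking: a head can move only if it holds a position and
  its remembered letter is right. A reset moves every head, so a computation that survives one has
  become a proper run from the initial configuration.

  The clock must outlast a shortest accepting run. Its length is at most the number of edges of the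
  configuration graph, hence at most \<open>card S ^ 2 * N ^ (2 * m)\<close> for \<open>m\<close>
  heads on \<open>N\<close> cells. This is why the clock has at least \<open>2 * m\<close> digits
  and more than \<open>card S ^ 2\<close> steps per tick.

  On the empty word the circle has one cell and odometers carry no information; there the answer is
  stored in the finite control.\<close>

lemma subst_subst: "subst \<tau> (subst \<sigma> t) = subst (subst \<tau> \<circ> \<sigma>) t"
  by (induction t) auto

lemma subst_cong: "(\<And>x. x \<in> vars t \<Longrightarrow> \<sigma> x = \<tau> x) \<Longrightarrow> subst \<sigma> t = subst \<tau> t"
  by (induction t) auto

lemma subst_Var [simp]: "subst Var t = t"
  by (induction t) (auto simp: map_idI)

lemma subst_rename: "subst \<sigma> (rename \<rho> t) = subst (\<sigma> \<circ> \<rho>) t"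
  by (simp add: rename_def subst_subst comp_def)

lemma size_subst_ge: "x \<in> vars t \<Longrightarrow> size (\<sigma> x) \<le> size (subst \<sigma> t)"
proof (induction t)
  case (Fn f ts)
  then obtain t where t: "t \<in> set ts" "size (\<sigma> x) \<le> size (subst \<sigma> t)" by auto
  then have "size (subst \<sigma> t) \<le> size_list size (map (subst \<sigma>) ts)"
    by (intro size_list_estimation'[where x = "subst \<sigma> t"]) auto
  with t show ?case by simp
qed auto

text \<open>The occurs check: a variable and a term properly containing it have instances of
  different size, so nothing unifies them.\<close>

lemma size_subst_gt:
  assumes "x \<in> vars t" "t \<noteq> Var x"
  shows "size (\<sigma> x) < size (subst \<sigma> t)"
proof (cases t)
  case (Bul a b)
  with assms have "x \<in> vars a \<or> x \<in> vars b" by auto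
  with Bul size_subst_ge[of x a \<sigma>] size_subst_ge[of x b \<sigma>] show ?thesis by auto
next
  case (Fn f ts)
  with assms obtain u where u: "u \<in> set ts" "x \<in> vars u" by auto
  then have "size (subst \<sigma> u) \<le> size_list size (map (subst \<sigma>) ts)"
    by (intro size_list_estimation'[where x = "subst \<sigma> u"]) auto
  with size_subst_ge[OF u(2), of \<sigma>] Fn show ?thesis by simp
qed (use assms in auto)

section \<open>Existence of most general unifiers\<close>

definition unifies :: "(nat \<Rightarrow> trm) \<Rightarrow> (trm \<times> trm) list \<Rightarrow> bool" where
  "unifies \<sigma> E \<longleftrightarrow> (\<forall>(s, t) \<in> set E. subst \<sigma> s = subst \<sigma> t)"

definition mgus :: "(nat \<Rightarrow> trm) \<Rightarrow> (trm \<times> trm) list \<Rightarrow> bool" where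
  "mgus \<theta> E \<longleftrightarrow> unifies \<theta> E \<and> (\<forall>\<sigma>. unifies \<sigma> E \<longrightarrow> (\<exists>\<tau>. \<forall>x. \<sigma> x = subst \<tau> (\<theta> x)))"

definition vars_eqs :: "(trm \<times> trm) list \<Rightarrow> nat set" where
  "vars_eqs E = (\<Union>(s, t) \<in> set E. vars s \<union> vars t)"

lemma finite_vars [simp]: "finite (vars t)"
  by (induction t) auto

lemma finite_vars_eqs [simp]: "finite (vars_eqs E)"
  by (auto simp: vars_eqs_def)

lemma vars_subst: "vars (subst \<sigma> t) = (\<Union>x \<in> vars t. vars (\<sigma> x))"
  by (induction t) auto

lemma mgus_cong:
  "(\<And>\<sigma>. unifies \<sigma> E \<longleftrightarrow> unifies \<sigma> E') \<Longrightarrow> mgus \<theta> E \<longleftrightarrow> mgus \<theta> E'"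
  by (simp add: mgus_def)

definition subst_eqs :: "(nat \<Rightarrow> trm) \<Rightarrow> (trm \<times> trm) list \<Rightarrow> (trm \<times> trm) list" where
  "subst_eqs \<sigma> E = map (\<lambda>(s, t). (subst \<sigma> s, subst \<sigma> t)) E"

lemma unifies_subst_eqs: "unifies \<tau> (subst_eqs \<sigma> E) \<longleftrightarrow> unifies (subst \<tau> \<circ> \<sigma>) E"
  by (auto simp: unifies_def subst_eqs_def subst_subst)

text \<open>Any solution of \<open>x = t\<close> absorbs the substitution of \<open>t\<close> for
  \<open>x\<close>. Hence it also solves the remaining equations after elimination and factors
  through their most general unifier.\<close>

lemma mgus_eliminate:
  assumes x: "x \<notin> vars t" and \<theta>: "mgus \<theta> (subst_eqs (Var(x := t)) E)"
  shows "mgus (subst \<theta> \<circ> Var(x := t)) ((Var x, t) # E)"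
proof -
  let ?s = "Var(x := t)"
  have st: "subst ?s t = t"
    using x by (subst subst_cong[where \<tau> = Var]) auto
  have absorb: "subst \<sigma> \<circ> ?s = \<sigma>" if "\<sigma> x = subst \<sigma> t" for \<sigma>
    using that by (auto simp: fun_eq_iff)
  have "unifies (subst \<theta> \<circ> ?s) ((Var x, t) # E)"
    using \<theta> st by (simp add: mgus_def unifies_subst_eqs) (simp add: unifies_def flip: subst_subst)
  moreover have "\<exists>\<tau>. \<forall>y. \<sigma> y = subst \<tau> ((subst \<theta> \<circ> ?s) y)" if "unifies \<sigma> ((Var x, t) # E)" for \<sigma>
  proof -
    have \<sigma>: "subst \<sigma> \<circ> ?s = \<sigma>"
      using that by (intro absorb) (simp add: unifies_def)
    moreover have "unifies \<sigma> E"
      using that by (simp add: unifies_def)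
    ultimately obtain \<tau> where \<tau>: "\<And>y. \<sigma> y = subst \<tau> (\<theta> y)"
      using \<theta> unfolding mgus_def unifies_subst_eqs by metis
    then have "\<sigma> = subst \<tau> \<circ> \<theta>" by auto
    with \<sigma> show ?thesis
      by (metis comp_apply subst_subst)
  qed
  ultimately show ?thesis
    by (auto simp: mgus_def)
qed

lemma card_vars_eliminate:
  assumes "x \<notin> vars t"
  shows "card (vars_eqs (subst_eqs (Var(x := t)) E)) < card (vars_eqs ((Var x, t) # E))"
proof (rule psubset_card_mono)
  have "x \<notin> vars_eqs (subst_eqs (Var(x := t)) E)"
    using assms by (auto simp: vars_eqs_def subst_eqs_def vars_subst split: if_splits)
  moreover have "vars_eqs (subst_eqs (Var(x := t)) E) \<subseteq> vars_eqs ((Var x, t) # E)"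
    by (force simp: vars_eqs_def subst_eqs_def vars_subst split: if_splits)
  ultimately show "vars_eqs (subst_eqs (Var(x := t)) E) \<subset> vars_eqs ((Var x, t) # E)"
    by (auto simp: vars_eqs_def)
qed simp

text \<open>\<open>Suc\<close> weighs the equation itself, so that dropping a trivial one counts as
  progress whatever its sides.\<close>

abbreviation size_eqs :: "(trm \<times> trm) list \<Rightarrow> nat" where
  "size_eqs E \<equiv> sum_list (map (\<lambda>(s, t). Suc (size s + size t)) E)"

lemma size_eqs_zip:
  "length ts = length us \<Longrightarrow> size_eqs (zip ts us) \<le> size_list size ts + size_list size us"
  by (induction ts us rule: list_induct2) auto

text \<open>Elimination lowers the number of variables; decomposition adds none and lowers the total
  size. A clash of symbols or a failed occurs check would contradict the assumed unifier.\<close>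

lemma mgus_exists: "unifies \<sigma> E \<Longrightarrow> \<exists>\<theta>. mgus \<theta> E"
proof (induction E arbitrary: \<sigma>
    rule: wf_induct_rule[OF wf_measures[of "[\<lambda>E. card (vars_eqs E), size_eqs]"]])
  case (1 E)
  note IH = 1(1) and uni = 1(2)
  show ?case
  proof (cases E)
    case Nil
    then have "mgus Var E" by (auto simp: mgus_def unifies_def)
    then show ?thesis by blast
  next
    case (Cons e F)
    obtain s t where e: "e = (s, t)" by (cases e)
    have st: "subst \<sigma> s = subst \<sigma> t" and F: "unifies \<sigma> F"
      using uni Cons e by (auto simp: unifies_def)
    \<comment> \<open>Formulated up to equivalence of equations, so that it applies to a variable on
      either side.\<close>
    have eliminate: "\<exists>\<theta>. mgus \<theta> E" if E: "\<And>\<sigma>. unifies \<sigma> E \<longleftrightarrow> unifies \<sigma> ((Var x, u) # F)"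
      and V: "vars_eqs E = vars_eqs ((Var x, u) # F)" and x: "x \<notin> vars u" for x u
    proof -
      have u: "\<sigma> x = subst \<sigma> u" using uni E by (simp add: unifies_def)
      then have "subst \<sigma> \<circ> Var(x := u) = \<sigma>" by (auto simp: fun_eq_iff)
      with F have "unifies \<sigma> (subst_eqs (Var(x := u)) F)"
        by (simp add: unifies_subst_eqs)
      moreover have "(subst_eqs (Var(x := u)) F, E) \<in> measures [\<lambda>E. card (vars_eqs E), size_eqs]"
        using card_vars_eliminate[OF x, of F] by (simp add: V)
      ultimately obtain \<theta> where "mgus \<theta> (subst_eqs (Var(x := u)) F)"
        using IH by blast
      from mgus_eliminate[OF x this] show ?thesis
        using mgus_cong[OF E] by blast
    qed
    have decompose: "\<exists>\<theta>. mgus \<theta> E" if E: "\<And>\<sigma>. unifies \<sigma> E \<longleftrightarrow> unifies \<sigma> E'"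
      and V: "vars_eqs E' \<subseteq> vars_eqs E" and less: "size_eqs E' < size_eqs E" for E'
    proof -
      have "card (vars_eqs E') \<le> card (vars_eqs E)" by (intro card_mono V) simp
      with less have "(E', E) \<in> measures [\<lambda>E. card (vars_eqs E), size_eqs]" by auto
      then show ?thesis using IH uni E mgus_cong[of E E'] by blast
    qed
    have occurs: "x \<notin> vars u" if "\<sigma> x = subst \<sigma> u" "u \<noteq> Var x" for x u
      using size_subst_gt[of x u \<sigma>] that by auto
    show ?thesis
    proof (cases "s = t")
      case True
      show ?thesis
        by (rule decompose[of F]) (auto simp: Cons e True unifies_def vars_eqs_def)
    next
      case neq: False
      show ?thesis
      proof (cases s)
        case (Var x)
        then show ?thesis
          using eliminate[of x t] occurs[of x t] st neq Cons e by auto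
      next
        case s: (Cst c)
        show ?thesis
        proof (cases t)
          case (Var x)
          then have "x \<notin> vars s" using occurs[of x s] st neq by auto
          then show ?thesis
            by (intro eliminate[of x s]) (auto simp: Var Cons e unifies_def vars_eqs_def)
        qed (use s st neq in auto)
      next
        case s: (Bul a b)
        show ?thesis
        proof (cases t)
          case (Var x)
          then have "x \<notin> vars s" using occurs[of x s] st neq by auto
          then show ?thesis
            by (intro eliminate[of x s]) (auto simp: Var Cons e unifies_def vars_eqs_def)
        next
          case t: (Bul a' b')
          show ?thesis
            by (rule decompose[of "(a, a') # (b, b') # F"])
              (auto simp: Cons e s t unifies_def vars_eqs_def)
        qed (use s st in auto)
      next
        case s: (Fn f ts)
        show ?thesis
        proof (cases t)
          case (Var x)
          then have "x \<notin> vars s" using occurs[of x s] st neq by auto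
          then show ?thesis
            by (intro eliminate[of x s]) (auto simp: Var Cons e unifies_def vars_eqs_def)
        next
          case t: (Fn f' us)
          have f: "f = f'" and map: "map (subst \<sigma>) ts = map (subst \<sigma>) us"
            using st s t by auto
          then have len: "length ts = length us" by (metis length_map)
          show ?thesis
          proof (rule decompose[of "zip ts us @ F"])
            show "unifies \<tau> E \<longleftrightarrow> unifies \<tau> (zip ts us @ F)" for \<tau>
              using len by (auto simp: Cons e s t f unifies_def list_eq_iff_nth_eq set_zip)
            show "vars_eqs (zip ts us @ F) \<subseteq> vars_eqs E"
              by (auto simp: Cons e s t vars_eqs_def dest: set_zip_leftD set_zip_rightD)
            show "size_eqs (zip ts us @ F) < size_eqs E"
              using size_eqs_zip[OF len] by (simp add: Cons e s t)
          qed
        qed (use s st in auto)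
      qed
    qed
  qed
qed

lemma mgu_exists:
  assumes "unifier \<sigma> s t"
  shows "\<exists>\<theta>. mgu \<theta> s t"
  using mgus_exists[of \<sigma> "[(s, t)]"] assms by (simp add: mgus_def mgu_def unifies_def unifier_def)

text \<open>Relations run from input to output, so that a product of flows, which applies its right
factor first, becomes a relational composition in the opposite order.\<close>

definition sem_flow :: "flow \<Rightarrow> (trm \<times> trm) set" where
  "sem_flow f = {(subst \<sigma> (snd f), subst \<sigma> (fst f)) | \<sigma>. True}"

definition sem :: "wiring \<Rightarrow> (trm \<times> trm) set" where
  "sem F = (\<Union>f\<in>F. sem_flow f)"

text \<open>The unifier picked by \<open>SOME\<close> does not matter: every common instance factors
  through it, and each of its instances is a common one.\<close>

lemma sem_flow_fprod:
  "sem_flow g O sem_flow f = (case fprod f g of Some h \<Rightarrow> sem_flow h | None \<Rightarrow> {})"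
proof -
  let ?u = "rename ev (fst f)" and ?v = "rename ev (snd f)"
  let ?t = "rename od (fst g)" and ?w = "rename od (snd g)"
  let ?\<theta> = "SOME \<theta>. mgu \<theta> ?v ?t"
  have glue: "\<exists>\<sigma>. unifier \<sigma> ?v ?t \<and> x = subst \<sigma> ?w \<and> z = subst \<sigma> ?u"
    if xz: "(x, z) \<in> sem_flow g O sem_flow f" for x z
  proof -
    obtain \<sigma>1 \<sigma>2 where \<sigma>: "x = subst \<sigma>1 (snd g)" "subst \<sigma>1 (fst g) = subst \<sigma>2 (snd f)"
      "z = subst \<sigma>2 (fst f)"
      using xz by (auto simp: sem_flow_def)
    \<comment> \<open>The factors are renamed apart by parity, so instances chosen independently for
      them combine into one substitution.\<close>
    define \<sigma> where "\<sigma> n = (if even n then \<sigma>2 (n div 2) else \<sigma>1 (n div 2))" for n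
    have "\<sigma> \<circ> ev = \<sigma>2" "\<sigma> \<circ> od = \<sigma>1"
      by (auto simp: \<sigma>_def ev_def od_def fun_eq_iff)
    with \<sigma> show ?thesis
      by (intro exI[of _ \<sigma>]) (auto simp: unifier_def subst_rename)
  qed
  have split: "(subst \<sigma> ?w, subst \<sigma> ?u) \<in> sem_flow g O sem_flow f" if "unifier \<sigma> ?v ?t" for \<sigma>
    using that by (fastforce simp: sem_flow_def unifier_def subst_rename)
  show ?thesis
  proof (cases "\<exists>\<sigma>. unifier \<sigma> ?v ?t")
    case True
    then have \<theta>: "mgu ?\<theta> ?v ?t"
      using mgu_exists someI_ex by metis
    have "(x, z) \<in> sem_flow (subst ?\<theta> ?u, subst ?\<theta> ?w)" if "(x, z) \<in> sem_flow g O sem_flow f" for x z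
    proof -
      obtain \<sigma> where \<sigma>: "unifier \<sigma> ?v ?t" "x = subst \<sigma> ?w" "z = subst \<sigma> ?u"
        using glue[OF \<open>(x, z) \<in> _\<close>] by blast
      with \<theta> obtain \<tau> where "\<And>n. \<sigma> n = subst \<tau> (?\<theta> n)"
        unfolding mgu_def by blast
      then have "\<sigma> = subst \<tau> \<circ> ?\<theta>" by auto
      with \<sigma> show ?thesis
        by (auto simp: sem_flow_def subst_subst)
    qed
    moreover have "(x, z) \<in> sem_flow g O sem_flow f"
      if "(x, z) \<in> sem_flow (subst ?\<theta> ?u, subst ?\<theta> ?w)" for x z
    proof -
      from that obtain \<tau> where "x = subst \<tau> (subst ?\<theta> ?w)" "z = subst \<tau> (subst ?\<theta> ?u)"
        unfolding sem_flow_def by auto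
      then have "x = subst (subst \<tau> \<circ> ?\<theta>) ?w" "z = subst (subst \<tau> \<circ> ?\<theta>) ?u"
        by (simp_all add: subst_subst)
      moreover have "unifier (subst \<tau> \<circ> ?\<theta>) ?v ?t"
        using \<theta> by (auto simp: mgu_def unifier_def simp flip: subst_subst)
      ultimately show ?thesis using split by blast
    qed
    ultimately show ?thesis
      using True by (auto simp: fprod_def Let_def)
  next
    case False
    then show ?thesis
      using glue by (fastforce simp: fprod_def Let_def)
  qed
qed

lemma sem_wprod: "sem (wprod F G) = sem G O sem F"
proof -
  have "sem (wprod F G) = (\<Union>f\<in>F. \<Union>g\<in>G. case fprod f g of Some h \<Rightarrow> sem_flow h | None \<Rightarrow> {})"
    by (fastforce simp: sem_def wprod_def split: option.splits)
  also have "\<dots> = sem G O sem F"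
    unfolding sem_flow_fprod[symmetric] by (auto simp: sem_def)
  finally show ?thesis .
qed

lemma sem_wpow: "sem (wpow F n) = sem F ^^ n"
proof (induction n)
  case 0
  have "(x, x) \<in> sem_flow (Var 0, Var 0)" for x
    by (auto simp: sem_flow_def intro: exI[of _ "\<lambda>_. x"])
  then show ?case
    by (auto simp: sem_def unit_wiring_def sem_flow_def)
qed (simp add: sem_wprod)

text \<open>Every flow has an instance. This carries nilpotency over to powers of relations.\<close>

lemma sem_empty_iff: "sem F = {} \<longleftrightarrow> F = {}"
  by (auto simp: sem_def sem_flow_def)

lemma nilpotent_iff: "nilpotent F \<longleftrightarrow> (\<exists>n. sem F ^^ n = {})"
  by (metis nilpotent_def sem_empty_iff sem_wpow)

text \<open>A closed term is fixed by the unifier, so the product yields an output of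
  \<open>sem F\<close> on that very term.\<close>

lemma wprod_fact:
  assumes u: "closed_trm u" and h: "h \<in> wprod F {fact u}"
  shows "(u, fst h) \<in> sem F \<and> snd h = Cst Star"
proof -
  obtain f where f: "f \<in> F" "fprod f (fact u) = Some h"
    using h by (auto simp: wprod_def)
  have closed: "subst \<sigma> (rename od u) = u" for \<sigma>
    using u subst_cong[of u "\<sigma> \<circ> od" Var] by (simp add: subst_rename closed_trm_def)
  have "\<exists>\<sigma>. unifier \<sigma> (rename ev (snd f)) (rename od u)"
    using f by (auto simp: fprod_def fact_def Let_def split: if_splits)
  moreover define \<theta> where "\<theta> = (SOME \<theta>. mgu \<theta> (rename ev (snd f)) (rename od u))"
  ultimately have "mgu \<theta> (rename ev (snd f)) (rename od u)"
    using mgu_exists someI_ex by metis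
  then have "subst \<theta> (rename ev (snd f)) = u"
    using closed by (simp add: mgu_def unifier_def)
  moreover have "h = (subst \<theta> (rename ev (fst f)), Cst Star)"
    using f by (auto simp: fprod_def fact_def Let_def \<theta>_def rename_def split: if_splits)
  ultimately show ?thesis
    using f by (auto simp: sem_def sem_flow_def subst_rename)
qed

lemma deterministicI:
  assumes "\<And>x y z. (x, y) \<in> sem F \<Longrightarrow> (x, z) \<in> sem F \<Longrightarrow> y = z"
  shows "deterministic F"
  unfolding deterministic_def
proof (intro allI impI)
  fix u assume u: "closed_trm u"
  have "h = h'" if "h \<in> wprod F {fact u}" "h' \<in> wprod F {fact u}" for h h'
    using wprod_fact[OF u that(1)] wprod_fact[OF u that(2)] assms by (metis prod_eqI)
  then have "\<exists>h. wprod F {fact u} \<subseteq> {h}"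
    by blast
  then show "card (wprod F {fact u}) \<le> 1"
    by (auto dest!: subset_singletonD)
qed

lemma sem_flow_ftensor_Cst:
  "sem_flow (ftensor (Cst c, Cst c') f) = {(Cst c' \<bullet> x, Cst c \<bullet> y) | x y. (x, y) \<in> sem_flow f}"
proof -
  \<comment> \<open>\<open>od\<close> has the left inverse \<open>n div 2\<close>, so renaming by it
    loses no instances.\<close>
  have "(\<lambda>n. \<sigma> (n div 2)) \<circ> od = \<sigma>" for \<sigma> :: "nat \<Rightarrow> trm"
    by (auto simp: od_def)
  then have "(subst \<sigma> (snd f), subst \<sigma> (fst f)) \<in> sem_flow (rename od (fst f), rename od (snd f))" for \<sigma>
    unfolding sem_flow_def fst_conv snd_conv subst_rename
    by (intro CollectI exI[of _ "\<lambda>n. \<sigma> (n div 2)"]) simp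
  then have "sem_flow (rename od (fst f), rename od (snd f)) = sem_flow f"
    by (auto simp: sem_flow_def subst_rename)
  moreover have "sem_flow (ftensor (Cst c, Cst c') f) =
      {(Cst c' \<bullet> x, Cst c \<bullet> y) | x y. (x, y) \<in> sem_flow (rename od (fst f), rename od (snd f))}"
    by (auto simp: sem_flow_def ftensor_def rename_def[of ev])
  ultimately show ?thesis by simp
qed

section \<open>Multihead automata as observations\<close>

definition letter :: "con list \<Rightarrow> nat \<Rightarrow> con" where
  "letter w x = (if x = 0 then Star else w ! (x - 1))"

definition mv :: "nat \<Rightarrow> bool \<Rightarrow> nat \<Rightarrow> nat" where
  "mv N d x = (if d then Suc x mod N else (x + N - 1) mod N)"

text \<open>A clockwise move leaves a cell through \<open>L\<close> and enters the next one at
  \<open>R\<close>; the opposite move leaves through \<open>R\<close> and enters at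
  \<open>L\<close>.\<close>

definition port :: "bool \<Rightarrow> con" where
  "port d = (if d then CL else CR)"

abbreviation pos :: "nat list \<Rightarrow> nat \<Rightarrow> trm" where
  "pos p x \<equiv> Cst (Pos (p ! x))"

lemma mv_less [simp]: "0 < N \<Longrightarrow> mv N d x < N"
  by (simp add: mv_def)

lemma letter_in: "set w \<subseteq> A \<Longrightarrow> x < Suc (length w) \<Longrightarrow> letter w x \<in> insert Star A"
  by (auto simp: letter_def subset_iff)

lemma letter_eq_Star:
  "set w \<subseteq> A \<Longrightarrow> Star \<notin> A \<Longrightarrow> x < Suc (length w) \<Longrightarrow> letter w x = Star \<longleftrightarrow> x = 0"
  by (cases x) (use nth_mem in \<open>fastforce simp: letter_def\<close>)+

lemma port_inject [simp]: "port d = port d' \<longleftrightarrow> d = d'"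
  by (simp add: port_def)

lemma mv_mv:
  assumes "x < N"
  shows "mv N (\<not> d) (mv N d x) = x"
proof (cases d)
  case True
  with assms show ?thesis
    by (cases "Suc x = N") (auto simp: mv_def)
next
  case False
  with assms show ?thesis
    by (cases x) (auto simp: mv_def)
qed

lemma sem_both: "sem (both t u) =
    {(subst \<sigma> u, subst \<sigma> t) | \<sigma>. True} \<union> {(subst \<sigma> t, subst \<sigma> u) | \<sigma>. True}"
  by (auto simp: sem_def both_def sem_flow_def)

lemma wordrep_eq:
  assumes "length p = Suc (length w)"
  shows "wordrep w p = (\<Union>x\<le>length w.
    both (Cst (letter w x) \<bullet> Cst CL \<bullet> Var 0 \<bullet> Var 1 \<bullet> MM (pos p x))
      (Cst (letter w (mv (Suc (length w)) True x)) \<bullet> Cst CR \<bullet> Var 0 \<bullet> Var 1 \<bullet>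
        MM (pos p (mv (Suc (length w)) True x))))"
proof -
  have *: "letter w (mv (Suc (length w)) True x) = (if x = length w then Star else w ! x)"
    "mv (Suc (length w)) True x = (if x = length w then 0 else Suc x)" if "x \<le> length w" for x
    using that by (auto simp: letter_def mv_def)
  show ?thesis
    unfolding wordrep_def Let_def atLeast0AtMost
    by (rule SUP_cong) (auto simp: * letter_def)
qed

lemma sem_wordrep:
  fixes w p
  defines "N \<equiv> Suc (length w)"
  assumes p: "length p = N"
  shows "sem (wordrep w p) = {(Cst (letter w x) \<bullet> Cst (port d) \<bullet> X \<bullet> Y \<bullet> MM (pos p x),
      Cst (letter w (mv N d x)) \<bullet> Cst (port (\<not> d)) \<bullet> X \<bullet> Y \<bullet> MM (pos p (mv N d x)))
      | x d X Y. x < N}" (is "_ = ?R")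
proof -
  let ?t = "\<lambda>d x X Y. Cst (letter w x) \<bullet> Cst (port d) \<bullet> X \<bullet> Y \<bullet> MM (pos p x)"
  have inv: "mv N False (mv N True x) = x" "mv N True (mv N False x) = x" if "x < N" for x
    using mv_mv[OF that, of True] mv_mv[OF that, of False] by simp_all
  have inst: "{(subst \<sigma> t, subst \<sigma> u) | \<sigma>. True} =
      {(?t d x X Y, ?t d' y X Y) | X Y. True}"
    if "t = ?t d x (Var 0) (Var 1)" "u = ?t d' y (Var 0) (Var 1)" for t u d d' x y
  proof -
    have "\<exists>\<sigma>. (?t d x X Y, ?t d' y X Y) = (subst \<sigma> t, subst \<sigma> u)" for X Y
      by (rule exI[of _ "\<lambda>n. if n = 0 then X else Y"]) (simp add: that MM_def)
    moreover have "\<exists>X Y. (subst \<sigma> t, subst \<sigma> u) = (?t d x X Y, ?t d' y X Y)" for \<sigma>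
      by (simp add: that MM_def)
    ultimately show ?thesis by blast
  qed
  have "sem (wordrep w p) = (\<Union>x\<le>length w. sem (both (?t True x (Var 0) (Var 1))
      (?t False (mv N True x) (Var 0) (Var 1))))"
    using p by (simp add: wordrep_eq sem_def N_def port_def)
  also have "\<dots> = (\<Union>x<N. {(?t True x X Y, ?t False (mv N True x) X Y) | X Y. True} \<union>
      {(?t False (mv N True x) X Y, ?t True x X Y) | X Y. True})"
    unfolding sem_both inst[OF refl refl] by (auto simp: N_def less_Suc_eq_le)
  also have "\<dots> = ?R" (is "?L = _")
  proof
    show "?L \<subseteq> ?R"
    proof
      fix z assume "z \<in> ?L"
      then obtain x X Y where x: "x < N" and z: "z = (?t True x X Y, ?t False (mv N True x) X Y) \<or>
          z = (?t False (mv N True x) X Y, ?t True x X Y)"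
        by blast
      from z show "z \<in> ?R"
      proof
        assume "z = (?t True x X Y, ?t False (mv N True x) X Y)"
        then show ?thesis
          using x by (intro CollectI exI[of _ x] exI[of _ True] exI[of _ X] exI[of _ Y]) simp
      next
        assume "z = (?t False (mv N True x) X Y, ?t True x X Y)"
        then show ?thesis
          using x inv by (intro CollectI exI[of _ "mv N True x"] exI[of _ False] exI[of _ X] exI[of _ Y])
            (simp add: N_def)
      qed
    qed
    show "?R \<subseteq> ?L"
    proof
      fix z assume "z \<in> ?R"
      then obtain x d X Y where x: "x < N" and z: "z = (?t d x X Y, ?t (\<not> d) (mv N d x) X Y)"
        by blast
      show "z \<in> ?L"
      proof (cases d)
        case True
        with x z show ?thesis by auto
      next
        case False
        then have "z \<in> {(?t False (mv N True (mv N False x)) X Y, ?t True (mv N False x) X Y) | X Y. True}"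
          using x z inv by auto
        moreover have "mv N False x < N" by (simp add: N_def)
        ultimately show ?thesis by blast
      qed
    qed
  qed
  finally show ?thesis .
qed

type_synonym 's program = "'s \<Rightarrow> con list \<Rightarrow> ('s \<times> nat \<times> bool) set"

text \<open>A head remembers the letter it claims to read; a register may hold any term. A step
requires the moved head to stand on a position and its remembered letter to be correct, but the
other heads may be in an impossible state, as nilpotency concerns arbitrary terms.\<close>

definition gstep ::
  "con list \<Rightarrow> nat list \<Rightarrow> 's program \<Rightarrow> (('s \<times> con list \<times> trm list) \<times> ('s \<times> con list \<times> trm list)) set"
where
  "gstep w p wk = {((s, l, r), (s', l', r')). \<exists>j d x. (s', j, d) \<in> wk s l \<and>
     x < Suc (length w) \<and> r ! j = pos p x \<and> l ! j = letter w x \<and>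
     l' = l[j := letter w (mv (Suc (length w)) d x)] \<and> r' = r[j := pos p (mv (Suc (length w)) d x)]}"

lemma set_list_update_subset:
  "set l \<subseteq> A \<Longrightarrow> c \<in> A \<Longrightarrow> set (l[j := c]) \<subseteq> A"
  using set_update_subset_insert[of l j c] by blast

lemma relpow_swap: "(A O B) ^^ Suc n = A O (B O A) ^^ n O B"
proof (induction n)
  case (Suc n)
  have "(A O B) ^^ Suc (Suc n) = (A O (B O A) ^^ n O B) O (A O B)"
    using Suc by simp
  then show ?case by (auto simp: O_assoc)
qed auto

text \<open>Chains of \<open>A O B\<close> and \<open>B O A\<close> differ only at their ends. This
  allows steps to be cut at arrivals instead of departures.\<close>

lemma relpow_empty_swap:
  assumes "(A O B) ^^ n = {}"
  shows "(B O A) ^^ Suc n = {}"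
  using relpow_swap[where A = B and B = A and n = n] assms by simp

locale mha =
  fixes Sig :: "con set" and S :: "'s set" and m :: nat and wk :: "'s program"
  assumes finite_Sig: "finite Sig" and Star: "Star \<notin> Sig" and finite_S: "finite S"
    and wk_closed: "\<lbrakk>s \<in> S; length l = m; set l \<subseteq> insert Star Sig; (s', j, d) \<in> wk s l\<rbrakk> \<Longrightarrow> s' \<in> S \<and> j < m"
begin

section \<open>Encoding a multihead automaton as an observation\<close>

definition cfg :: "('s \<times> con list \<times> trm list) set" where
  "cfg = {(s, l, r). s \<in> S \<and> length l = m \<and> set l \<subseteq> insert Star Sig \<and> length r = m}"

text \<open>A move announced but not yet made: the control is already in state \<open>s\<close>,
  while \<open>l\<close> still holds the old letter of head \<open>j\<close>.\<close>

definition pend :: "(con list \<times> 's \<times> nat \<times> bool) set" where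
  "pend = {(l, s, j, d). length l = m \<and> set l \<subseteq> insert Star Sig \<and> s \<in> S \<and> j < m}"

text \<open>An observation offers one state constant, so the whole finite control, remembered
  letters included, is packed into one number.\<close>

definition code :: "con list \<times> 's \<times> nat \<times> bool \<Rightarrow> nat" where
  "code = (SOME f. inj_on f pend)"

lemma finite_pend: "finite pend"
proof (rule finite_subset)
  show "pend \<subseteq> {l. set l \<subseteq> insert Star Sig \<and> length l = m} \<times> S \<times> {..<m} \<times> UNIV"
    by (auto simp: pend_def)
  show "finite ({l. set l \<subseteq> insert Star Sig \<and> length l = m} \<times> S \<times> {..<m} \<times> (UNIV :: bool set))"
    using finite_Sig finite_S by (intro finite_cartesian_product finite_lists_length_eq) auto
qed

lemma inj_on_code: "inj_on code pend"
proof -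
  have "\<exists>f :: con list \<times> 's \<times> nat \<times> bool \<Rightarrow> nat. inj_on f pend"
    using finite_imp_inj_to_nat_seg[OF finite_pend] by blast
  then show ?thesis unfolding code_def by (rule someI_ex)
qed

text \<open>Every register has height 2, whichever of them is exposed under \<open>M\<close>, so
  exchanging the exposed one is a balanced flow. The others form the term that the word carries
  along as its variable \<open>y\<close>.\<close>

definition regs_term :: "nat \<Rightarrow> (nat \<Rightarrow> trm) \<Rightarrow> trm" where
  "regs_term j f = Fn 1 (map f (filter (\<lambda>i. i \<noteq> j) [0..<m])) \<bullet> MM (f j)"

lemma subst_regs_term: "subst \<sigma> (regs_term j Var) = regs_term j \<sigma>"
  by (simp add: regs_term_def MM_def comp_def)

lemma regs_term_eq_iff: "j < m \<Longrightarrow> regs_term j f = regs_term j g \<longleftrightarrow> (\<forall>i<m. f i = g i)"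
  by (auto simp: regs_term_def MM_def)

text \<open>One passage through the observation: the moved head arrives on the letter
  \<open>c\<close>, which replaces the remembered one, and the program announces the next
  move.\<close>

definition transitions ::
  "((con list \<times> 's \<times> nat \<times> bool) \<times> con \<times> (con list \<times> 's \<times> nat \<times> bool)) set" where
  "transitions = {((l, s, j, d), c, (l', s', j', d')). (l, s, j, d) \<in> pend \<and> c \<in> insert Star Sig \<and>
     l' = l[j := c] \<and> (s', j', d') \<in> wk s l'}"

lemma transitions_subset: "transitions \<subseteq> pend \<times> insert Star Sig \<times> pend"
proof
  fix \<tau> assume "\<tau> \<in> transitions"
  then obtain l s j d c s' j' d' where \<tau>: "\<tau> = ((l, s, j, d), c, (l[j := c], s', j', d'))"
    and *: "(l, s, j, d) \<in> pend" "c \<in> insert Star Sig" "(s', j', d') \<in> wk s (l[j := c])"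
    unfolding transitions_def by blast
  then have "length (l[j := c]) = m" "set (l[j := c]) \<subseteq> insert Star Sig" "s \<in> S"
    using set_list_update_subset[of l "insert Star Sig" c j] by (auto simp: pend_def)
  with wk_closed[OF _ _ _ *(3)] * show "\<tau> \<in> pend \<times> insert Star Sig \<times> pend"
    by (simp add: \<tau> pend_def)
qed

lemma finite_transitions: "finite transitions"
  by (rule finite_subset[OF transitions_subset]) (use finite_pend finite_Sig in auto)

text \<open>The output must show the letter of the cell that head \<open>j'\<close> leaves; it is
  taken from memory, as a hidden register cannot be inspected. The input port is
  \<open>\<not> d\<close> because a move in direction \<open>d\<close> arrives at the opposite
  port.\<close>

fun obs_flow ::
  "(con list \<times> 's \<times> nat \<times> bool) \<times> con \<times> (con list \<times> 's \<times> nat \<times> bool) \<Rightarrow> wiring" where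
  "obs_flow ((l, s, j, d), c, (l', s', j', d')) =
     wtensor {(Cst (l' ! j'), Cst c)} (wtensor {(Cst (port d'), Cst (port (\<not> d)))}
       (wtensor {(Cst (St (code (l', s', j', d'))), Cst (St (code (l, s, j, d))))}
         {(regs_term j' Var, regs_term j Var)}))"

definition observation :: wiring where
  "observation = (\<Union>\<tau>\<in>transitions. obs_flow \<tau>)"

lemma stensor_UN:
  assumes "finite I" "\<And>i. i \<in> I \<Longrightarrow> X i \<in> A \<and> Y i \<in> B"
  shows "(\<Union>i\<in>I. wtensor (X i) (Y i)) \<in> stensor A B"
  unfolding stensor_def
  by (intro CollectI exI[of _ "(\<lambda>i. (X i, Y i)) ` I"]) (use assms in auto)

lemma stensor_wtensor: "X \<in> A \<Longrightarrow> Y \<in> B \<Longrightarrow> wtensor X Y \<in> stensor A B"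
  using stensor_UN[of "{()}" "\<lambda>_. X" A "\<lambda>_. Y" B] by simp

lemma regs_flow_balanced:
  assumes "j < m" "j' < m"
  shows "{(regs_term j' Var, regs_term j Var)} \<in> RP Bal"
proof -
  have "occs (regs_term i Var) = {..<m} \<times> {2}" if "i < m" for i
    using that by (fastforce simp: regs_term_def MM_def image_iff)
  moreover have "vars (regs_term i Var) = {..<m}" if "i < m" for i
    using that by (auto simp: regs_term_def MM_def)
  moreover have "cons_of (regs_term i Var) = {}" for i
    by (auto simp: regs_term_def MM_def)
  ultimately show ?thesis
    using assms by (simp add: RP_def Bal_def is_wiring_def is_flow_def balanced_def)
qed

lemma observation_in_Matr: "observation \<in> Matr Sig Obs"
proof -
  have "\<exists>X Y. obs_flow \<tau> = wtensor X Y \<and> X \<in> Cw (Sig \<union> {Star}) \<and> Y \<in> stensor (Cw {CL, CR}) Obs"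
    if \<tau>: "\<tau> \<in> transitions" for \<tau>
  proof -
    obtain l s j d c l' s' j' d' where eq: "\<tau> = ((l, s, j, d), c, (l', s', j', d'))"
      using prod_cases4 by (metis surj_pair)
    have *: "(l, s, j, d) \<in> pend" "c \<in> insert Star Sig" "(l', s', j', d') \<in> pend"
      using subsetD[OF transitions_subset \<tau>] by (auto simp: eq)
    then have "set l' \<subseteq> insert Star Sig" "j' < length l'"
      by (auto simp: pend_def)
    then have "l' ! j' \<in> insert Star Sig"
      using nth_mem by blast
    with * have 1: "{(Cst (l' ! j'), Cst c)} \<in> Cw (Sig \<union> {Star})"
      by (auto simp: Cw_def)
    have 2: "{(Cst (port d'), Cst (port (\<not> d)))} \<in> Cw {CL, CR}"
      by (auto simp: Cw_def port_def)
    have 3: "{(Cst (St k), Cst (St k'))} \<in> Cw (range St)" for k k'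
      by (auto simp: Cw_def)
    have 4: "{(regs_term j' Var, regs_term j Var)} \<in> RP Bal"
      using * by (intro regs_flow_balanced) (auto simp: pend_def)
    show ?thesis
      using 1 stensor_wtensor[OF 2 stensor_wtensor[OF 3 4]]
      unfolding Obs_def[symmetric] eq obs_flow.simps by blast
  qed
  then obtain X Y where "\<And>\<tau>. \<tau> \<in> transitions \<Longrightarrow> obs_flow \<tau> = wtensor (X \<tau>) (Y \<tau>) \<and>
      X \<tau> \<in> Cw (Sig \<union> {Star}) \<and> Y \<tau> \<in> stensor (Cw {CL, CR}) Obs"
    by metis
  then show ?thesis
    using stensor_UN[OF finite_transitions, of X _ Y] by (simp add: observation_def Matr_def)
qed

lemma sem_wtensor_Cst: "sem (wtensor {(Cst c, Cst c')} G) = {(Cst c' \<bullet> x, Cst c \<bullet> y) | x y. (x, y) \<in> sem G}"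
proof -
  have "wtensor {(Cst c, Cst c')} G = ftensor (Cst c, Cst c') ` G"
    by (auto simp: wtensor_def)
  then show ?thesis
    by (auto simp: sem_def sem_flow_ftensor_Cst)
qed

lemma sem_obs_flow: "sem (obs_flow ((l, s, j, d), c, (l', s', j', d'))) =
    {(Cst c \<bullet> Cst (port (\<not> d)) \<bullet> Cst (St (code (l, s, j, d))) \<bullet> regs_term j f,
      Cst (l' ! j') \<bullet> Cst (port d') \<bullet> Cst (St (code (l', s', j', d'))) \<bullet> regs_term j' f) | f. True}"
proof -
  have "sem {(regs_term j' Var, regs_term j Var)} = {(regs_term j f, regs_term j' f) | f. True}"
    by (auto simp: sem_def sem_flow_def subst_regs_term)
  then show ?thesis
    by (auto simp: sem_wtensor_Cst)
qed

lemma sem_observationI: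
  assumes "(l, s, j, d) \<in> pend" "c \<in> insert Star Sig" "(s', j', d') \<in> wk s (l[j := c])"
  shows "(Cst c \<bullet> Cst (port (\<not> d)) \<bullet> Cst (St (code (l, s, j, d))) \<bullet> regs_term j f,
    Cst (l[j := c] ! j') \<bullet> Cst (port d') \<bullet> Cst (St (code (l[j := c], s', j', d'))) \<bullet> regs_term j' f)
    \<in> sem observation"
proof -
  have "((l, s, j, d), c, (l[j := c], s', j', d')) \<in> transitions"
    using assms by (simp add: transitions_def)
  then have "sem (obs_flow ((l, s, j, d), c, (l[j := c], s', j', d'))) \<subseteq> sem observation"
    unfolding observation_def sem_def by blast
  then show ?thesis
    unfolding sem_obs_flow by blast
qed

lemma sem_observationE:
  assumes "(t, u) \<in> sem observation"
  obtains l s j d c s' j' d' f where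
    "(l, s, j, d) \<in> pend" "c \<in> insert Star Sig" "(s', j', d') \<in> wk s (l[j := c])"
    "t = Cst c \<bullet> Cst (port (\<not> d)) \<bullet> Cst (St (code (l, s, j, d))) \<bullet> regs_term j f"
    "u = Cst (l[j := c] ! j') \<bullet> Cst (port d') \<bullet> Cst (St (code (l[j := c], s', j', d'))) \<bullet> regs_term j' f"
proof -
  obtain \<tau> where \<tau>: "\<tau> \<in> transitions" and tu: "(t, u) \<in> sem (obs_flow \<tau>)"
    using assms unfolding observation_def sem_def by blast
  obtain l s j d c s' j' d' where eq: "\<tau> = ((l, s, j, d), c, (l[j := c], s', j', d'))"
    and *: "(l, s, j, d) \<in> pend" "c \<in> insert Star Sig" "(s', j', d') \<in> wk s (l[j := c])"
    using \<tau> unfolding transitions_def by blast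
  from tu obtain f where
    "t = Cst c \<bullet> Cst (port (\<not> d)) \<bullet> Cst (St (code (l, s, j, d))) \<bullet> regs_term j f"
    "u = Cst (l[j := c] ! j') \<bullet> Cst (port d') \<bullet> Cst (St (code (l[j := c], s', j', d'))) \<bullet> regs_term j' f"
    unfolding eq sem_obs_flow by blast
  with * show thesis by (rule that)
qed

lemma pend_update:
  assumes "(l, s, j, d) \<in> pend" "c \<in> insert Star Sig" "(s', j', d') \<in> wk s (l[j := c])"
  shows "(l[j := c], s', j', d') \<in> pend"
proof -
  have "((l, s, j, d), c, (l[j := c], s', j', d')) \<in> transitions"
    using assms by (simp add: transitions_def)
  then show ?thesis
    using transitions_subset by blast
qed

text \<open>The input term reveals the pending move, \<open>code\<close> being injective, so outputs
  can differ only through a choice made by \<open>wk\<close>.\<close>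

lemma deterministic_observation:
  assumes det: "\<And>s l x y. s \<in> S \<Longrightarrow> x \<in> wk s l \<Longrightarrow> y \<in> wk s l \<Longrightarrow> x = y"
  shows "deterministic observation"
proof (rule deterministicI)
  fix t u v assume tu: "(t, u) \<in> sem observation" and tv: "(t, v) \<in> sem observation"
  from tu obtain l s j d c s' j' d' f where *:
    "(l, s, j, d) \<in> pend" "c \<in> insert Star Sig" "(s', j', d') \<in> wk s (l[j := c])"
    "t = Cst c \<bullet> Cst (port (\<not> d)) \<bullet> Cst (St (code (l, s, j, d))) \<bullet> regs_term j f"
    "u = Cst (l[j := c] ! j') \<bullet> Cst (port d') \<bullet> Cst (St (code (l[j := c], s', j', d'))) \<bullet> regs_term j' f"
    by (rule sem_observationE)
  from tv obtain l2 s2 j2 d2 c2 s2' j2' d2' f2 where **: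
    "(l2, s2, j2, d2) \<in> pend" "c2 \<in> insert Star Sig" "(s2', j2', d2') \<in> wk s2 (l2[j2 := c2])"
    "t = Cst c2 \<bullet> Cst (port (\<not> d2)) \<bullet> Cst (St (code (l2, s2, j2, d2))) \<bullet> regs_term j2 f2"
    "v = Cst (l2[j2 := c2] ! j2') \<bullet> Cst (port d2') \<bullet> Cst (St (code (l2[j2 := c2], s2', j2', d2'))) \<bullet>
      regs_term j2' f2"
    by (rule sem_observationE)
  have "code (l, s, j, d) = code (l2, s2, j2, d2)" and [simp]: "c2 = c"
    and f: "regs_term j f = regs_term j2 f2"
    using *(4) **(4) by auto
  then have eq [simp]: "l2 = l" "s2 = s" "j2 = j" "d2 = d"
    using inj_onD[OF inj_on_code _ *(1) **(1)] by auto
  have "j < m" "s \<in> S" using *(1) by (auto simp: pend_def)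
  then have "(s2', j2', d2') = (s', j', d')" and "\<forall>i<m. f i = f2 i"
    using det[OF _ *(3)] **(3) f regs_term_eq_iff by auto
  moreover have "j' < m" using pend_update[OF *(1-3)] by (simp add: pend_def)
  ultimately show "u = v"
    using *(5) **(5) regs_term_eq_iff[of j' f f2] by simp
qed

section \<open>Automaton steps inside the product of observation and word\<close>

context
  fixes w :: "con list" and p :: "nat list"
  assumes w: "set w \<subseteq> Sig" and p: "length p = Suc (length w)"
begin

abbreviation "N \<equiv> Suc (length w)"

text \<open>A step of the product of observation and word representation runs from departure to
departure, a step of the automaton from arrival to arrival.\<close>

definition arrive :: "(trm \<times> ('s \<times> con list \<times> trm list)) set" where
  "arrive = {(u, (s, l', r')). \<exists>l j d x r. (l, s, j, d) \<in> pend \<and> length r = m \<and> x < N \<and> r ! j = pos p x \<and>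
     u = Cst (letter w x) \<bullet> Cst (port d) \<bullet> Cst (St (code (l, s, j, d))) \<bullet> regs_term j (nth r) \<and>
     l' = l[j := letter w (mv N d x)] \<and> r' = r[j := pos p (mv N d x)]}"

definition depart :: "(('s \<times> con list \<times> trm list) \<times> trm) set" where
  "depart = {((s, l, r), u). (s, l, r) \<in> cfg \<and> (\<exists>s' j d. (s', j, d) \<in> wk s l \<and>
     u = Cst (l ! j) \<bullet> Cst (port d) \<bullet> Cst (St (code (l, s', j, d))) \<bullet> regs_term j (nth r))}"

lemma arriveI:
  assumes "(l, s, j, d) \<in> pend" "length r = m" "x < N" "r ! j = pos p x"
  shows "(Cst (letter w x) \<bullet> Cst (port d) \<bullet> Cst (St (code (l, s, j, d))) \<bullet> regs_term j (nth r),
    (s, l[j := letter w (mv N d x)], r[j := pos p (mv N d x)])) \<in> arrive"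
  using assms unfolding arrive_def by blast

lemma arrive_cfg:
  assumes "(u, g) \<in> arrive"
  shows "g \<in> cfg"
proof -
  obtain s l j d x r where *: "(l, s, j, d) \<in> pend" "length r = m"
    and g: "g = (s, l[j := letter w (mv N d x)], r[j := pos p (mv N d x)])"
    using assms by (auto simp: arrive_def)
  then have "set (l[j := letter w (mv N d x)]) \<subseteq> insert Star Sig"
    using letter_in[OF w, of "mv N d x"] by (intro set_list_update_subset) (auto simp: pend_def)
  then show ?thesis
    using * by (simp add: g cfg_def pend_def)
qed

lemma depart_arrive: "depart O arrive = {(g, g') \<in> gstep w p wk. g \<in> cfg}"
proof (intro set_eqI iffI)
  fix z assume "z \<in> depart O arrive"
  then obtain s l r u g' where z: "z = ((s, l, r), g')" and dep: "((s, l, r), u) \<in> depart" and "(u, g') \<in> arrive"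
    by (metis relcompE surj_pair)
  then obtain s' j d where c: "(s, l, r) \<in> cfg" and wk: "(s', j, d) \<in> wk s l"
    and u: "u = Cst (l ! j) \<bullet> Cst (port d) \<bullet> Cst (St (code (l, s', j, d))) \<bullet> regs_term j (nth r)"
    by (auto simp: depart_def)
  have pnd: "(l, s', j, d) \<in> pend" and j: "j < m"
    using c wk wk_closed by (auto simp: pend_def cfg_def)
  obtain s2 l2 j2 d2 x r2 where *: "(l2, s2, j2, d2) \<in> pend" "length r2 = m" "x < N" "r2 ! j2 = pos p x"
    "u = Cst (letter w x) \<bullet> Cst (port d2) \<bullet> Cst (St (code (l2, s2, j2, d2))) \<bullet> regs_term j2 (nth r2)"
    "g' = (s2, l2[j2 := letter w (mv N d2 x)], r2[j2 := pos p (mv N d2 x)])"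
    using \<open>(u, g') \<in> arrive\<close> by (auto simp: arrive_def)
  have "code (l, s', j, d) = code (l2, s2, j2, d2)" and lj: "l ! j = letter w x"
    and regs: "regs_term j (nth r) = regs_term j2 (nth r2)"
    using u *(5) by auto
  then have [simp]: "l2 = l" "s2 = s'" "j2 = j" "d2 = d"
    using inj_onD[OF inj_on_code _ pnd *(1)] by auto
  have "r2 = r"
    using regs j c *(2) by (auto simp: regs_term_eq_iff cfg_def intro: nth_equalityI)
  then show "z \<in> {(g, g') \<in> gstep w p wk. g \<in> cfg}"
    using c wk lj * by (auto simp: z gstep_def)
next
  fix z assume "z \<in> {(g, g') \<in> gstep w p wk. g \<in> cfg}"
  then obtain s l r s' j d x where *: "(s, l, r) \<in> cfg" "(s', j, d) \<in> wk s l" "x < N" "r ! j = pos p x"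
    "l ! j = letter w x" and z: "z = ((s, l, r), (s', l[j := letter w (mv N d x)], r[j := pos p (mv N d x)]))"
    unfolding gstep_def by blast
  let ?u = "Cst (l ! j) \<bullet> Cst (port d) \<bullet> Cst (St (code (l, s', j, d))) \<bullet> regs_term j (nth r)"
  have "(l, s', j, d) \<in> pend"
    using * wk_closed by (auto simp: pend_def cfg_def)
  then have "(?u, (s', l[j := letter w (mv N d x)], r[j := pos p (mv N d x)])) \<in> arrive"
    using arriveI[of l s' j d r x] * by (simp add: cfg_def)
  moreover have "((s, l, r), ?u) \<in> depart"
    using * unfolding depart_def by blast
  ultimately show "z \<in> depart O arrive"
    unfolding z by blast
qed

lemma sem_product: "sem (wprod observation (wordrep w p)) = arrive O depart"
  unfolding sem_wprod sem_wordrep[OF p]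
proof (intro set_eqI iffI)
  fix z assume "z \<in> {(Cst (letter w x) \<bullet> Cst (port d) \<bullet> X \<bullet> Y \<bullet> MM (pos p x),
      Cst (letter w (mv N d x)) \<bullet> Cst (port (\<not> d)) \<bullet> X \<bullet> Y \<bullet> MM (pos p (mv N d x)))
      | x d X Y. x < N} O sem observation" (is "z \<in> ?W O _")
  then obtain u t v where z: "z = (u, v)" and "(u, t) \<in> ?W" and "(t, v) \<in> sem observation"
    by blast
  then obtain x d X Y l s j d2 c s' j' d' f where x: "x < N"
    and u: "u = Cst (letter w x) \<bullet> Cst (port d) \<bullet> X \<bullet> Y \<bullet> MM (pos p x)"
    and t: "t = Cst (letter w (mv N d x)) \<bullet> Cst (port (\<not> d)) \<bullet> X \<bullet> Y \<bullet> MM (pos p (mv N d x))"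
    and *: "(l, s, j, d2) \<in> pend" "c \<in> insert Star Sig" "(s', j', d') \<in> wk s (l[j := c])"
    and t2: "t = Cst c \<bullet> Cst (port (\<not> d2)) \<bullet> Cst (St (code (l, s, j, d2))) \<bullet> regs_term j f"
    and v: "v = Cst (l[j := c] ! j') \<bullet> Cst (port d') \<bullet> Cst (St (code (l[j := c], s', j', d'))) \<bullet> regs_term j' f"
    by (elim sem_observationE) blast
  have [simp]: "c = letter w (mv N d x)" "d2 = d" and X: "X = Cst (St (code (l, s, j, d)))"
    and Y: "Y = Fn 1 (map f (filter (\<lambda>i. i \<noteq> j) [0..<m]))" and fj: "f j = pos p (mv N d x)"
    using t t2 by (auto simp: regs_term_def MM_def)
  have j: "j < m" using * by (simp add: pend_def)
  have j': "j' < m" using pend_update[OF *] by (simp add: pend_def)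
  \<comment> \<open>Before the move the registers agree with \<open>f\<close>, except that
    \<open>j\<close> still holds the cell being left.\<close>
  define r where "r = (map f [0..<m])[j := pos p x]"
  have "Y \<bullet> MM (pos p x) = regs_term j (nth r)"
    using j by (auto simp: Y regs_term_def r_def)
  then have "(u, (s, l[j := letter w (mv N d x)], r[j := pos p (mv N d x)])) \<in> arrive"
    using arriveI[OF *(1), of r x] x j by (simp add: u X r_def)
  moreover from arrive_cfg[OF this]
  have "((s, l[j := letter w (mv N d x)], r[j := pos p (mv N d x)]), v) \<in> depart"
  proof -
    have "regs_term j' f = regs_term j' (nth (r[j := pos p (mv N d x)]))"
      using j j' fj by (auto simp: regs_term_eq_iff r_def nth_list_update)
    then show "(s, l[j := letter w (mv N d x)], r[j := pos p (mv N d x)]) \<in> cfg \<Longrightarrow>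
        ((s, l[j := letter w (mv N d x)], r[j := pos p (mv N d x)]), v) \<in> depart"
      using * unfolding depart_def v by auto
  qed
  ultimately show "z \<in> arrive O depart"
    unfolding z by blast
next
  fix z assume "z \<in> arrive O depart"
  then obtain u v l s j d x r s' j' d' where z: "z = (u, v)"
    and *: "(l, s, j, d) \<in> pend" "length r = m" "x < N" "r ! j = pos p x"
    and u: "u = Cst (letter w x) \<bullet> Cst (port d) \<bullet> Cst (St (code (l, s, j, d))) \<bullet> regs_term j (nth r)"
    and wk: "(s', j', d') \<in> wk s (l[j := letter w (mv N d x)])"
    and v: "v = Cst (l[j := letter w (mv N d x)] ! j') \<bullet> Cst (port d') \<bullet>
      Cst (St (code (l[j := letter w (mv N d x)], s', j', d'))) \<bullet> regs_term j' (nth (r[j := pos p (mv N d x)]))"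
    by (fastforce simp: arrive_def depart_def)
  let ?W = "{(Cst (letter w x) \<bullet> Cst (port d) \<bullet> X \<bullet> Y \<bullet> MM (pos p x),
      Cst (letter w (mv N d x)) \<bullet> Cst (port (\<not> d)) \<bullet> X \<bullet> Y \<bullet> MM (pos p (mv N d x)))
      | x d X Y. x < N}"
  let ?X = "Cst (St (code (l, s, j, d)))" and ?Y = "Fn 1 (map (nth r) (filter (\<lambda>i. i \<noteq> j) [0..<m]))"
  let ?t = "Cst (letter w (mv N d x)) \<bullet> Cst (port (\<not> d)) \<bullet> ?X \<bullet> ?Y \<bullet> MM (pos p (mv N d x))"
  have j: "j < m" using * by (simp add: pend_def)
  have "(u, ?t) \<in> ?W"
    using * u by (intro CollectI exI[of _ x] exI[of _ d] exI[of _ ?X] exI[of _ ?Y]) (simp add: regs_term_def)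
  moreover have regs: "?Y \<bullet> MM (pos p (mv N d x)) = regs_term j (nth (r[j := pos p (mv N d x)]))"
    using j * by (auto simp: regs_term_def)
  have "letter w (mv N d x) \<in> insert Star Sig"
    by (rule letter_in[OF w]) simp
  from sem_observationI[OF *(1) this wk] have "(?t, v) \<in> sem observation"
    unfolding v regs .
  ultimately show "z \<in> ?W O sem observation"
    unfolding z by (rule relcompI)
qed

lemma nilpotent_product_iff:
  "nilpotent (wprod observation (wordrep w p)) \<longleftrightarrow> (\<exists>n. {(g, g') \<in> gstep w p wk. g \<in> cfg} ^^ n = {})"
  unfolding nilpotent_iff sem_product depart_arrive[symmetric]
  using relpow_empty_swap[where A = arrive and B = depart] relpow_empty_swap[where A = depart and B = arrive] by metis

end

end

section \<open>Counters in positional notation\<close>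

definition digits_value :: "nat \<Rightarrow> (nat \<Rightarrow> nat) \<Rightarrow> nat \<Rightarrow> nat" where
  "digits_value N f c = (\<Sum>i<c. f i * N ^ i)"

lemma digits_value_upd:
  assumes "i < c"
  shows "digits_value N (f(i := v)) c + f i * N ^ i = digits_value N f c + v * N ^ i"
proof -
  have "(\<Sum>k\<in>{..<c} - {i}. (f(i := v)) k * N ^ k) = (\<Sum>k\<in>{..<c} - {i}. f k * N ^ k)"
    by (rule sum.cong) auto
  moreover have "digits_value N g c = g i * N ^ i + (\<Sum>k\<in>{..<c} - {i}. g k * N ^ k)" for g
    unfolding digits_value_def using assms by (intro sum.remove) auto
  ultimately show ?thesis by simp
qed

lemma digits_value_cong: "(\<And>i. i < c \<Longrightarrow> f i = g i) \<Longrightarrow> digits_value N f c = digits_value N g c"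
  by (simp add: digits_value_def)

lemma digits_value_less:
  assumes "\<And>i. i < c \<Longrightarrow> f i < N"
  shows "digits_value N f c < N ^ c"
  using assms
proof (induction c)
  case (Suc c)
  then have "Suc (f c) * N ^ c \<le> N * N ^ c"
    by (intro mult_right_mono) (auto simp: Suc_le_eq)
  moreover have "digits_value N f c < N ^ c"
    using Suc by simp
  ultimately show ?case
    by (simp add: digits_value_def)
qed (simp add: digits_value_def)

lemma digits_value_eq_0_iff: "0 < N \<Longrightarrow> digits_value N f c = 0 \<longleftrightarrow> (\<forall>i<c. f i = 0)"
  by (auto simp: digits_value_def)

text \<open>Wrapping a digit loses \<open>N ^ Suc i\<close>; the extra summand is the carry owed to
  the next digit.\<close>

lemma digits_value_forward:
  assumes "i < c" "f i < N"
  shows "digits_value N (f(i := mv N True (f i))) c + (if mv N True (f i) = 0 then N ^ Suc i else 0) =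
    digits_value N f c + N ^ i"
proof (cases "Suc (f i) = N")
  case True
  then show ?thesis
    using digits_value_upd[OF assms(1), of N f 0] by (auto simp: mv_def)
next
  case False
  then have "mv N True (f i) = Suc (f i)" using assms by (simp add: mv_def)
  then show ?thesis
    using digits_value_upd[OF assms(1), of N f "Suc (f i)"] by simp
qed

text \<open>A digit stepping back from 0 gains \<open>N ^ Suc i\<close>, the borrow that the next
  digit has to pay.\<close>

lemma digits_value_backward:
  assumes "i < c" "f i < N"
  shows "digits_value N (f(i := mv N False (f i))) c + N ^ i =
    digits_value N f c + (if f i = 0 then N ^ Suc i else 0)"
proof (cases "f i")
  case 0
  then have "mv N False (f i) = N - 1" using assms by (simp add: mv_def)
  moreover have "(N - 1) * N ^ i + N ^ i = N ^ Suc i"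
    using assms by (cases N) auto
  ultimately show ?thesis
    using digits_value_upd[OF assms(1), of N f "N - 1"] 0 by simp
next
  case (Suc x)
  then have "mv N False (f i) = x" using assms by (simp add: mv_def)
  then show ?thesis
    using digits_value_upd[OF assms(1), of N f x] Suc by simp
qed

section \<open>Clocked automata\<close>

text \<open>The intended runs: each head stands on a cell and remembers its letter correctly,
  whereas \<open>gstep\<close> also admits junk.\<close>

definition nstep :: "con list \<Rightarrow> 's program \<Rightarrow> (('s \<times> nat list) \<times> ('s \<times> nat list)) set" where
  "nstep w wk = {((s, a), (s', a')). \<exists>j d. (s', j, d) \<in> wk s (map (letter w) a) \<and>
     a' = a[j := mv (Suc (length w)) d (a ! j)]}"

definition G :: "con list \<Rightarrow> nat list \<Rightarrow> 's \<Rightarrow> nat list \<Rightarrow> 's \<times> con list \<times> trm list" where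
  "G w p s a = (s, map (letter w) a, map (pos p) a)"

lemma nstep_deterministic:
  assumes "\<And>l x y. x \<in> wk (fst c) l \<Longrightarrow> y \<in> wk (fst c) l \<Longrightarrow> x = y"
    and "(c, c') \<in> nstep w wk" "(c, c'') \<in> nstep w wk"
  shows "c' = c''"
proof -
  obtain s' j d where 1: "(s', j, d) \<in> wk (fst c) (map (letter w) (snd c))"
    "c' = (s', (snd c)[j := mv (Suc (length w)) d (snd c ! j)])"
    using assms(2) by (auto simp: nstep_def)
  obtain s'' j' d' where 2: "(s'', j', d') \<in> wk (fst c) (map (letter w) (snd c))"
    "c'' = (s'', (snd c)[j' := mv (Suc (length w)) d' (snd c ! j')])"
    using assms(3) by (auto simp: nstep_def)
  show ?thesis
    using assms(1)[OF 1(1) 2(1)] 1(2) 2(2) by simp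
qed

lemma gstep_G:
  assumes "(s', j, d) \<in> wk s (map (letter w) a)" "j < length a" "a ! j < Suc (length w)"
  shows "(G w p s a, G w p s' (a[j := mv (Suc (length w)) d (a ! j)])) \<in> gstep w p wk"
proof -
  let ?x = "mv (Suc (length w)) d (a ! j)"
  have "(map (letter w) a)[j := letter w ?x] = map (letter w) (a[j := ?x])"
    "(map (pos p) a)[j := pos p ?x] = map (pos p) (a[j := ?x])"
    by (simp_all add: map_update)
  then show ?thesis
    using assms unfolding G_def gstep_def by fastforce
qed

text \<open>\<open>Rs j\<close>: register \<open>j\<close> is being reset and was just moved; \<open>Tk i s\<close>: the clock digit \<open>i\<close> was
just moved; \<open>Run t s\<close>: the automaton is in state \<open>s\<close>, \<open>t\<close> steps after the last clock tick.\<close>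

datatype 's clocked = Rs nat | Tk nat 's | Run nat 's

locale clocked_mha = mha Sig S m wk for Sig S m and wk :: "'s program" +
  fixes s0 :: 's and acc :: "'s \<Rightarrow> bool" and again :: bool and b c :: nat
  assumes s0: "s0 \<in> S" and m: "0 < m" and b: "card S * card S < b" and c: "2 * m \<le> c"
begin

lemma c_pos: "0 < c"
  using c m by auto

text \<open>Every step has to move a head, so a tick starts by moving the lowest clock digit and a
  restart by moving head 0.\<close>

definition exec :: "nat \<Rightarrow> 's \<Rightarrow> con list \<Rightarrow> ('s clocked \<times> nat \<times> bool) set" where
  "exec t s l = (if b \<le> t then {(Tk 0 s, m, True)}
     else if acc s then (if again then {(Rs 0, 0, True)} else {})
     else if wk s (take m l) = {} then (if again then {} else {(Rs 0, 0, True)})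
     else {(Run (Suc t) s', j, d) | s' j d. (s', j, d) \<in> wk s (take m l)})"

text \<open>The parameter \<open>again\<close> selects whether acceptance or its failure restarts the computation.\<close>

fun cwk :: "'s clocked program" where
  "cwk (Rs j) l = (if l ! j \<noteq> Star then {(Rs j, j, True)}
     else if Suc j < m + c then {(Rs (Suc j), Suc j, True)} else exec 0 s0 l)"
| "cwk (Tk i s) l = (if l ! (m + i) \<noteq> Star then exec 0 s l
     else if Suc i < c then {(Tk (Suc i) s, m + Suc i, True)}
     else if again then {} else {(Rs 0, 0, True)})"
| "cwk (Run t s) l = exec t s l"

definition CS :: "'s clocked set" where
  "CS = Rs ` {..<m + c} \<union> (\<lambda>(i, s). Tk i s) ` ({..<c} \<times> S) \<union> (\<lambda>(t, s). Run t s) ` ({..b} \<times> S)"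

lemma CS_iff [simp]:
  "Rs j \<in> CS \<longleftrightarrow> j < m + c"
  "Tk i s \<in> CS \<longleftrightarrow> i < c \<and> s \<in> S"
  "Run t s \<in> CS \<longleftrightarrow> t \<le> b \<and> s \<in> S"
  by (auto simp: CS_def)

lemma wk_take_closed:
  assumes "s \<in> S" "length l = m + c" "set l \<subseteq> insert Star Sig" "(s', j, d) \<in> wk s (take m l)"
  shows "s' \<in> S \<and> j < m"
  using wk_closed[OF assms(1) _ _ assms(4)] assms set_take_subset[of m l] by (auto simp: subset_iff)

lemma exec_closed:
  assumes "s \<in> S" "length l = m + c" "set l \<subseteq> insert Star Sig" "(z, j, d) \<in> exec t s l"
  shows "z \<in> CS \<and> j < m + c"
  using assms wk_take_closed[OF assms(1-3)] m c_pos by (fastforce simp: exec_def split: if_splits)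

sublocale clk: mha Sig CS "m + c" cwk
proof
  show "finite CS" using finite_S by (simp add: CS_def)
  show "z' \<in> CS \<and> j < m + c"
    if "z \<in> CS" "length l = m + c" "set l \<subseteq> insert Star Sig" "(z', j, d) \<in> cwk z l" for z l z' j d
    using that(1,4) exec_closed[OF _ that(2,3)] s0 m c_pos by (cases z) (auto split: if_splits)
qed (rule finite_Sig Star)+

lemma cwk_deterministic:
  assumes det: "\<And>s l x y. s \<in> S \<Longrightarrow> x \<in> wk s l \<Longrightarrow> y \<in> wk s l \<Longrightarrow> x = y"
    and z: "z \<in> CS" "x \<in> cwk z l" "y \<in> cwk z l"
  shows "x = y"
proof -
  have "x = y" if "s \<in> S" "x \<in> exec t s l" "y \<in> exec t s l" for t s
    using that det[of s _ "take m l"] by (fastforce simp: exec_def split: if_splits)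
  with z s0 show ?thesis by (cases z) (auto split: if_splits)
qed

context
  fixes w :: "con list" and p :: "nat list"
  assumes w: "set w \<subseteq> Sig" and p: "length p = Suc (length w)" and dist: "distinct p"
begin

abbreviation "steps \<equiv> {(g, g') \<in> gstep w p cwk. g \<in> clk.cfg}"

section \<open>Reading the clock off arbitrary configurations\<close>

lemma letter_Star: "x < N w \<Longrightarrow> letter w x = Star \<longleftrightarrow> x = 0"
  using letter_eq_Star[OF w Star] .

text \<open>Junk terms count as 0, which makes clock and measure total.\<close>

definition index :: "trm \<Rightarrow> nat" where
  "index t = (if \<exists>x<N w. t = pos p x then THE x. x < N w \<and> t = pos p x else 0)"

lemma index_pos: "x < N w \<Longrightarrow> index (pos p x) = x"
  using p dist by (auto simp: index_def nth_eq_iff_index_eq)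

lemma index_less: "index t < N w"
proof (cases "\<exists>x<N w. t = pos p x")
  case True
  then show ?thesis using index_pos by auto
next
  case False
  then show ?thesis by (auto simp: index_def)
qed

definition clock :: "trm list \<Rightarrow> nat" where
  "clock r = digits_value (N w) (\<lambda>i. index (r ! (m + i))) c"

text \<open>Based on the remembered letter, on which the program branches: \<open>Star\<close> means
  that digit \<open>i\<close> has wrapped and owes a carry.\<close>

definition carry :: "nat \<Rightarrow> con list \<Rightarrow> nat" where
  "carry i l = (if l ! (m + i) = Star then N w ^ Suc i else 0)"

lemma clock_less: "clock r < N w ^ c"
  unfolding clock_def by (intro digits_value_less index_less)

lemma clock_update_work: "j < m \<Longrightarrow> clock (r[j := t]) = clock r"
  by (simp add: clock_def)

text \<open>Clock plus pending carry is the true time while a carry ripples: moving digit 0 adds 1,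
  and moving digit \<open>Suc i\<close> adds just the \<open>N ^ Suc i\<close> that was
  owed.\<close>

lemma clock_tick:
  assumes "i < c" "length r = m + c" "length l = m + c" "x < N w" "r ! (m + i) = pos p x"
  shows "clock (r[m + i := pos p (mv (N w) True x)]) + carry i (l[m + i := letter w (mv (N w) True x)]) =
    clock r + N w ^ i"
proof -
  let ?f = "\<lambda>i. index (r ! (m + i))"
  have fi: "?f i = x" using assms by (simp add: index_pos)
  have "digits_value (N w) (\<lambda>k. index (r[m + i := pos p (mv (N w) True x)] ! (m + k))) c =
      digits_value (N w) (?f(i := mv (N w) True x)) c"
    using assms by (intro digits_value_cong) (auto simp: index_pos nth_list_update)
  then show ?thesis
    using digits_value_forward[OF assms(1), of ?f "N w"] fi assms
    by (simp add: clock_def carry_def letter_Star)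
qed

subsection \<open>Boundedness\<close>

text \<open>Exceeds the largest minor part \<open>b + 1 + c\<close> of the measure below, so that
  one tick outweighs it.\<close>

definition bs :: nat where
  "bs = b + c + 2"

text \<open>Resets lie on top, ordered by the registers still to be cleared and then by the moves
  that take the current one to cell 0. Below them the remaining clock time dominates, refined by the
  ripple of the carry and the steps since the last tick.\<close>

fun \<mu> :: "'s clocked \<times> con list \<times> trm list \<Rightarrow> nat" where
  "\<mu> (Rs j, l, r) = Suc (N w ^ c) * bs + ((m + c - j) * Suc (N w) + (N w - index (r ! j)) mod N w)"
| "\<mu> (Tk i s, l, r) = (N w ^ c - (clock r + carry i l)) * bs + (b + 1 + (c - i))"
| "\<mu> (Run t s, l, r) = (N w ^ c - clock r) * bs + (b - t)"

lemma bounded_mu: "\<mu> g < Suc (N w ^ c) * bs + Suc (m + c) * Suc (N w)"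
proof (cases g rule: \<mu>.cases)
  case (1 j l r)
  have "(m + c - j) * Suc (N w) + (N w - index (r ! j)) mod N w < (m + c) * Suc (N w) + Suc (N w)"
    by (intro add_le_less_mono mult_right_mono) (auto intro: less_SucI)
  then show ?thesis by (simp add: 1)
next
  case (2 i s l r)
  have "(N w ^ c - (clock r + carry i l)) * bs + (b + 1 + (c - i)) < N w ^ c * bs + bs"
    by (intro add_le_less_mono mult_right_mono) (auto simp: bs_def)
  then show ?thesis by (simp add: 2)
next
  case (3 t s l r)
  have "(N w ^ c - clock r) * bs + (b - t) < N w ^ c * bs + bs"
    by (intro add_le_less_mono mult_right_mono) (auto simp: bs_def)
  then show ?thesis by (simp add: 3)
qed

lemma remaining_less:
  assumes "x < y" "x < M" "u < bs"
  shows "(M - y) * bs + u < (M - x) * bs + v"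
proof -
  have "(M - y) * bs + u < (M - y) * bs + bs" using assms by simp
  also have "\<dots> = Suc (M - y) * bs" by simp
  also have "\<dots> \<le> (M - x) * bs" using assms by (intro mult_right_mono) auto
  finally show ?thesis by simp
qed

definition restart :: "nat \<Rightarrow> 's \<Rightarrow> con list \<Rightarrow> bool" where
  "restart t s l \<longleftrightarrow> t < b \<and> (if again then acc s else \<not> acc s \<and> wk s (take m l) = {})"

fun restarts :: "'s clocked \<Rightarrow> con list \<Rightarrow> bool" where
  "restarts (Rs j) l \<longleftrightarrow> l ! j = Star \<and> \<not> Suc j < m + c \<and> restart 0 s0 l"
| "restarts (Tk i s) l \<longleftrightarrow> (if l ! (m + i) \<noteq> Star then restart 0 s l else \<not> Suc i < c \<and> \<not> again)"
| "restarts (Run t s) l \<longleftrightarrow> restart t s l"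

lemma exec_cases:
  assumes "(z, j, d) \<in> exec t s l"
  obtains (tick) "b \<le> t" "z = Tk 0 s" "j = m" "d"
    | (restart) "restart t s l" "z = Rs 0" "j = 0" "d"
    | (step) s' where "t < b" "\<not> acc s" "(s', j, d) \<in> wk s (take m l)" "z = Run (Suc t) s'"
  using assms by (auto simp: exec_def restart_def split: if_splits)

lemma exec_mu:
  assumes s: "s \<in> S" and l: "length l = m + c" "set l \<subseteq> insert Star Sig" and r: "length r = m + c"
    and z: "(z, j, d) \<in> exec t s l" and x: "x < N w" "r ! j = pos p x" "t \<le> b"
  shows "\<mu> (z, l[j := letter w (mv (N w) d x)], r[j := pos p (mv (N w) d x)]) < (N w ^ c - clock r) * bs + (b - t) \<or>
    (restart t s l \<and> z = Rs 0)"
  using z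
proof (cases rule: exec_cases)
  case tick
  then have "clock (r[j := pos p (mv (N w) d x)]) + carry 0 (l[j := letter w (mv (N w) d x)]) = Suc (clock r)"
    using clock_tick[of 0 r l x] x l r c_pos by simp
  moreover have "b + 1 + c < bs" by (simp add: bs_def)
  ultimately show ?thesis
    using remaining_less[of "clock r" "Suc (clock r)" "N w ^ c" "b + 1 + c" "b - t"] clock_less
    by (simp add: tick)
next
  case restart
  then show ?thesis by simp
next
  case (step s')
  then have "j < m" using wk_take_closed[OF s l] by blast
  then show ?thesis using step by (simp add: clock_update_work)
qed

text \<open>Holds for junk as well: the argument looks only at the register being moved, and that
  one must hold a position.\<close>

lemma steps_mu:
  assumes "(g, g') \<in> steps"
  shows "\<mu> g' < \<mu> g \<or> (restarts (fst g) (fst (snd g)) \<and> fst g' = Rs 0)"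
proof -
  obtain z l r z' j d x where g: "g = (z, l, r)" and cfg: "(z, l, r) \<in> clk.cfg"
    and wk: "(z', j, d) \<in> cwk z l" and x: "x < N w" "r ! j = pos p x" "l ! j = letter w x"
    and g': "g' = (z', l[j := letter w (mv (N w) d x)], r[j := pos p (mv (N w) d x)])"
    using assms unfolding gstep_def by blast
  have lr: "length l = m + c" "set l \<subseteq> insert Star Sig" "length r = m + c" and z: "z \<in> CS"
    using cfg by (auto simp: clk.cfg_def)
  show ?thesis
  proof (cases z)
    case (Rs k)
    have k: "k < m + c" using z Rs by simp
    consider (move) "l ! k \<noteq> Star" | (advance) "l ! k = Star" "Suc k < m + c"
      | (exec) "l ! k = Star" "\<not> Suc k < m + c" by blast
    then show ?thesis
    proof cases
      case move
      then have [simp]: "z' = Rs k" "j = k" "d" using wk Rs by auto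
      have "x \<noteq> 0" using move x by (auto simp: letter_def split: if_splits)
      \<comment> \<open>\<open>(N - x) mod N\<close> is the number of forward moves to cell
        0.\<close>
      have "(N w - index (pos p (mv (N w) True x))) mod N w < (N w - x) mod N w"
      proof (cases "Suc x = N w")
        case True
        then have "mv (N w) True x = 0" by (simp add: mv_def)
        then show ?thesis using \<open>x \<noteq> 0\<close> True by (simp add: index_pos)
      next
        case False
        then have "mv (N w) True x = Suc x" using x by (simp add: mv_def)
        then show ?thesis using \<open>x \<noteq> 0\<close> False x by (simp add: index_pos)
      qed
      moreover define A where "A = Suc (N w ^ c) * bs + (m + c - k) * Suc (N w)"
      then have "\<mu> g = A + (N w - x) mod N w"
        "\<mu> g' = A + (N w - index (pos p (mv (N w) True x))) mod N w"
        using x k lr \<open>d\<close> by (simp_all only: g g' Rs \<mu>.simps \<open>z' = Rs k\<close> \<open>j = k\<close> index_pos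
          nth_list_update_eq add.assoc simp_thms)
      ultimately show ?thesis by simp
    next
      case advance
      then have [simp]: "z' = Rs (Suc k)" "j = Suc k" "d" using wk Rs by auto
      have *: "m + c - k = Suc (m + c - Suc k)" using advance by simp
      show ?thesis
        unfolding g g' Rs by (simp add: *) (rule less_le_trans[OF mod_less_divisor], simp_all)
    next
      case exec
      then have "(z', j, d) \<in> exec 0 s0 l" using wk Rs by simp
      from exec_mu[OF s0 lr this x(1,2)]
      have "\<mu> g' < N w ^ c * bs + b \<or> (restart 0 s0 l \<and> z' = Rs 0)"
        unfolding g' by (auto intro: less_le_trans)
      moreover have "N w ^ c * bs + b \<le> \<mu> g"
        by (simp add: g Rs bs_def trans_le_add1)
      ultimately show ?thesis using exec by (auto simp: g g' Rs)
    qed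
  next
    case (Tk i s)
    have i: "i < c" and s: "s \<in> S" using z Tk by auto
    show ?thesis
    proof (cases "l ! (m + i) = Star")
      case False
      then have "(z', j, d) \<in> exec 0 s l" using wk Tk by simp
      from exec_mu[OF s lr this x(1,2)] show ?thesis
        using False by (auto simp: g g' Tk carry_def)
    next
      case True
      show ?thesis
      proof (cases "Suc i < c")
        case False
        then show ?thesis using True wk by (auto simp: g g' Tk split: if_splits)
      next
        case Suc: True
        then have [simp]: "z' = Tk (Suc i) s" "j = m + Suc i" "d" using wk Tk True by auto
        \<comment> \<open>The new digit pays exactly the carry of the old one: the major part is
          unchanged and \<open>c - i\<close> drops.\<close>
        have "clock (r[m + Suc i := pos p (mv (N w) True x)]) +
            carry (Suc i) (l[m + Suc i := letter w (mv (N w) True x)]) = clock r + N w ^ Suc i"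
          using clock_tick[of "Suc i" r l x] x Suc lr by simp
        moreover have "carry i l = N w ^ Suc i" using True by (simp add: carry_def)
        ultimately show ?thesis using Suc by (simp add: g g' Tk)
      qed
    qed
  next
    case (Run t s)
    have "t \<le> b" "s \<in> S" "(z', j, d) \<in> exec t s l" using z wk Run by auto
    from exec_mu[OF this(2) lr this(3) x(1,2) this(1)] show ?thesis
      by (auto simp: g g' Run)
  qed
qed

lemma relpow_decreasing:
  fixes f :: "'a \<Rightarrow> nat"
  assumes "\<And>x y. (x, y) \<in> R \<Longrightarrow> f y < f x" and "(x, y) \<in> R ^^ n"
  shows "n + f y \<le> f x"
  using assms(2)
proof (induction n arbitrary: y)
  case (Suc n)
  then obtain z where "(x, z) \<in> R ^^ n" "(z, y) \<in> R" by auto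
  with Suc.IH[of z] assms(1)[of z y] show ?case by simp
qed simp

text \<open>\<open>J\<close> holds after a restart and excludes further ones, so a computation restarts at most once.\<close>

lemma bounded_if_invariant:
  assumes J_restart: "\<And>g g'. (g, g') \<in> steps \<Longrightarrow> fst g' = Rs 0 \<Longrightarrow> restarts (fst g) (fst (snd g)) \<Longrightarrow> J g'"
    and J_step: "\<And>g g'. (g, g') \<in> steps \<Longrightarrow> J g \<Longrightarrow> J g'"
    and J_no_restart: "\<And>g. J g \<Longrightarrow> g \<in> clk.cfg \<Longrightarrow> \<not> restarts (fst g) (fst (snd g))"
  shows "\<exists>n. steps ^^ n = {}"
proof -
  define B where "B = Suc (N w ^ c) * bs + Suc (m + c) * Suc (N w)"
  have B: "\<mu> g < B" for g using bounded_mu by (simp add: B_def)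
  \<comment> \<open>Configurations that may still restart are lifted above all those satisfying
    \<open>J\<close>.\<close>
  define f where "f g = (if J g then \<mu> g else B + \<mu> g)" for g
  have "f g' < f g" if "(g, g') \<in> steps" for g g'
  proof -
    have "\<mu> g' < \<mu> g" if "J g"
      using steps_mu[OF \<open>(g, g') \<in> steps\<close>] J_no_restart[OF that] \<open>(g, g') \<in> steps\<close> by auto
    moreover have "\<mu> g' < \<mu> g" if "\<not> J g'"
      using steps_mu[OF \<open>(g, g') \<in> steps\<close>] J_restart[OF \<open>(g, g') \<in> steps\<close>] that by auto
    moreover have "J g'" if "J g" using J_step \<open>(g, g') \<in> steps\<close> that by blast
    moreover have "\<mu> g' < B" by (rule B)
    ultimately show ?thesis by (auto simp: f_def)
  qed
  then have le: "n + f g' \<le> f g" if "(g, g') \<in> steps ^^ n" for n g g'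
    using relpow_decreasing[where R = steps and f = f] that by blast
  have "False" if "z \<in> steps ^^ (2 * B)" for z
  proof -
    obtain g g' where z: "z = (g, g')" by (rule prod.exhaust)
    have "2 * B + f g' \<le> f g" using that unfolding z by (rule le)
    moreover have "f g < 2 * B" using B[of g] by (simp add: f_def)
    ultimately show False by simp
  qed
  then have "steps ^^ (2 * B) = {}" by (rule equals0I)
  then show ?thesis ..
qed

subsection \<open>Correctness of the clock\<close>

definition good :: "nat list \<Rightarrow> bool" where
  "good a \<longleftrightarrow> length a = m + c \<and> set a \<subseteq> {..length w}"

lemma good_nth: "good a \<Longrightarrow> j < m + c \<Longrightarrow> a ! j < N w"
  unfolding good_def by (metis atMost_iff less_Suc_eq_le nth_mem subsetD)

lemma good_update: "good a \<Longrightarrow> good (a[j := mv (N w) d x])"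
  unfolding good_def using set_list_update_subset[of a "{..length w}" "mv (N w) d x" j] mv_less[of "N w" d x]
  by (simp add: less_Suc_eq_le)

lemma good_replicate: "good (replicate (m + c) 0)"
  by (auto simp: good_def)

lemma good_cfg: "good a \<Longrightarrow> z \<in> CS \<Longrightarrow> G w p z a \<in> clk.cfg"
  using letter_in[OF w] by (auto simp: good_def G_def clk.cfg_def less_Suc_eq_le)

abbreviation "time a \<equiv> clock (map (pos p) a)"

abbreviation "time_carry i a \<equiv> time a + carry i (map (letter w) a)"

text \<open>The predicate \<open>\<Phi> k x\<close> describes the configurations \<open>x\<close> of the automaton after \<open>k\<close> steps; the number
of steps is read off the clock.\<close>

fun K :: "(nat \<Rightarrow> 's \<times> nat list \<Rightarrow> bool) \<Rightarrow> 's clocked \<Rightarrow> nat list \<Rightarrow> bool" where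
  "K \<Phi> (Rs j) a \<longleftrightarrow> (\<forall>i<j. a ! i = 0)"
| "K \<Phi> (Tk i s) a \<longleftrightarrow> \<Phi> (time_carry i a * b) (s, take m a)"
| "K \<Phi> (Run t s) a \<longleftrightarrow> \<Phi> (time a * b + t) (s, take m a)"

lemma time_tick:
  assumes "good a" "i < c"
  shows "time_carry i (a[m + i := mv (N w) True (a ! (m + i))]) = time a + N w ^ i"
  using clock_tick[of i "map (pos p) a" "map (letter w) a" "a ! (m + i)"] assms good_nth[of a "m + i"]
  by (simp add: good_def map_update)

lemma exec_K:
  assumes a: "good a" and s: "s \<in> S" and t: "t \<le> b" and \<Phi>: "\<Phi> (time a * b + t) (s, take m a)"
    and z: "(z, j, d) \<in> exec t s (map (letter w) a)"
    and step: "\<And>s'. z = Run (Suc t) s' \<Longrightarrow> \<not> acc s \<Longrightarrow> (s', j, d) \<in> wk s (take m (map (letter w) a)) \<Longrightarrow>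
      \<Phi> (Suc (time a * b + t)) (s', (take m a)[j := mv (N w) d (take m a ! j)])"
  shows "K \<Phi> z (a[j := mv (N w) d (a ! j)])"
  using z
proof (cases rule: exec_cases)
  \<comment> \<open>Here \<open>t = b\<close>: a full block of steps is exchanged for one unit of
    time, so the step count stays the same.\<close>
  case tick
  then have "time_carry 0 (a[j := mv (N w) d (a ! j)]) = Suc (time a)"
    using time_tick[OF a c_pos] by simp
  then show ?thesis using \<Phi> t tick by (simp add: add.commute)
next
  case restart
  then show ?thesis by simp
next
  case (step s')
  have "length (map (letter w) a) = m + c" "set (map (letter w) a) \<subseteq> insert Star Sig"
    using good_cfg[OF a, of "Rs 0"] m by (auto simp: G_def clk.cfg_def)
  then have "j < m" using wk_take_closed[OF s] step by blast
  then show ?thesis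
    using assms(6)[OF step(4,2,3)] by (simp add: step(4) map_update clock_update_work take_update_swap)
qed

lemma nstep_takeE:
  assumes "((s, take m a), x') \<in> nstep w wk"
  obtains s' j d where "(s', j, d) \<in> wk s (take m (map (letter w) a))"
    "x' = (s', (take m a)[j := mv (N w) d (take m a ! j)])"
  using assms unfolding nstep_def by (auto simp: take_map)

lemma nstep_takeI:
  "(s', j, d) \<in> wk s (take m (map (letter w) a)) \<Longrightarrow>
    ((s, take m a), (s', (take m a)[j := mv (N w) d (take m a ! j)])) \<in> nstep w wk"
  unfolding nstep_def by (auto simp: take_map)

text \<open>During a reset nothing is claimed about registers still to come; only the one just moved
  and those already cleared are known to be proper.\<close>

definition J :: "(nat \<Rightarrow> 's \<times> nat list \<Rightarrow> bool) \<Rightarrow> 's clocked \<times> con list \<times> trm list \<Rightarrow> bool" where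
  "J \<Phi> = (\<lambda>(z, l, r). case z of
     Rs j \<Rightarrow> (\<exists>x<N w. l ! j = letter w x \<and> r ! j = pos p x) \<and> (\<forall>i<j. l ! i = Star \<and> r ! i = pos p 0)
   | _ \<Rightarrow> (\<exists>a. good a \<and> (z, l, r) = G w p z a \<and> K \<Phi> z a))"

lemma J_simps [simp]:
  "J \<Phi> (Rs j, l, r) \<longleftrightarrow>
    (\<exists>x<N w. l ! j = letter w x \<and> r ! j = pos p x) \<and> (\<forall>i<j. l ! i = Star \<and> r ! i = pos p 0)"
  "J \<Phi> (Tk i s, l, r) \<longleftrightarrow> (\<exists>a. good a \<and> l = map (letter w) a \<and> r = map (pos p) a \<and> K \<Phi> (Tk i s) a)"
  "J \<Phi> (Run t s, l, r) \<longleftrightarrow> (\<exists>a. good a \<and> l = map (letter w) a \<and> r = map (pos p) a \<and> K \<Phi> (Run t s) a)"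
  by (auto simp: J_def G_def)

lemma J_G:
  assumes "good a" "K \<Phi> z a" "z \<in> CS"
  shows "J \<Phi> (G w p z a)"
proof (cases z)
  case (Rs j)
  have "i < length a \<and> a ! i = 0" if "i < j" for i
    using assms that by (simp add: Rs good_def)
  then show ?thesis
    using assms good_nth[OF assms(1), of j]
    by (auto simp: Rs G_def good_def letter_def[of w 0] intro!: exI[of _ "a ! j"])
qed (use assms in \<open>auto simp: G_def\<close>)

lemma Rs_moves: "(Rs k, j, d) \<in> cwk z l \<Longrightarrow> j = k"
  by (cases z) (auto simp: exec_def split: if_splits)

lemma map_replicate_0:
  assumes "\<forall>i<m + c. l ! i = Star \<and> r ! i = pos p 0" "length l = m + c" "length r = m + c"
  shows "l = map (letter w) (replicate (m + c) 0)" "r = map (pos p) (replicate (m + c) 0)"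
  using assms by (auto intro!: nth_equalityI simp: letter_def)

lemma time_replicate: "time (replicate (m + c) 0) = 0"
  by (simp add: clock_def digits_value_def index_pos)

text \<open>A register moves only from a cell whose letter it remembers correctly, so a reset either
  blocks or makes the registers proper one by one. Once the last is cleared, the run starts from the
  initial configuration.\<close>

lemma J_step:
  assumes \<Phi>0: "\<Phi> 0 (s0, replicate m 0)"
    and \<Phi>step: "\<And>k x x'. \<Phi> k x \<Longrightarrow> \<not> acc (fst x) \<Longrightarrow> (x, x') \<in> nstep w wk \<Longrightarrow> \<Phi> (Suc k) x'"
    and J: "J \<Phi> g" and gg': "(g, g') \<in> steps"
  shows "J \<Phi> g'"
proof -
  obtain z l r z' j d x where g: "g = (z, l, r)" and cfg: "(z, l, r) \<in> clk.cfg"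
    and wk: "(z', j, d) \<in> cwk z l" and x: "x < N w" "r ! j = pos p x" "l ! j = letter w x"
    and g': "g' = (z', l[j := letter w (mv (N w) d x)], r[j := pos p (mv (N w) d x)])"
    using gg' unfolding gstep_def by blast
  have lr: "length l = m + c" "set l \<subseteq> insert Star Sig" "length r = m + c" and z: "z \<in> CS"
    using cfg by (auto simp: clk.cfg_def)
  have z': "z' \<in> CS" and j: "j < m + c" using clk.wk_closed[OF z lr(1,2) wk] by auto
  have valid: "J \<Phi> g'" if a: "good a" "l = map (letter w) a" "r = map (pos p) a"
    and K: "K \<Phi> z' (a[j := mv (N w) d (a ! j)])" for a
  proof -
    have "j < length a" using j a(1) by (simp add: good_def)
    then have "pos p (a ! j) = pos p x" using x(2) a(3) by simp
    \<comment> \<open>Distinct positions identify the cell.\<close>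
    then have "x = a ! j"
      using good_nth[OF a(1) j] x(1) p dist by (simp add: nth_eq_iff_index_eq)
    then have "g' = G w p z' (a[j := mv (N w) d (a ! j)])"
      by (simp add: g' G_def a map_update)
    then show ?thesis using J_G[OF good_update[OF a(1)] K z'] by simp
  qed
  have exec: "J \<Phi> g'" if a: "good a" "l = map (letter w) a" "r = map (pos p) a"
    and s: "s \<in> S" "t \<le> b" and \<Phi>: "\<Phi> (time a * b + t) (s, take m a)" and ex: "(z', j, d) \<in> exec t s l" for a t s
  proof (rule valid[OF a])
    show "K \<Phi> z' (a[j := mv (N w) d (a ! j)])"
      using exec_K[where \<Phi> = \<Phi>, OF a(1) s \<Phi> ex[unfolded a(2)]] \<Phi>step[OF \<Phi> _ nstep_takeI] by simp
  qed
  show ?thesis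
  proof (cases z)
    case (Rs k)
    have k: "k < m + c" using z Rs by simp
    obtain y where y: "y < N w" "l ! k = letter w y" "r ! k = pos p y"
      and below: "\<forall>i<k. l ! i = Star \<and> r ! i = pos p 0"
      using J by (auto simp: g Rs)
    consider (move) "l ! k \<noteq> Star" | (advance) "l ! k = Star" "Suc k < m + c"
      | (exec) "l ! k = Star" "\<not> Suc k < m + c" by blast
    then show ?thesis
    proof cases
      case move
      then have [simp]: "z' = Rs k" "j = k" using wk Rs by auto
      show ?thesis using below k lr by (auto simp: g' intro!: exI[of _ "mv (N w) d x"])
    next
      case advance
      then have [simp]: "z' = Rs (Suc k)" "j = Suc k" using wk Rs by auto
      have "y = 0" using letter_Star[OF y(1)] y(2) advance(1) by simp
      then show ?thesis using below y advance lr
        by (auto simp: g' elim!: less_SucE intro!: exI[of _ "mv (N w) d x"])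
    next
      case exec2: exec
      then have "y = 0" using letter_Star[OF y(1)] y(2) by simp
      then have "\<forall>i<m + c. l ! i = Star \<and> r ! i = pos p 0"
        using below y exec2 by (metis Suc_leI le_less_trans linorder_neqE_nat not_less)
      note a = map_replicate_0[OF this lr(1,3)]
      have "(z', j, d) \<in> exec 0 s0 l" using wk exec2 Rs by simp
      then show ?thesis
        using exec[OF good_replicate a s0, of 0] \<Phi>0 time_replicate by simp
    qed
  next
    case (Tk i s)
    have i: "i < c" and s: "s \<in> S" using z Tk by auto
    obtain a where a: "good a" "l = map (letter w) a" "r = map (pos p) a"
      and \<Phi>: "\<Phi> (time_carry i a * b) (s, take m a)"
      using J by (auto simp: g Tk)
    show ?thesis
    proof (cases "l ! (m + i) = Star")
      case False
      then have "(z', j, d) \<in> exec 0 s l" "carry i (map (letter w) a) = 0"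
        using wk Tk a by (auto simp: carry_def)
      with \<Phi> show ?thesis by (intro exec[OF a s, of 0]) auto
    next
      case True
      show ?thesis
      proof (cases "Suc i < c")
        case False
        then have "z' = Rs 0" "j = 0" using True wk Tk by (auto split: if_splits)
        then show ?thesis by (intro valid[OF a]) simp
      next
        case Suc: True
        then have [simp]: "z' = Tk (Suc i) s" "j = m + Suc i" "d" using wk Tk True by auto
        have "carry i (map (letter w) a) = N w ^ Suc i" using True a by (simp add: carry_def)
        then show ?thesis
          using \<Phi> time_tick[OF a(1) Suc] by (intro valid[OF a]) simp
      qed
    qed
  next
    case (Run t s)
    then have "t \<le> b" "s \<in> S" using z by auto
    obtain a where a: "good a" "l = map (letter w) a" "r = map (pos p) a"
      and \<Phi>: "\<Phi> (time a * b + t) (s, take m a)"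
      using J by (auto simp: g Run)
    have "(z', j, d) \<in> exec t s l" using wk Run by simp
    then show ?thesis using exec[OF a \<open>s \<in> S\<close> \<open>t \<le> b\<close> \<Phi>] by simp
  qed
qed

text \<open>An invariant of proper runs that excludes restarts is enough: none accepts if acceptance
  restarts; otherwise none is stuck without accepting or reaches the end of the clock.\<close>

lemma bounded_steps:
  assumes \<Phi>0: "\<Phi> 0 (s0, replicate m 0)"
    and \<Phi>step: "\<And>k x x'. \<Phi> k x \<Longrightarrow> \<not> acc (fst x) \<Longrightarrow> (x, x') \<in> nstep w wk \<Longrightarrow> \<Phi> (Suc k) x'"
    and again: "\<And>k x. again \<Longrightarrow> \<Phi> k x \<Longrightarrow> \<not> acc (fst x)"
    and not_again: "\<And>k x. \<not> again \<Longrightarrow> \<Phi> k x \<Longrightarrow> k < b * N w ^ c \<and> (acc (fst x) \<or> (\<exists>x'. (x, x') \<in> nstep w wk))"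
  shows "\<exists>n. steps ^^ n = {}"
proof (rule bounded_if_invariant[where J = "J \<Phi>"])
  have no_restart: "\<not> restart t s (map (letter w) a)" if "\<Phi> k (s, take m a)" for k t s a
    using again[OF _ that] not_again[OF _ that] by (auto simp: restart_def nstep_def take_map)
  show "\<not> restarts (fst g) (fst (snd g))" if J: "J \<Phi> g" and g: "g \<in> clk.cfg" for g
  proof -
    obtain z l r where g_eq: "g = (z, l, r)" and lr: "length l = m + c" "length r = m + c" and z: "z \<in> CS"
      using g by (auto simp: clk.cfg_def)
    show ?thesis
    proof (cases z)
      case (Rs j)
      have "\<not> restart 0 s0 l" if "l ! j = Star" "\<not> Suc j < m + c"
      proof -
        obtain y where y: "y < N w" "l ! j = letter w y" "r ! j = pos p y"
          and below: "\<forall>i<j. l ! i = Star \<and> r ! i = pos p 0"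
          using J by (auto simp: g_eq Rs)
        have "y = 0" using letter_Star[OF y(1)] y(2) that(1) by simp
        then have "l ! i = Star \<and> r ! i = pos p 0" if "i < m + c" for i
          using that below y \<open>l ! j = Star\<close> \<open>\<not> Suc j < m + c\<close> by (cases "i = j") auto
        then have "l = map (letter w) (replicate (m + c) 0)"
          using map_replicate_0 lr by blast
        then show ?thesis
          using no_restart[of 0 s0 "replicate (m + c) 0" 0] \<Phi>0 by simp
      qed
      then show ?thesis by (auto simp: g_eq Rs)
    next
      case (Tk i s)
      obtain a where a: "good a" "l = map (letter w) a" and \<Phi>: "\<Phi> (time_carry i a * b) (s, take m a)"
        using J by (auto simp: g_eq Tk)
      \<comment> \<open>An overflow of the top digit would mean at least \<open>b * N ^ c\<close>
        steps.\<close>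
      have "again" if "l ! (m + i) = Star" "\<not> Suc i < c"
      proof (rule ccontr)
        assume "\<not> again"
        have "c = Suc i" using that z Tk by simp
        then have "N w ^ c \<le> time_carry i a"
          using that a by (simp add: carry_def)
        then have "b * N w ^ c \<le> time_carry i a * b"
          by (simp add: mult.commute)
        then show False using not_again[OF \<open>\<not> again\<close> \<Phi>] by simp
      qed
      then show ?thesis
        using no_restart[OF \<Phi>] by (auto simp: g_eq Tk a)
    next
      case (Run t s)
      then show ?thesis
        using J no_restart by (auto simp: g_eq Run)
    qed
  qed
  show "J \<Phi> g'" if "(g, g') \<in> steps" "fst g' = Rs 0" for g g'
  proof -
    obtain z l r z' j d x where g: "(z, l, r) \<in> clk.cfg"
      and wk: "(z', j, d) \<in> cwk z l" and x: "x < N w"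
      and g': "g' = (z', l[j := letter w (mv (N w) d x)], r[j := pos p (mv (N w) d x)])"
      using \<open>(g, g') \<in> steps\<close> unfolding gstep_def by blast
    have "z' = Rs 0" "j = 0" using \<open>fst g' = Rs 0\<close> wk Rs_moves by (auto simp: g')
    moreover have "0 < length l" "0 < length r" using g m by (auto simp: clk.cfg_def)
    moreover have "mv (N w) d x < N w" by (rule mv_less) simp
    ultimately show ?thesis
      unfolding g' \<open>z' = Rs 0\<close> J_simps by (intro conjI exI[of _ "mv (N w) d x"]) simp_all
  qed
qed (rule J_step[where \<Phi> = \<Phi>, OF \<Phi>0 \<Phi>step])

lemma relpow_nonempty_if_progress:
  assumes "x \<in> X" and "\<And>x. x \<in> X \<Longrightarrow> \<exists>y\<in>X. (x, y) \<in> R"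
  shows "\<exists>y\<in>X. (x, y) \<in> R ^^ n"
  using assms by (induction n) (auto, blast)

text \<open>Proper configurations satisfying \<open>K\<close> always have a successor of the same
  kind: where a run ends it restarts, and the reset leads back to the initial configuration.\<close>

lemma unbounded_steps:
  assumes \<Phi>0: "\<Phi> 0 (s0, replicate m 0)"
    and progress: "\<And>k x. \<Phi> k x \<Longrightarrow> if acc (fst x) then again else
      (\<exists>x'. (x, x') \<in> nstep w wk \<and> \<Phi> (Suc k) x') \<or> (\<not> again \<and> (\<forall>x'. (x, x') \<notin> nstep w wk))"
    and again: "\<And>k x. again \<Longrightarrow> \<Phi> k x \<Longrightarrow> k < b * N w ^ c"
  shows "steps ^^ n \<noteq> {}"
proof -
  define X where "X = {G w p z a | z a. good a \<and> z \<in> CS \<and> K \<Phi> z a}"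
  have X_step: "\<exists>g'\<in>X. (G w p z a, g') \<in> steps"
    if a: "good a" and z: "z \<in> CS" and wk: "(z', j, d) \<in> cwk z (map (letter w) a)"
      and K: "K \<Phi> z' (a[j := mv (N w) d (a ! j)])" for z a z' j d
  proof -
    have cfg: "G w p z a \<in> clk.cfg" by (rule good_cfg[OF a z])
    then have z': "z' \<in> CS" "j < m + c"
      using clk.wk_closed[OF z _ _ wk] by (auto simp: clk.cfg_def G_def)
    then have "(G w p z a, G w p z' (a[j := mv (N w) d (a ! j)])) \<in> gstep w p cwk"
      using wk good_nth[OF a] a by (intro gstep_G) (auto simp: good_def)
    then show ?thesis
      using cfg good_update[OF a] z' K unfolding X_def by blast
  qed
  have exec: "\<exists>z' j d. (z', j, d) \<in> exec t s (map (letter w) a) \<and> K \<Phi> z' (a[j := mv (N w) d (a ! j)])"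
    if a: "good a" and s: "s \<in> S" and t: "t \<le> b" and \<Phi>: "\<Phi> (time a * b + t) (s, take m a)" for a s t
  proof -
    note K = exec_K[where \<Phi> = \<Phi>, OF a s t \<Phi>]
    let ?l = "map (letter w) a"
    consider (tick) "b \<le> t" | (acc) "t < b" "acc s" | (stuck) "t < b" "\<not> acc s" "wk s (take m ?l) = {}"
      | (step) "t < b" "\<not> acc s" "wk s (take m ?l) \<noteq> {}"
      using not_le by blast
    then show ?thesis
    proof cases
      case tick
      then have "(Tk 0 s, m, True) \<in> exec t s ?l" by (simp add: exec_def)
      from K[OF this] this show ?thesis by blast
    next
      case acc
      then have again using progress[OF \<Phi>] by simp
      with acc have "(Rs 0, 0, True) \<in> exec t s ?l" unfolding exec_def by simp
      from K[OF this] this show ?thesis by blast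
    next
      case stuck
      have "\<not> again" using progress[OF \<Phi>] stuck by (auto elim!: nstep_takeE)
      then have "(Rs 0, 0, True) \<in> exec t s ?l" using stuck unfolding exec_def by simp
      from K[OF this] this show ?thesis by blast
    next
      case step
      then obtain s1 j1 d1 where "(s1, j1, d1) \<in> wk s (take m ?l)"
        by (auto simp: ex_in_conv[symmetric])
      from nstep_takeI[OF this]
      obtain x' where "((s, take m a), x') \<in> nstep w wk" and \<Phi>': "\<Phi> (Suc (time a * b + t)) x'"
        using progress[OF \<Phi>] step(2) by auto
      then obtain s' j d where wk: "(s', j, d) \<in> wk s (take m ?l)"
        and x': "x' = (s', (take m a)[j := mv (N w) d (take m a ! j)])"
        by (elim nstep_takeE)
      then have "(Run (Suc t) s', j, d) \<in> exec t s ?l" using step by (auto simp: exec_def)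
      from K[OF this] this \<Phi>'[unfolded x'] show ?thesis by blast
    qed
  qed
  have "\<exists>g'\<in>X. (g, g') \<in> steps" if "g \<in> X" for g
  proof -
    obtain z a where g: "g = G w p z a" and a: "good a" and z: "z \<in> CS" and K: "K \<Phi> z a"
      using \<open>g \<in> X\<close> by (auto simp: X_def)
    show ?thesis
    proof (cases z)
      case (Rs k)
      have k: "k < m + c" using z Rs by simp
      then have lk: "map (letter w) a ! k = Star \<longleftrightarrow> a ! k = 0"
        using a good_nth[OF a k] letter_Star by (simp add: good_def)
      consider (move) "a ! k \<noteq> 0" | (advance) "a ! k = 0" "Suc k < m + c"
        | (exec) "a ! k = 0" "\<not> Suc k < m + c" by blast
      then show ?thesis
      proof cases
        case move
        then have "(Rs k, k, True) \<in> cwk z (map (letter w) a)" using lk by (simp add: Rs)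
        from X_step[OF a z this] show ?thesis using K by (simp add: g Rs)
      next
        case advance
        then have "(Rs (Suc k), Suc k, True) \<in> cwk z (map (letter w) a)" using lk by (simp add: Rs)
        from X_step[OF a z this] show ?thesis using K advance by (auto simp: g Rs elim!: less_SucE)
      next
        case exec2: exec
        have "a = replicate (m + c) 0"
        proof (rule nth_equalityI)
          show "length a = length (replicate (m + c) 0)" using a by (simp add: good_def)
          show "a ! i = replicate (m + c) 0 ! i" if "i < length a" for i
            using that a K exec2 by (cases "i = k") (auto simp: good_def Rs)
        qed
        then have "\<Phi> (time a * b + 0) (s0, take m a)" using \<Phi>0 time_replicate by simp
        from exec[OF a s0 _ this] obtain z' j d where "(z', j, d) \<in> exec 0 s0 (map (letter w) a)"
          "K \<Phi> z' (a[j := mv (N w) d (a ! j)])" by blast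
        moreover have "cwk z (map (letter w) a) = exec 0 s0 (map (letter w) a)"
          using exec2 lk by (simp add: Rs)
        ultimately show ?thesis using X_step[OF a z] by (simp add: g)
      qed
    next
      case (Tk i s)
      have i: "i < c" and s: "s \<in> S" using z Tk by auto
      have \<Phi>: "\<Phi> (time_carry i a * b) (s, take m a)" using K by (simp add: Tk)
      show ?thesis
      proof (cases "map (letter w) a ! (m + i) = Star")
        case False
        then have "\<Phi> (time a * b + 0) (s, take m a)" using \<Phi> by (simp add: carry_def)
        from exec[OF a s _ this] False show ?thesis using X_step[OF a z] by (auto simp: g Tk)
      next
        case True
        then have carry: "carry i (map (letter w) a) = N w ^ Suc i" by (simp add: carry_def)
        show ?thesis
        proof (cases "Suc i < c")
          case Suc: True
          then have "(Tk (Suc i) s, m + Suc i, True) \<in> cwk z (map (letter w) a)"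
            using True by (simp add: Tk)
          from X_step[OF a z this] show ?thesis
            using \<Phi> time_tick[OF a Suc] carry by (simp add: g)
        next
          case False
          then have "c = Suc i" using i by simp
          then have "b * N w ^ c \<le> time_carry i a * b" using carry by (simp add: mult.commute)
          then have "\<not> again" using again[OF _ \<Phi>] by auto
          then have "(Rs 0, 0, True) \<in> cwk z (map (letter w) a)"
            using True False unfolding Tk cwk.simps by simp
          from X_step[OF a z this] show ?thesis by (simp add: g)
        qed
      qed
    next
      case (Run t s)
      then have "s \<in> S" "t \<le> b" and \<Phi>: "\<Phi> (time a * b + t) (s, take m a)" using z K by auto
      from exec[OF a this] show ?thesis using X_step[OF a z] by (auto simp: g Run)
    qed
  qed
  moreover have "G w p (Rs 0) (replicate (m + c) 0) \<in> X"
    using good_replicate m unfolding X_def by fastforce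
  ultimately show ?thesis
    using relpow_nonempty_if_progress[of _ X steps n] by blast
qed

section \<open>Acceptance and the length of accepting runs\<close>

definition accepts :: bool where
  "accepts \<longleftrightarrow> (\<exists>s a. ((s0, replicate m 0), (s, a)) \<in> (nstep w wk)\<^sup>* \<and> acc s)"

lemma nstep_closed:
  assumes "((s0, replicate m 0), (s, a)) \<in> (nstep w wk)\<^sup>*"
  shows "s \<in> S \<and> length a = m \<and> set a \<subseteq> {..length w}"
  using assms
proof (induction rule: rtrancl_induct2)
  case refl
  then show ?case using s0 by auto
next
  case (step s a s' a')
  then obtain j d where wk: "(s', j, d) \<in> wk s (map (letter w) a)" and a': "a' = a[j := mv (N w) d (a ! j)]"
    by (auto simp: nstep_def)
  have "length (map (letter w) a) = m" "set (map (letter w) a) \<subseteq> insert Star Sig"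
    using step letter_in[OF w] by (auto simp: less_Suc_eq_le)
  then have "s' \<in> S" using wk_closed wk step by blast
  moreover have "mv (N w) d (a ! j) \<in> {..length w}"
    using mv_less[of "N w" d "a ! j"] by (simp only: atMost_iff less_Suc_eq_le)
  ultimately show ?case
    using step a' set_list_update_subset by (metis length_list_update)
qed

text \<open>Reachability in a finite relation needs no more steps than it has edges. There are at
  most \<open>card C ^ 2\<close> edges, whence the squares in the bounds on \<open>b\<close> and
  \<open>c\<close>.\<close>

lemma accepting_path:
  assumes accepts
  shows "\<exists>f k. f 0 = (s0, replicate m 0) \<and> (\<forall>i<k. (f i, f (Suc i)) \<in> nstep w wk) \<and>
    acc (fst (f k)) \<and> (\<forall>i<k. \<not> acc (fst (f i))) \<and> k < b * N w ^ c"
proof -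
  let ?x0 = "(s0, replicate m 0)"
  define C where "C = S \<times> {a. set a \<subseteq> {..length w} \<and> length a = m}"
  define R where "R = nstep w wk \<inter> C \<times> C"
  have C: "finite C" "card C = card S * N w ^ m"
    using finite_S finite_lists_length_eq[of "{..length w}" m] card_lists_length_eq[of "{..length w}" m]
    by (simp_all add: C_def card_cartesian_product)
  then have R: "finite R" by (simp add: R_def)
  have "card R \<le> card (C \<times> C)"
    using C by (intro card_mono) (auto simp: R_def)
  also have "\<dots> = card S * card S * N w ^ (2 * m)"
    by (simp add: card_cartesian_product C mult_2 power_add)
  also have "\<dots> \<le> card S * card S * N w ^ c"
    using c by (intro mult_left_mono power_increasing) auto
  also have "\<dots> < b * N w ^ c"
    using b by (intro mult_strict_right_mono) auto
  finally have card: "card R < b * N w ^ c" .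
  have reach: "(?x0, y) \<in> R\<^sup>*" if "(?x0, y) \<in> (nstep w wk)\<^sup>*" for y
    using that
  proof (induction rule: rtrancl_induct)
    case (step y z)
    have "y \<in> C" "z \<in> C"
      using nstep_closed[of "fst y" "snd y"] nstep_closed[of "fst z" "snd z"] step(1,2)
      by (auto simp: C_def mem_Times_iff intro: rtrancl_into_rtrancl)
    with step show ?case by (auto simp: R_def intro: rtrancl_into_rtrancl)
  qed simp
  define P where "P k \<longleftrightarrow> (\<exists>y. (?x0, y) \<in> R ^^ k \<and> acc (fst y))" for k
  have "\<exists>k\<le>card R. P k"
    using assms reach unfolding accepts_def rtrancl_finite_eq_relpow[OF R] P_def by fastforce
  then obtain k0 where k0: "k0 \<le> card R" "P k0" by blast
  \<comment> \<open>The least length, so that nothing before the end is accepting.\<close>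
  obtain k where k: "P k" "\<And>i. i < k \<Longrightarrow> \<not> P i"
    using exists_least_iff[of P] k0(2) by metis
  have "k \<le> card R" using k(2)[of k0] k0 by (meson le_trans not_le)
  then have k_less: "k < b * N w ^ c" using card by simp
  obtain y where y: "(?x0, y) \<in> R ^^ k" "acc (fst y)"
    using k(1) unfolding P_def by blast
  obtain f where f: "f 0 = ?x0" "f k = y" "\<And>i. i < k \<Longrightarrow> (f i, f (Suc i)) \<in> R"
    using y(1) unfolding relpow_fun_conv by blast
  have "(?x0, f i) \<in> R ^^ i" if "i < k" for i
    using f that unfolding relpow_fun_conv by (intro exI[of _ f]) auto
  then have "\<not> acc (fst (f i))" if "i < k" for i
    using k(2)[OF that] that unfolding P_def by blast
  then show ?thesis
    using f y k_less by (intro exI[of _ f] exI[of _ k]) (auto simp: R_def)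
qed

text \<open>For unboundedness the invariant follows one accepting path; for boundedness it is plain
  reachability.\<close>

theorem bounded_iff_not_accepts:
  assumes again
  shows "(\<exists>n. steps ^^ n = {}) \<longleftrightarrow> \<not> accepts"
proof (cases accepts)
  case True
  then obtain f k where f: "f 0 = (s0, replicate m 0)" "\<And>i. i < k \<Longrightarrow> (f i, f (Suc i)) \<in> nstep w wk"
    "acc (fst (f k))" "\<And>i. i < k \<Longrightarrow> \<not> acc (fst (f i))" "k < b * N w ^ c"
    using accepting_path by blast
  have "steps ^^ n \<noteq> {}" for n
  proof (rule unbounded_steps[where \<Phi> = "\<lambda>i x. i \<le> k \<and> x = f i"])
    show "if acc (fst x) then again else
        (\<exists>x'. (x, x') \<in> nstep w wk \<and> Suc i \<le> k \<and> x' = f (Suc i)) \<or>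
        (\<not> again \<and> (\<forall>x'. (x, x') \<notin> nstep w wk))"
      if "i \<le> k \<and> x = f i" for i x
    proof (cases "i = k")
      case False
      then have "(x, f (Suc i)) \<in> nstep w wk" "\<not> acc (fst x)" "Suc i \<le> k"
        using that f by auto
      then show ?thesis by (metis (full_types))
    qed (use that f assms in auto)
  qed (use f in auto)
  with True show ?thesis by blast
next
  case False
  have "\<exists>n. steps ^^ n = {}"
  proof (rule bounded_steps[where \<Phi> = "\<lambda>k x. ((s0, replicate m 0), x) \<in> (nstep w wk)\<^sup>*"])
    show "\<not> acc (fst x)" if "((s0, replicate m 0), x) \<in> (nstep w wk)\<^sup>*" for x
      using False that unfolding accepts_def by (metis prod.collapse)
  qed (use assms in \<open>auto intro: rtrancl_into_rtrancl\<close>)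
  with False show ?thesis by blast
qed

text \<open>Determinism makes the accepting path the only run, so following it is an invariant of
  all steps.\<close>

theorem bounded_iff_accepts:
  assumes "\<not> again" and det: "\<And>s l x y. s \<in> S \<Longrightarrow> x \<in> wk s l \<Longrightarrow> y \<in> wk s l \<Longrightarrow> x = y"
  shows "(\<exists>n. steps ^^ n = {}) \<longleftrightarrow> accepts"
proof (cases accepts)
  case True
  then obtain f k where f: "f 0 = (s0, replicate m 0)" "\<And>i. i < k \<Longrightarrow> (f i, f (Suc i)) \<in> nstep w wk"
    "acc (fst (f k))" "\<And>i. i < k \<Longrightarrow> \<not> acc (fst (f i))" "k < b * N w ^ c"
    using accepting_path by blast
  have S: "fst (f i) \<in> S" if "i \<le> k" for i
  proof -
    have "(f 0, f i) \<in> (nstep w wk)\<^sup>*"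
      using that by (induction i) (simp_all, metis Suc_le_eq f(2) less_imp_le rtrancl.rtrancl_into_rtrancl)
    then show ?thesis
      using nstep_closed[of "fst (f i)" "snd (f i)"] f(1) by simp
  qed
  have "\<exists>n. steps ^^ n = {}"
  proof (rule bounded_steps[where \<Phi> = "\<lambda>i x. i \<le> k \<and> x = f i"])
    show "Suc i \<le> k \<and> x' = f (Suc i)"
      if "i \<le> k \<and> x = f i" "\<not> acc (fst x)" "(x, x') \<in> nstep w wk" for i x x'
    proof -
      have i: "i < k" using that f(3) by (cases "i = k") auto
      have "(f i, f (Suc i)) \<in> nstep w wk" "(f i, x') \<in> nstep w wk"
        using f(2)[OF i] that by auto
      then have "x' = f (Suc i)"
        using nstep_deterministic[of wk "f i"] det S[of i] i by (metis less_imp_le)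
      then show ?thesis using i by simp
    qed
    show "i < b * N w ^ c \<and> (acc (fst x) \<or> (\<exists>x'. (x, x') \<in> nstep w wk))" if "i \<le> k \<and> x = f i" for i x
    proof (cases "i = k")
      case False
      then have "(x, f (Suc i)) \<in> nstep w wk" "i < b * N w ^ c"
        using that f by auto
      then show ?thesis by blast
    qed (use that f in auto)
  qed (use f assms in auto)
  with True show ?thesis by blast
next
  case False
  have "steps ^^ n \<noteq> {}" for n
  proof (rule unbounded_steps[where \<Phi> = "\<lambda>k x. ((s0, replicate m 0), x) \<in> (nstep w wk)\<^sup>*"])
    show "if acc (fst x) then again else
        (\<exists>x'. (x, x') \<in> nstep w wk \<and> ((s0, replicate m 0), x') \<in> (nstep w wk)\<^sup>*) \<or>
        (\<not> again \<and> (\<forall>x'. (x, x') \<notin> nstep w wk))"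
      if "((s0, replicate m 0), x) \<in> (nstep w wk)\<^sup>*" for x
      using that False assms(1) unfolding accepts_def
      by (metis prod.collapse rtrancl.rtrancl_into_rtrancl)
  qed (use assms in auto)
  with False show ?thesis by blast
qed

end

end

section \<open>Counter machines as multihead automata\<close>

text \<open>The forward half alone; it will bound the counters of the simulated Turing
  machine.\<close>

lemma stuttering_simulation_invariant:
  assumes init: "I c0 C0"
    and sim: "\<And>c C c'. I c C \<Longrightarrow> ready c \<Longrightarrow> (c, c') \<in> r \<Longrightarrow> \<exists>C'. (C, C') \<in> R \<and> I c' C'"
    and busy_sim: "\<And>c C c'. I c C \<Longrightarrow> \<not> ready c \<Longrightarrow> (c, c') \<in> r \<Longrightarrow> I c' C"
    and c: "(c0, c) \<in> r\<^sup>*"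
  shows "\<exists>C. (C0, C) \<in> R\<^sup>* \<and> I c C"
  using c
proof (induction rule: rtrancl_induct)
  case base
  then show ?case using init by blast
next
  case (step c c')
  then obtain C where C: "(C0, C) \<in> R\<^sup>*" "I c C" by blast
  show ?case
  proof (cases "ready c")
    case True
    then obtain C' where "(C, C') \<in> R" "I c' C'" using sim C step by blast
    then show ?thesis using C by (meson rtrancl.rtrancl_into_rtrancl)
  next
    case False
    then show ?thesis using busy_sim C step by blast
  qed
qed

text \<open>Ready configurations match step for step, the others do internal work that terminates
  along \<open>W\<close>. It serves twice: heads simulate counters, and counters simulate the work
  tape.\<close>

lemma stuttering_simulation:
  assumes init: "I c0 C0"
    and sim: "\<And>c C c'. I c C \<Longrightarrow> ready c \<Longrightarrow> (c, c') \<in> r \<Longrightarrow> \<exists>C'. (C, C') \<in> R \<and> I c' C'"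
    and cosim: "\<And>c C C'. I c C \<Longrightarrow> ready c \<Longrightarrow> (C, C') \<in> R \<Longrightarrow> \<exists>c'. (c, c') \<in> r \<and> I c' C'"
    and busy: "\<And>c C. I c C \<Longrightarrow> \<not> ready c \<Longrightarrow> \<exists>c'. (c, c') \<in> r"
    and busy_sim: "\<And>c C c'. I c C \<Longrightarrow> \<not> ready c \<Longrightarrow> (c, c') \<in> r \<Longrightarrow> I c' C \<and> (c', c) \<in> W"
    and W: "wf W"
    and acc: "\<And>c C. I c C \<Longrightarrow> acc c \<longleftrightarrow> ready c \<and> Acc C"
  shows "(\<exists>c. (c0, c) \<in> r\<^sup>* \<and> acc c) \<longleftrightarrow> (\<exists>C. (C0, C) \<in> R\<^sup>* \<and> Acc C)"
proof
  assume "\<exists>c. (c0, c) \<in> r\<^sup>* \<and> acc c"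
  then obtain c where c: "(c0, c) \<in> r\<^sup>*" "acc c" by blast
  have "\<exists>C. (C0, C) \<in> R\<^sup>* \<and> I c C"
  proof (rule stuttering_simulation_invariant[where I = I and ready = ready, OF init])
    show "\<exists>C'. (C, C') \<in> R \<and> I c' C'" if "I c C" "ready c" "(c, c') \<in> r" for c C c'
      using sim[OF that] .
    show "I c' C" if "I c C" "\<not> ready c" "(c, c') \<in> r" for c C c'
      using busy_sim[OF that] by simp
  qed (rule c)
  then show "\<exists>C. (C0, C) \<in> R\<^sup>* \<and> Acc C" using acc c(2) by blast
next
  have catch_up: "\<exists>c'. (c, c') \<in> r\<^sup>* \<and> ready c' \<and> I c' C" if "I c C" for c C
    using that
  proof (induction c rule: wf_induct_rule[OF W])
    case (1 c)
    show ?case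
    proof (cases "ready c")
      case False
      then obtain c' where c': "(c, c') \<in> r" using busy 1(2) by blast
      then have "I c' C" "(c', c) \<in> W" using busy_sim 1(2) False by blast+
      then show ?thesis using 1(1) c' by (meson converse_rtrancl_into_rtrancl)
    qed (use 1 in blast)
  qed
  have "\<exists>c. (c0, c) \<in> r\<^sup>* \<and> ready c \<and> I c C" if "(C0, C) \<in> R\<^sup>*" for C
    using that
  proof (induction rule: rtrancl_induct)
    case base
    then show ?case using catch_up[OF init] .
  next
    case (step C C')
    then obtain c where c: "(c0, c) \<in> r\<^sup>*" "ready c" "I c C" by blast
    then obtain c' where c': "(c, c') \<in> r" "I c' C'" using cosim step by blast
    obtain c'' where "(c', c'') \<in> r\<^sup>*" "ready c''" "I c'' C'" using catch_up[OF c'(2)] by blast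
    then show ?case using c c' by (meson rtrancl.rtrancl_into_rtrancl rtrancl_trans)
  qed
  then show "\<exists>C. (C0, C) \<in> R\<^sup>* \<and> Acc C \<Longrightarrow> \<exists>c. (c0, c) \<in> r\<^sup>* \<and> acc c"
    using acc by blast
qed

section \<open>Counter programs and their compilation to head moves\<close>

datatype cop = Inc nat | Dec nat | Hd bool | Nop

type_synonym 'q counter_program = "'q \<Rightarrow> con \<Rightarrow> (nat \<Rightarrow> bool) \<Rightarrow> ('q \<times> cop) set"

fun apply_op :: "nat \<Rightarrow> cop \<Rightarrow> nat \<times> (nat \<Rightarrow> nat) \<Rightarrow> nat \<times> (nat \<Rightarrow> nat)" where
  "apply_op N (Inc X) (x, v) = (x, v(X := Suc (v X)))"
| "apply_op N (Dec X) (x, v) = (x, v(X := v X - 1))"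
| "apply_op N (Hd d) (x, v) = (mv N d x, v)"
| "apply_op N Nop (x, v) = (x, v)"

fun op_ok :: "(nat \<Rightarrow> bool) \<Rightarrow> cop \<Rightarrow> bool" where
  "op_ok z (Inc X) \<longleftrightarrow> X < 3"
| "op_ok z (Dec X) \<longleftrightarrow> X < 3 \<and> \<not> z X"
| "op_ok z (Hd d) \<longleftrightarrow> True"
| "op_ok z Nop \<longleftrightarrow> True"

definition cstep ::
  "con list \<Rightarrow> 'q counter_program \<Rightarrow> (('q \<times> nat \<times> (nat \<Rightarrow> nat)) \<times> ('q \<times> nat \<times> (nat \<Rightarrow> nat))) set" where
  "cstep w cp = {((q, x, v), (q', y)). \<exists>op. (q', op) \<in> cp q (letter w x) (\<lambda>X. X < 3 \<and> v X = 0) \<and>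
     y = apply_op (Suc (length w)) op (x, v)}"

text \<open>Register 0 is the input head and register 1 a dummy, moved by steps that should do nothing.
The boot states decide the empty word, on which registers hold no information.\<close>

datatype 'q mstate = Boot | Boot2 | Yes | Cm 'q | IncS nat nat 'q | DecS nat nat 'q

locale counter_mha =
  fixes Sig :: "con set" and C :: "'q set" and cp :: "'q counter_program" and q0 :: 'q
    and cacc :: "'q \<Rightarrow> bool" and D :: nat and eacc :: bool
  assumes finite_Sig: "finite Sig" and Star: "Star \<notin> Sig" and finite_C: "finite C"
    and q0: "q0 \<in> C" and D: "0 < D"
    and cp_closed: "q \<in> C \<Longrightarrow> (q', op) \<in> cp q a z \<Longrightarrow> q' \<in> C \<and> op_ok z op"
begin

definition m :: nat where
  "m = 2 + 3 * D"

lemma m_gt [simp]: "0 < m" "Suc 0 < m"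
  by (simp_all add: m_def)

definition reg :: "nat \<Rightarrow> nat \<Rightarrow> nat" where
  "reg X i = 2 + X * D + i"

lemma reg_less: "X < 3 \<Longrightarrow> i < D \<Longrightarrow> reg X i < m"
proof -
  assume "X < 3" "i < D"
  then have "X * D \<le> 2 * D" by (intro mult_right_mono) auto
  moreover have "2 * D + D = 3 * D" by simp
  ultimately show ?thesis using \<open>i < D\<close> unfolding reg_def m_def by linarith
qed

lemma reg_eq_iff:
  assumes "i < D" "j < D"
  shows "reg X i = reg Y j \<longleftrightarrow> X = Y \<and> i = j"
proof
  assume "reg X i = reg Y j"
  then have eq: "X * D + i = Y * D + j" by (simp add: reg_def)
  have "X = (X * D + i) div D" "Y = (Y * D + j) div D" using assms by simp_all
  then have "X = Y" using eq by simp
  then show "X = Y \<and> i = j" using eq by simp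
qed simp

lemma reg_neq [simp]: "reg X i \<noteq> 0" "reg X i \<noteq> Suc 0"
  by (auto simp: reg_def)

text \<open>A digit reads \<open>Star\<close> after an increment that carries, but before a
  decrement that borrows. Hence \<open>Inc\<close> moves digit 0 at once and tests afterwards, while
  \<open>Dec\<close> makes a dummy move and tests before each move.\<close>

fun start_op :: "'q \<Rightarrow> cop \<Rightarrow> 'q mstate \<times> nat \<times> bool" where
  "start_op q (Inc X) = (IncS X 0 q, reg X 0, True)"
| "start_op q (Dec X) = (DecS X 0 q, 1, True)"
| "start_op q (Hd d) = (Cm q, 0, d)"
| "start_op q Nop = (Cm q, 1, True)"

fun mwk :: "'q mstate program" where
  "mwk Boot l = {(Boot2, 1, True)}"
| "mwk Boot2 l = (if l ! 1 = Star then (if eacc then {(Yes, 1, True)} else {}) else {(Cm q0, 1, True)})"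
| "mwk Yes l = {}"
| "mwk (Cm q) l = (\<lambda>(q', op). start_op q' op) ` cp q (l ! 0) (\<lambda>X. X < 3 \<and> (\<forall>i<D. l ! reg X i = Star))"
| "mwk (IncS X i q) l = (if l ! reg X i = Star \<and> Suc i < D then {(IncS X (Suc i) q, reg X (Suc i), True)}
     else {(Cm q, 1, True)})"
| "mwk (DecS X i q) l = (if i < D then {(if l ! reg X i = Star then DecS X (Suc i) q else Cm q, reg X i, False)}
     else {(Cm q, 1, True)})"

fun macc :: "'q mstate \<Rightarrow> bool" where
  "macc Yes \<longleftrightarrow> True"
| "macc (Cm q) \<longleftrightarrow> cacc q"
| "macc _ \<longleftrightarrow> False"

definition MS :: "'q mstate set" where
  "MS = {Boot, Boot2, Yes} \<union> Cm ` C \<union> (\<lambda>(X, i, q). IncS X i q) ` ({..<3} \<times> {..<D} \<times> C) \<union>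
     (\<lambda>(X, i, q). DecS X i q) ` ({..<3} \<times> {..D} \<times> C)"

lemma MS_iff [simp]:
  "Boot \<in> MS" "Boot2 \<in> MS" "Yes \<in> MS" "Cm q \<in> MS \<longleftrightarrow> q \<in> C"
  "IncS X i q \<in> MS \<longleftrightarrow> X < 3 \<and> i < D \<and> q \<in> C" "DecS X i q \<in> MS \<longleftrightarrow> X < 3 \<and> i \<le> D \<and> q \<in> C"
  by (auto simp: MS_def image_iff)

lemma mwk_closed:
  assumes "z \<in> MS" "(z', j, d) \<in> mwk z l"
  shows "z' \<in> MS \<and> j < m"
proof (cases z)
  case (Cm q)
  then obtain q' op where op: "(q', op) \<in> cp q (l ! 0) (\<lambda>X. X < 3 \<and> (\<forall>i<D. l ! reg X i = Star))"
    and eq: "(z', j, d) = start_op q' op"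
    using assms by auto
  then have "q' \<in> C" "op_ok (\<lambda>X. X < 3 \<and> (\<forall>i<D. l ! reg X i = Star)) op"
    using cp_closed[OF _ op] assms(1) Cm by auto
  then show ?thesis using eq D by (cases op) (auto simp: reg_less)
qed (use assms q0 D in \<open>auto simp: reg_less split: if_splits\<close>)

sublocale mach: mha Sig MS m mwk
proof
  show "finite MS" using finite_C by (simp add: MS_def)
qed (use finite_Sig Star mwk_closed in auto)

lemma mwk_deterministic:
  assumes det: "\<And>q a z x y. x \<in> cp q a z \<Longrightarrow> y \<in> cp q a z \<Longrightarrow> x = y"
    and "x \<in> mwk z l" "y \<in> mwk z l"
  shows "x = y"
proof (cases z)
  case (Cm q)
  then show ?thesis using assms det by (auto dest: det)
qed (use assms in \<open>auto split: if_splits\<close>)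

context
  fixes w :: "con list"
  assumes w: "set w \<subseteq> Sig"
begin

definition maccepts :: bool where
  "maccepts \<longleftrightarrow> (\<exists>z a. ((Boot, replicate m 0), (z, a)) \<in> (nstep w mwk)\<^sup>* \<and> macc z)"

lemma nstep_iff: "((z, a), y) \<in> nstep w mwk \<longleftrightarrow>
    (\<exists>z' j d. (z', j, d) \<in> mwk z (map (letter w) a) \<and> y = (z', a[j := mv (Suc (length w)) d (a ! j)]))"
  by (cases y) (auto simp: nstep_def)

text \<open>On a circle of one cell the dummy head is back on \<open>Star\<close> after its first
  move, which \<open>Boot2\<close> detects.\<close>

lemma maccepts_empty:
  assumes "w = []"
  shows "maccepts \<longleftrightarrow> eacc"
proof
  assume eacc
  let ?a = "replicate m 0 :: nat list"
  have "mv (Suc 0) True x = 0" for x by (simp add: mv_def)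
  then have upd: "?a = ?a[1 := mv (Suc (length w)) True (?a ! 1)]"
    using assms list_update_id[of ?a 1] by simp
  have "(Boot2, 1, True) \<in> mwk Boot (map (letter w) ?a)" by simp
  then have "((Boot, ?a), (Boot2, ?a)) \<in> nstep w mwk"
    unfolding nstep_iff using upd by blast
  moreover have "(Yes, 1, True) \<in> mwk Boot2 (map (letter w) ?a)"
    unfolding mwk.simps using \<open>eacc\<close> by (simp add: letter_def)
  then have "((Boot2, ?a), (Yes, ?a)) \<in> nstep w mwk"
    unfolding nstep_iff using upd by blast
  ultimately have "((Boot, ?a), (Yes, ?a)) \<in> (nstep w mwk)\<^sup>*"
    by (meson r_into_rtrancl rtrancl_trans)
  then show maccepts unfolding maccepts_def by force
next
  assume maccepts
  then obtain z a where "((Boot, replicate m 0), (z, a)) \<in> (nstep w mwk)\<^sup>*" "macc z"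
    by (auto simp: maccepts_def)
  from this(1) have "(z \<in> {Boot, Boot2} \<and> a ! 1 = 0 \<and> length a = m) \<or> (z = Yes \<and> eacc)"
  proof (induction rule: rtrancl_induct2)
    case refl
    then show ?case by simp
  next
    case (step z a z' a')
    obtain j d where mwk: "(z', j, d) \<in> mwk z (map (letter w) a)"
      and a': "a' = a[j := mv (Suc (length w)) d (a ! j)]"
      using step(2) unfolding nstep_iff by blast
    from step(3) consider "z = Boot" "length a = m" | "z = Boot2" "a ! 1 = 0" "length a = m" | "z = Yes"
      by auto
    then show ?case
      by cases (use mwk assms in \<open>auto simp: a' mv_def letter_def split: if_splits\<close>)
  qed
  with \<open>macc z\<close> show eacc by auto
qed

section \<open>Odometers of heads as counter values\<close>

abbreviation "N \<equiv> Suc (length w)"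

definition val :: "nat list \<Rightarrow> nat \<Rightarrow> nat" where
  "val a X = digits_value N (\<lambda>i. a ! reg X i) D"

definition good :: "nat list \<Rightarrow> bool" where
  "good a \<longleftrightarrow> length a = m \<and> set a \<subseteq> {..length w}"

lemma good_nth: "good a \<Longrightarrow> j < m \<Longrightarrow> a ! j < N"
  unfolding good_def by (metis atMost_iff less_Suc_eq_le nth_mem subsetD)

lemma good_update: "good a \<Longrightarrow> good (a[j := mv N d x])"
  unfolding good_def using set_list_update_subset[of a "{..length w}" "mv N d x" j] mv_less[of N d x]
  by (simp add: less_Suc_eq_le)

lemma val_less: "good a \<Longrightarrow> X < 3 \<Longrightarrow> val a X < N ^ D"
  unfolding val_def by (intro digits_value_less good_nth reg_less)

lemma letter_Star: "good a \<Longrightarrow> j < m \<Longrightarrow> map (letter w) a ! j = Star \<longleftrightarrow> a ! j = 0"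
  using letter_eq_Star[OF w Star good_nth] by (simp add: good_def)

lemma val_update_other:
  assumes "\<And>i. i < D \<Longrightarrow> j \<noteq> reg X i"
  shows "val (a[j := x]) X = val a X"
  unfolding val_def by (rule digits_value_cong) (use assms in auto)

lemma val_update_low [simp]: "val (a[0 := x]) X = val a X" "val (a[Suc 0 := x]) X = val a X"
  by (rule val_update_other, use reg_neq in metis)+

lemma val_update_reg:
  assumes "good a" "X < 3" "i < D"
  shows "val (a[reg X i := x]) X = digits_value N ((\<lambda>i. a ! reg X i)(i := x)) D"
  unfolding val_def
  by (rule digits_value_cong) (use assms reg_less in \<open>auto simp: good_def nth_list_update reg_eq_iff\<close>)

lemma val_forward:
  assumes "good a" "X < 3" "i < D"
  shows "val (a[reg X i := mv N True (a ! reg X i)]) X + (if mv N True (a ! reg X i) = 0 then N ^ Suc i else 0) =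
    val a X + N ^ i"
  using digits_value_forward[OF assms(3), of "\<lambda>i. a ! reg X i" N] good_nth[OF assms(1) reg_less] assms
  by (simp add: val_update_reg) (simp add: val_def)

lemma val_backward:
  assumes "good a" "X < 3" "i < D"
  shows "val (a[reg X i := mv N False (a ! reg X i)]) X + N ^ i =
    val a X + (if a ! reg X i = 0 then N ^ Suc i else 0)"
  using digits_value_backward[OF assms(3), of "\<lambda>i. a ! reg X i" N] good_nth[OF assms(1) reg_less] assms
  by (simp add: val_update_reg) (simp add: val_def)

lemma val_eq_0_iff:
  assumes "good a" "X < 3"
  shows "val a X = 0 \<longleftrightarrow> (\<forall>i<D. map (letter w) a ! reg X i = Star)"
  using letter_Star[OF assms(1) reg_less[OF assms(2)]] by (auto simp: val_def digits_value_eq_0_iff)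

abbreviation "creach c \<equiv> ((q0, 0, \<lambda>_. 0), c) \<in> (cstep w cp)\<^sup>*"

text \<open>In the loops the counter machine is already past its operation:
  \<open>IncS X i q\<close> owes a carry if digit \<open>i\<close> has just wrapped, and
  \<open>DecS X i q\<close> still has to subtract \<open>N ^ i\<close>. Reachability is recorded so
  that the bound \<open>safe\<close> applies.\<close>

fun Icm :: "'q mstate \<times> nat list \<Rightarrow> 'q \<times> nat \<times> (nat \<Rightarrow> nat) \<Rightarrow> bool" where
  "Icm (Boot, a) c \<longleftrightarrow> a = replicate m 0 \<and> c = (q0, 0, \<lambda>_. 0)"
| "Icm (Boot2, a) c \<longleftrightarrow> a = (replicate m 0)[1 := 1] \<and> c = (q0, 0, \<lambda>_. 0)"
| "Icm (Yes, a) c \<longleftrightarrow> False"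
| "Icm (Cm q, a) (q', x, v) \<longleftrightarrow> good a \<and> creach (q', x, v) \<and> q' = q \<and> a ! 0 = x \<and> (\<forall>Y<3. val a Y = v Y)"
| "Icm (IncS X i q, a) (q', x, v) \<longleftrightarrow> good a \<and> creach (q', x, v) \<and> X < 3 \<and> i < D \<and> q' = q \<and> a ! 0 = x \<and>
     (\<forall>Y<3. Y \<noteq> X \<longrightarrow> val a Y = v Y) \<and> val a X + (if a ! reg X i = 0 then N ^ Suc i else 0) = v X"
| "Icm (DecS X i q, a) (q', x, v) \<longleftrightarrow> good a \<and> creach (q', x, v) \<and> X < 3 \<and> i \<le> D \<and> q' = q \<and> a ! 0 = x \<and>
     (\<forall>Y<3. Y \<noteq> X \<longrightarrow> val a Y = v Y) \<and> val a X = v X + N ^ i"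

fun is_Cm :: "'q mstate \<times> nat list \<Rightarrow> bool" where
  "is_Cm (Cm q, a) \<longleftrightarrow> True"
| "is_Cm _ \<longleftrightarrow> False"

fun busyness :: "'q mstate \<times> nat list \<Rightarrow> nat" where
  "busyness (Boot, a) = 2"
| "busyness (Boot2, a) = 1"
| "busyness (IncS X i q, a) = Suc D - i"
| "busyness (DecS X i q, a) = Suc D - i"
| "busyness _ = 0"

lemma creach_closed: "creach c \<Longrightarrow> fst c \<in> C"
proof (induction rule: rtrancl_induct)
  case (step c c')
  then show ?case using cp_closed by (auto simp: cstep_def)
qed (use q0 in simp)

lemma val_other_reg: "X \<noteq> Y \<Longrightarrow> i < D \<Longrightarrow> val (a[reg X i := x]) Y = val a Y"
  by (intro val_update_other) (auto simp: reg_eq_iff)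

context
  assumes nonempty: "w \<noteq> []"
    and safe: "\<And>q x v X. creach (q, x, v) \<Longrightarrow> X < 3 \<Longrightarrow> v X < N ^ D"
begin

lemma val_zeros: "(\<And>j. 2 \<le> j \<Longrightarrow> j < m \<Longrightarrow> a ! j = 0) \<Longrightarrow> Y < 3 \<Longrightarrow> val a Y = 0"
  unfolding val_def using reg_less by (auto simp: digits_value_eq_0_iff reg_def)

lemma busy_step:
  assumes I: "Icm g c" and busy: "\<not> is_Cm g" and step: "(g, g') \<in> nstep w mwk"
  shows "Icm g' c \<and> (g', g) \<in> measure busyness"
proof -
  obtain z a where g: "g = (z, a)" by (cases g)
  obtain q x v where c: "c = (q, x, v)" using prod_cases3 by blast
  obtain z' j d where mwk: "(z', j, d) \<in> mwk z (map (letter w) a)" and g': "g' = (z', a[j := mv N d (a ! j)])"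
    using step unfolding g nstep_iff by blast
  show ?thesis
  proof (cases z)
    case Boot
    have "mv N True 0 = 1" using nonempty by (cases w) (auto simp: mv_def)
    then show ?thesis using I mwk by (auto simp: g c g' Boot)
  next
    case Boot2
    have a: "a = (replicate m 0)[1 := 1]" using I by (simp add: g c Boot2)
    have "Suc 0 \<le> length w" using nonempty by (cases w) auto
    then have "good a"
      using set_list_update_subset[of "replicate m 0" "{..length w}" 1 1] by (auto simp: good_def a)
    moreover have "map (letter w) a ! 1 \<noteq> Star"
      using letter_Star[OF \<open>good a\<close>, of 1] by (simp add: a)
    then have "z' = Cm q0" "j = 1" "d" using mwk by (auto simp: Boot2)
    ultimately show ?thesis
      using I good_update[OF \<open>good a\<close>, of 1 True "a ! 1"]
      by (auto simp: g c g' Boot2 a intro!: val_zeros)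
  next
    case (IncS X i q')
    have *: "good a" "X < 3" "i < D" "q' = q" "a ! 0 = x" "\<forall>Y<3. Y \<noteq> X \<longrightarrow> val a Y = v Y" "creach (q, x, v)"
      and vX: "val a X + (if a ! reg X i = 0 then N ^ Suc i else 0) = v X"
      using I by (auto simp: g c IncS)
    have vless: "v X < N ^ D" using safe * by blast
    have Star_iff: "map (letter w) a ! reg X i = Star \<longleftrightarrow> a ! reg X i = 0"
      using letter_Star[OF *(1) reg_less] * by blast
    show ?thesis
    proof (cases "a ! reg X i = 0")
      case True
      \<comment> \<open>A carry out of the top digit would make the counter at least
        \<open>N ^ D\<close>.\<close>
      have "Suc i < D"
      proof (rule ccontr)
        assume "\<not> Suc i < D"
        then have "Suc i = D" using * by simp
        then show False using vX vless True by simp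
      qed
      then have z': "z' = IncS X (Suc i) q'" "j = reg X (Suc i)" "d"
        using mwk True Star_iff by (auto simp: IncS)
      show ?thesis
        using val_forward[OF *(1,2) \<open>Suc i < D\<close>] * vX True \<open>Suc i < D\<close> good_update[OF *(1)] reg_less[of X "Suc i"]
        by (auto simp: g c g' IncS z' val_other_reg good_def)
    next
      case False
      then have "z' = Cm q'" "j = 1" "d" using mwk Star_iff by (auto simp: IncS)
      then show ?thesis using * vX False good_update[OF *(1)] by (auto simp: g c g' IncS)
    qed
  next
    case (DecS X i q')
    have *: "good a" "X < 3" "i \<le> D" "q' = q" "a ! 0 = x" "\<forall>Y<3. Y \<noteq> X \<longrightarrow> val a Y = v Y" "creach (q, x, v)"
      and vX: "val a X = v X + N ^ i"
      using I by (auto simp: g c DecS)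
    \<comment> \<open>A borrow beyond the top digit would need an odometer value of at least
      \<open>N ^ D\<close>.\<close>
    have i: "i < D"
      using val_less[OF *(1,2)] vX * by (cases "i = D") auto
    have Star_iff: "map (letter w) a ! reg X i = Star \<longleftrightarrow> a ! reg X i = 0"
      using letter_Star[OF *(1) reg_less] * i by blast
    have j: "j = reg X i" "\<not> d" and z': "z' = (if a ! reg X i = 0 then DecS X (Suc i) q' else Cm q')"
      using mwk i Star_iff by (auto simp: DecS)
    have "\<forall>Y<3. Y \<noteq> X \<longrightarrow> val (a[reg X i := mv N False (a ! reg X i)]) Y = v Y"
      using * i by (auto simp: val_other_reg)
    moreover have "val (a[reg X i := mv N False (a ! reg X i)]) X + N ^ i =
        v X + N ^ i + (if a ! reg X i = 0 then N ^ Suc i else 0)"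
      using val_backward[OF *(1,2) i] vX by simp
    moreover have "a[reg X i := mv N False (a ! reg X i)] ! 0 = x"
      using * by simp
    ultimately show ?thesis
      using * i j good_update[OF *(1), of "reg X i" False "a ! reg X i"]
      by (cases "a ! reg X i = 0") (simp_all add: g c g' DecS z', metis)
  qed (use I busy in \<open>auto simp: g c\<close>)
qed

lemma ready_op:
  assumes I: "Icm (Cm q, a) (q, x, v)" and q': "creach (q', apply_op N op (x, v))"
    and ok: "op_ok (\<lambda>X. X < 3 \<and> v X = 0) op" and eq: "start_op q' op = (z', j, d)"
  shows "Icm (z', a[j := mv N d (a ! j)]) (q', apply_op N op (x, v))"
proof -
  have *: "good a" "a ! 0 = x" "\<forall>Y<3. val a Y = v Y" using I by auto
  have len: "length a = m" using *(1) by (simp add: good_def)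
  show ?thesis
  proof (cases op)
    case (Inc X)
    then have "X < 3" using ok by simp
    then show ?thesis
      using eq q' * val_forward[OF *(1) \<open>X < 3\<close> D] good_update[OF *(1)] D reg_less[OF \<open>X < 3\<close> D]
      by (auto simp: Inc val_other_reg len)
  next
    case (Dec X)
    then have "X < 3" "0 < v X" using ok by auto
    then show ?thesis
      using eq q' * good_update[OF *(1)] by (auto simp: Dec)
  next
    case (Hd d)
    then show ?thesis using eq q' * good_update[OF *(1)] len by auto
  next
    case Nop
    then show ?thesis using eq q' * good_update[OF *(1)] by auto
  qed
qed

lemma ready_steps:
  assumes I: "Icm (Cm q, a) (q, x, v)"
  shows "((Cm q, a), g') \<in> nstep w mwk \<longleftrightarrow>
    (\<exists>q' op z' j d. (q', op) \<in> cp q (letter w x) (\<lambda>X. X < 3 \<and> v X = 0) \<and> start_op q' op = (z', j, d) \<and>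
      g' = (z', a[j := mv N d (a ! j)]))"
proof -
  have *: "good a" "a ! 0 = x" "\<forall>Y<3. val a Y = v Y" using I by auto
  have "(\<lambda>X. X < 3 \<and> (\<forall>i<D. map (letter w) a ! reg X i = Star)) = (\<lambda>X. X < 3 \<and> v X = 0)"
    using * val_eq_0_iff[OF *(1)] by (intro ext) metis
  moreover have "map (letter w) a ! 0 = letter w x" using * by (simp add: good_def)
  moreover have "(\<exists>z' j d. (z', j, d) \<in> (\<lambda>(q', op). start_op q' op) ` A \<and> P z' j d) \<longleftrightarrow>
      (\<exists>q' op z' j d. (q', op) \<in> A \<and> start_op q' op = (z', j, d) \<and> P z' j d)" (is "?L \<longleftrightarrow> ?R") for A P
  proof
    assume ?L
    then obtain z' j d qo where "qo \<in> A" "(z', j, d) = (\<lambda>(q', op). start_op q' op) qo" "P z' j d" by blast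
    then show ?R by (cases qo) (metis case_prod_conv)
  next
    assume ?R
    then show ?L by (metis (no_types, lifting) case_prod_conv image_eqI)
  qed
  ultimately show ?thesis unfolding nstep_iff mwk.simps by simp
qed

lemma maccepts_nonempty: "maccepts \<longleftrightarrow> (\<exists>c. creach c \<and> cacc (fst c))"
proof -
  have sim: "\<exists>c'. (c, c') \<in> cstep w cp \<and> Icm g' c'"
    if I: "Icm g c" "is_Cm g" and step: "(g, g') \<in> nstep w mwk" for g c g'
  proof -
    obtain q a x v where g: "g = (Cm q, a)" and c: "c = (q, x, v)"
      using I by (cases "(g, c)" rule: Icm.cases) auto
    obtain q' op z' j d where op: "(q', op) \<in> cp q (letter w x) (\<lambda>X. X < 3 \<and> v X = 0)"
      and z': "start_op q' op = (z', j, d)" and g': "g' = (z', a[j := mv N d (a ! j)])"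
      using ready_steps[of q a x v g'] I step unfolding g c by auto
    have st: "(c, (q', apply_op N op (x, v))) \<in> cstep w cp"
      using op by (auto simp: cstep_def c)
    moreover have reach: "creach (q, x, v)" using I by (simp add: g c)
    ultimately have "creach (q', apply_op N op (x, v))"
      unfolding c by (rule rtrancl.rtrancl_into_rtrancl[rotated])
    then show ?thesis
      using ready_op[of q a x v q' op z' j d] I cp_closed[OF creach_closed[OF reach, simplified] op] z' st
      unfolding g c g' by blast
  qed
  have cosim: "\<exists>g'. (g, g') \<in> nstep w mwk \<and> Icm g' c'"
    if I: "Icm g c" "is_Cm g" and step: "(c, c') \<in> cstep w cp" for g c c'
  proof -
    obtain q a x v where g: "g = (Cm q, a)" and c: "c = (q, x, v)"
      using I by (cases "(g, c)" rule: Icm.cases) auto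
    obtain q' op where op: "(q', op) \<in> cp q (letter w x) (\<lambda>X. X < 3 \<and> v X = 0)"
      and c': "c' = (q', apply_op N op (x, v))"
      using step by (auto simp: cstep_def c)
    obtain z' j d where z': "start_op q' op = (z', j, d)" using prod_cases3 by blast
    have reach: "creach (q, x, v)" using I by (simp add: g c)
    then have "creach c'"
      using step unfolding c by (rule rtrancl.rtrancl_into_rtrancl)
    then have "Icm (z', a[j := mv N d (a ! j)]) c'"
      using ready_op[of q a x v q' op z' j d] I cp_closed[OF creach_closed[OF reach, simplified] op] z'
      unfolding g c c' by blast
    moreover have "(g, (z', a[j := mv N d (a ! j)])) \<in> nstep w mwk"
      using ready_steps[of q a x v] I op z' unfolding g c by blast
    ultimately show ?thesis by blast
  qed
  have busy: "\<exists>g'. (g, g') \<in> nstep w mwk" if "Icm g c" "\<not> is_Cm g" for g c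
  proof -
    obtain z a where g: "g = (z, a)" by (cases g)
    have "mwk z (map (letter w) a) \<noteq> {}"
      using that letter_Star[of "(replicate m 0)[1 := 1]" 1] nonempty unfolding g
    proof (cases z)
      case Boot2
      have "letter w 1 \<noteq> Star"
        using letter_eq_Star[OF w Star, of 1] nonempty by (cases w) auto
      then show ?thesis using that by (simp add: g Boot2)
    qed (auto simp: g)
    then show ?thesis unfolding g nstep_iff by (metis ex_in_conv surj_pair)
  qed
  have "(\<exists>g. ((Boot, replicate m 0), g) \<in> (nstep w mwk)\<^sup>* \<and> macc (fst g)) \<longleftrightarrow> (\<exists>c. creach c \<and> cacc (fst c))"
  proof (rule stuttering_simulation[where I = Icm and ready = is_Cm and W = "measure busyness"])
    show "macc (fst g) \<longleftrightarrow> is_Cm g \<and> cacc (fst c)" if "Icm g c" for g c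
      using that by (cases "(g, c)" rule: Icm.cases) auto
  qed (use sim cosim busy busy_step in \<open>auto simp del: in_measure\<close>)
  then show ?thesis by (auto simp: maccepts_def)
qed

end

end

end

section \<open>Logarithmic space machines as counter machines\<close>

text \<open>\<open>lft g tp j\<close> encodes the cells to the left of \<open>j\<close> as a stack of base \<open>g\<close> digits. Its symbols are
shifted by one, so that 0 encodes the empty stack only; to the right the blank symbol 0 provides an
unbounded supply of empty cells.\<close>

fun lft :: "nat \<Rightarrow> (nat \<Rightarrow> nat) \<Rightarrow> nat \<Rightarrow> nat" where
  "lft g tp 0 = 0"
| "lft g tp (Suc j) = lft g tp j * g + Suc (tp j)"

fun rgt :: "nat \<Rightarrow> (nat \<Rightarrow> nat) \<Rightarrow> nat \<Rightarrow> nat \<Rightarrow> nat" where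
  "rgt g tp j 0 = 0"
| "rgt g tp j (Suc H) = tp (Suc j) + g * rgt g tp (Suc j) H"

lemma lft_upd [simp]: "j \<le> i \<Longrightarrow> lft g (tp(i := a)) j = lft g tp j"
  by (induction j) auto

lemma rgt_upd [simp]: "i \<le> j \<Longrightarrow> rgt g (tp(i := a)) j H = rgt g tp j H"
  by (induction H arbitrary: j) auto

text \<open>Blank cells are leading zeros. This compensates for the shift of the window when the
  work head moves.\<close>

lemma rgt_Suc_eq: "(\<And>x. j + H < x \<Longrightarrow> tp x = 0) \<Longrightarrow> rgt g tp j (Suc H) = rgt g tp j H"
proof (induction H arbitrary: j)
  case (Suc H)
  have "rgt g tp (Suc j) (Suc H) = rgt g tp (Suc j) H"
    by (rule Suc.IH) (use Suc.prems in auto)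
  then show ?case by (metis rgt.simps(2))
qed simp

lemma digit_append_less: "x < g ^ n \<Longrightarrow> d < g \<Longrightarrow> d + g * x < g ^ Suc n" for x g n d :: nat
proof -
  assume "x < g ^ n" "d < g"
  then have "d + g * x < g * Suc x" by simp
  also have "\<dots> \<le> g * g ^ n" using \<open>x < g ^ n\<close> by (intro mult_left_mono) auto
  finally show ?thesis by simp
qed

lemma lft_less: "(\<And>x. Suc (tp x) < g) \<Longrightarrow> lft g tp j < g ^ j"
proof (induction j)
  case (Suc j)
  then show ?case
    using digit_append_less[of "lft g tp j" g j "Suc (tp j)"] by (simp add: ac_simps)
qed simp

lemma rgt_less: "(\<And>x. Suc (tp x) < g) \<Longrightarrow> rgt g tp j H < g ^ H"
proof (induction H arbitrary: j)
  case (Suc H)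
  have "tp (Suc j) < g" using Suc.prems[of "Suc j"] by simp
  then show ?case
    using digit_append_less[OF Suc.IH[OF Suc.prems], of "tp (Suc j)" "Suc j"] by simp
qed simp

text \<open>Thanks to the shifted digits, a zero test detects the left end of the work tape even
  among blanks.\<close>

lemma lft_eq_0_iff: "lft g tp j = 0 \<longleftrightarrow> j = 0"
  by (cases j) auto

text \<open>In \<open>Pu q f r n\<close> a symbol is pushed on the stack that the work head moves away from, in
\<open>Po q f r d\<close> one is popped off the other stack; \<open>C1\<close> and \<open>C2\<close> copy the scratch counter 2 back.
The flag \<open>f\<close> tells the two end markers apart and \<open>r\<close> is the direction of the move.\<close>

datatype tmst = Ready nat bool nat | Pu nat bool bool nat | C1 nat bool bool nat
  | Po nat bool bool nat | C2 nat bool bool nat nat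

locale log_tm =
  fixes Sig :: "con set" and M :: tm and k e :: nat
  assumes finite_Sig: "finite Sig" and Star: "Star \<notin> Sig" and wf: "wf_tm M"
    and space: "\<lbrakk>set w \<subseteq> Sig; (tm_step M w)\<^sup>*\<^sup>* (tm_init M) (q, i, tp, j)\<rbrakk> \<Longrightarrow> 2 ^ j \<le> (length w + 2) ^ k"
    and symbols: "s \<in> Gam M \<Longrightarrow> Suc s < 2 ^ e"
begin

text \<open>With a power of two as base, the bound on \<open>2 ^ j\<close> bounds
  \<open>g ^ j\<close> by a polynomial too.\<close>

abbreviation "g \<equiv> (2::nat) ^ e"

definition pushed :: "bool \<Rightarrow> nat" where "pushed r = (if r then 0 else 1)"

definition popped :: "bool \<Rightarrow> nat" where "popped r = (if r then 1 else 0)"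

lemma stacks_simps [simp]: "pushed r < 3" "popped r < 3" "pushed r \<noteq> popped r" "popped r \<noteq> pushed r"
  "pushed r \<noteq> 2" "popped r \<noteq> 2" "2 \<noteq> pushed r" "2 \<noteq> popped r"
  by (auto simp: pushed_def popped_def)

definition head_op :: "int \<Rightarrow> cop" where
  "head_op di = (if di = 1 then Hd True else if di = -1 then Hd False else Nop)"

text \<open>Both end markers share the \<open>Star\<close> cell; the direction of the last input
  move tells which one was reached.\<close>

definition new_end :: "bool \<Rightarrow> int \<Rightarrow> bool" where
  "new_end f di = (if di = 1 then True else if di = -1 then False else f)"

definition after_write :: "nat \<Rightarrow> bool \<Rightarrow> nat \<Rightarrow> int \<Rightarrow> tmst" where
  "after_write q f s dw = (if dw = 1 then Pu q f True (Suc s) else if dw = -1 then Pu q f False s else Ready q f s)"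

text \<open>The guards are the range conditions of \<open>tm_step\<close>: the input must not cross
  the cell shared by the markers. Testing \<open>h\<close> keeps junk symbols in \<open>PS\<close>
  away from \<open>delta\<close>, whose results are controlled on \<open>Gam M\<close> only.\<close>

definition moves :: "nat \<Rightarrow> bool \<Rightarrow> nat \<Rightarrow> con \<Rightarrow> bool \<Rightarrow> (nat \<times> nat \<times> int \<times> int) set" where
  "moves q f h a z = {(q', s, di, dw). q \<in> Q M \<and> h \<in> Gam M \<and>
     (q', s, di, dw) \<in> delta M q (if a = Star then None else Some a) h \<and>
     \<not> (di = -1 \<and> a = Star \<and> \<not> f) \<and> \<not> (di = 1 \<and> a = Star \<and> f) \<and> \<not> (dw = -1 \<and> z)}"

text \<open>Pushing adds \<open>g\<close> to the scratch counter for each unit taken off the stack,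
  on top of the new digit. Popping divides by \<open>g\<close>: \<open>d\<close> becomes the
  remainder, the scratch counter the quotient. The final \<open>d - 1\<close> undoes the shift of
  the left stack.\<close>

fun prog :: "tmst counter_program" where
  "prog (Ready q f h) a z = (\<lambda>(q', s, di, dw). (after_write q' (new_end f di) s dw, head_op di)) ` moves q f h a (z 0)"
| "prog (Pu q f r n) a z = (if 0 < n then {(Pu q f r (n - 1), Inc 2)}
     else if \<not> z (pushed r) then {(Pu q f r g, Dec (pushed r))} else {(C1 q f r 0, Nop)})"
| "prog (C1 q f r n) a z = (if 0 < n then {(C1 q f r (n - 1), Inc (pushed r))}
     else if \<not> z 2 then {(C1 q f r 1, Dec 2)} else {(Po q f r 0, Nop)})"
| "prog (Po q f r d) a z = (if g \<le> d then {(Po q f r 0, Inc 2)}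
     else if \<not> z (popped r) then {(Po q f r (Suc d), Dec (popped r))} else {(C2 q f r d 0, Nop)})"
| "prog (C2 q f r d n) a z = (if 0 < n then {(C2 q f r d (n - 1), Inc (popped r))}
     else if \<not> z 2 then {(C2 q f r d 1, Dec 2)} else {(Ready q f (if r then d else d - 1), Nop)})"

fun prog_acc :: "tmst \<Rightarrow> bool" where
  "prog_acc (Ready q f h) \<longleftrightarrow> q = qacc M"
| "prog_acc _ \<longleftrightarrow> False"

definition PS :: "tmst set" where
  "PS = (\<lambda>(q, f, h). Ready q f h) ` (Q M \<times> UNIV \<times> {..g}) \<union>
     (\<lambda>(q, f, r, n). Pu q f r n) ` (Q M \<times> UNIV \<times> UNIV \<times> {..g}) \<union>
     (\<lambda>(q, f, r, n). C1 q f r n) ` (Q M \<times> UNIV \<times> UNIV \<times> {..g}) \<union>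
     (\<lambda>(q, f, r, d). Po q f r d) ` (Q M \<times> UNIV \<times> UNIV \<times> {..g}) \<union>
     (\<lambda>(q, f, r, d, n). C2 q f r d n) ` (Q M \<times> UNIV \<times> UNIV \<times> {..g} \<times> {..g})"

lemma PS_iff [simp]:
  "Ready q f h \<in> PS \<longleftrightarrow> q \<in> Q M \<and> h \<le> g"
  "Pu q f r n \<in> PS \<longleftrightarrow> q \<in> Q M \<and> n \<le> g"
  "C1 q f r n \<in> PS \<longleftrightarrow> q \<in> Q M \<and> n \<le> g"
  "Po q f r n \<in> PS \<longleftrightarrow> q \<in> Q M \<and> n \<le> g"
  "C2 q f r d n \<in> PS \<longleftrightarrow> q \<in> Q M \<and> d \<le> g \<and> n \<le> g"
  by (auto simp: PS_def image_iff)

lemma finite_PS: "finite PS"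
  using wf by (simp add: PS_def wf_tm_def)

lemma delta_closed:
  assumes "q \<in> Q M" "h \<in> Gam M" "(q', s, di, dw) \<in> delta M q a h"
  shows "q' \<in> Q M \<and> s \<in> Gam M \<and> di \<in> {-1, 0, 1} \<and> dw \<in> {-1, 0, 1}"
  using wf assms unfolding wf_tm_def by blast

lemma e_pos: "0 < e"
  using symbols[of 0] wf by (cases e) (auto simp: wf_tm_def)

text \<open>\<open>e * Suc k\<close> is the exponent of \<open>n + 2\<close> that bounds
  \<open>g ^ Suc H\<close>; the factor 2 passes from \<open>n + 2\<close> to
  \<open>(n + 1) ^ 2\<close>.\<close>

definition D :: nat where
  "D = 2 * (e * Suc k)"

sublocale counter_mha Sig PS prog "Ready (q0 M) False 0" prog_acc D "tm_accepts M []"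
proof
  show "finite Sig" "Star \<notin> Sig" by (rule finite_Sig Star)+
  show "finite PS" by (rule finite_PS)
  show "Ready (q0 M) False 0 \<in> PS" using wf by (simp add: wf_tm_def)
  show "0 < D" using e_pos by (simp add: D_def)
  show "s' \<in> PS \<and> op_ok z op" if s: "s \<in> PS" and step: "(s', op) \<in> prog s a z" for s s' op a z
  proof (cases s)
    case (Ready q f h)
    then obtain q' s2 di dw where "q \<in> Q M" "h \<in> Gam M"
      and "(q', s2, di, dw) \<in> delta M q (if a = Star then None else Some a) h"
      and s': "s' = after_write q' (new_end f di) s2 dw" "op = head_op di"
      using step by (auto simp: moves_def)
    then have "q' \<in> Q M" "s2 \<in> Gam M" using delta_closed by blast+
    then show ?thesis using symbols[of s2] by (simp add: s' after_write_def head_op_def)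
  qed (use s step in \<open>auto split: if_splits\<close>)
qed

lemma prog_deterministic:
  assumes det: "deterministic_tm M" and "x \<in> prog s a z" "y \<in> prog s a z"
  shows "x = y"
proof (cases s)
  case (Ready q f h)
  have "u = v" if "u \<in> delta M q b h" "v \<in> delta M q b h" for u v b
    using det that card_le_Suc0_iff_eq[of "delta M q b h"] by (simp add: deterministic_tm_def)
  then have "u = v" if "u \<in> moves q f h a (z 0)" "v \<in> moves q f h a (z 0)" for u v
    using that unfolding moves_def by blast
  then show ?thesis using assms(2,3) unfolding Ready prog.simps by blast
qed (use assms in \<open>auto split: if_splits\<close>)

section \<open>Capacity of the counters on a nonempty word\<close>

context
  fixes w :: "con list"
  assumes w: "set w \<subseteq> Sig" and nonempty: "w \<noteq> []"
begin

text \<open>The farthest work cell that the space bound allows; all cells beyond stay blank.\<close>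

definition H :: nat where
  "H = (GREATEST x. 2 ^ x \<le> (length w + 2) ^ k)"

lemma H: "2 ^ H \<le> (length w + 2) ^ k" "2 ^ x \<le> (length w + 2) ^ k \<Longrightarrow> x \<le> H"
proof -
  have bound: "y \<le> (length w + 2) ^ k" if "2 ^ y \<le> (length w + 2) ^ k" for y
    using less_exp[of y] that by linarith
  show "2 ^ H \<le> (length w + 2) ^ k"
    unfolding H_def by (rule GreatestI_nat[where k = 0, OF _ bound]) simp_all
  show "2 ^ x \<le> (length w + 2) ^ k \<Longrightarrow> x \<le> H"
    unfolding H_def by (rule Greatest_le_nat[OF _ bound])
qed

text \<open>\<open>Suc H\<close>, as a counter still to be popped holds one digit more than a
  stack.\<close>

lemma capacity: "g ^ Suc H \<le> Suc (length w) ^ D"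
proof -
  have "g ^ Suc H = 2 ^ e * (2 ^ H) ^ e"
    by (simp add: power_mult[symmetric] mult.commute)
  also have "\<dots> \<le> (length w + 2) ^ e * ((length w + 2) ^ k) ^ e"
    using H(1) by (intro mult_mono power_mono) auto
  also have "\<dots> = (length w + 2) ^ (e * Suc k)"
    by (simp add: power_mult[symmetric] power_add[symmetric] algebra_simps)
  \<comment> \<open>\<open>n + 2 <= (n + 1) ^ 2\<close> needs \<open>n >= 1\<close>.\<close>
  also have "\<dots> \<le> (Suc (length w) ^ 2) ^ (e * Suc k)"
    using nonempty by (intro power_mono) (cases w, auto simp: power2_eq_square)
  also have "\<dots> = Suc (length w) ^ D"
    by (simp only: D_def power_mult)
  finally show ?thesis .
qed

abbreviation "treach C \<equiv> (tm_step M w)\<^sup>*\<^sup>* (tm_init M) C"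

lemma treach_facts:
  assumes "treach (q, i, tp, j)"
  shows "q \<in> Q M" "tp x \<in> Gam M" "i \<le> Suc (length w)" "j \<le> H" "H < x \<Longrightarrow> tp x = 0"
proof -
  have "case C of (q, i, tp, j) \<Rightarrow> q \<in> Q M \<and> (\<forall>x. tp x \<in> Gam M) \<and> i \<le> Suc (length w) \<and> j \<le> H \<and>
      (\<forall>x. H < x \<longrightarrow> tp x = 0)" if "treach C" for C
    using that
  proof (induction rule: rtranclp_induct)
    case base
    have "2 ^ 0 \<le> (length w + 2) ^ k" by simp
    then show ?case using wf by (simp add: tm_init_def wf_tm_def)
  next
    case (step C C')
    obtain q i tp j where C: "C = (q, i, tp, j)" using prod_cases4 by blast
    obtain q' s di dw where delta: "(q', s, di, dw) \<in> delta M q (inp w i) (tp j)"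
      and b: "int i + di \<le> int (length w) + 1"
      and C': "C' = (q', nat (int i + di), tp(j := s), nat (int j + dw))"
      using step(2) unfolding tm_step_def C by auto
    have "2 ^ nat (int j + dw) \<le> (length w + 2) ^ k"
      using space[OF w] rtranclp.rtrancl_into_rtrancl[OF step(1,2)] unfolding C' .
    then have "nat (int j + dw) \<le> H" by (rule H(2))
    then show ?case
      using step(3) delta_closed[OF _ _ delta] b by (auto simp: C C')
  qed
  from this[OF assms] show "q \<in> Q M" "tp x \<in> Gam M" "i \<le> Suc (length w)" "j \<le> H" "H < x \<Longrightarrow> tp x = 0"
    by auto
qed

section \<open>The invariant linking counters and Turing machine\<close>

definition input_rel :: "nat \<Rightarrow> bool \<Rightarrow> nat \<Rightarrow> bool" where
  "input_rel x f i \<longleftrightarrow> x = i mod Suc (length w) \<and> (i = 0 \<longrightarrow> \<not> f) \<and> (i = Suc (length w) \<longrightarrow> f)"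

definition stack :: "bool \<Rightarrow> (nat \<Rightarrow> nat) \<Rightarrow> nat \<Rightarrow> nat" where
  "stack r tp j = (if r then lft g tp j else rgt g tp j H)"

text \<open>The digit exposed by a move in direction \<open>r\<close>: a right move pops the right
  stack, whose digits are unshifted.\<close>

definition residue :: "bool \<Rightarrow> nat \<Rightarrow> nat" where
  "residue r s = (if r then s else Suc s)"

text \<open>Once a loop runs, the Turing machine has already made its step. Each loop preserves a
  sum whose final value is the new stack or, while popping, the old one with the symbol now under
  the head as lowest digit.\<close>

fun It :: "tmst \<times> nat \<times> (nat \<Rightarrow> nat) \<Rightarrow> config \<Rightarrow> bool" where
  "It (Ready q f h, x, v) (q', i, tp, j) \<longleftrightarrow> treach (q', i, tp, j) \<and> q' = q \<and> input_rel x f i \<and>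
     h = tp j \<and> v 0 = lft g tp j \<and> v 1 = rgt g tp j H \<and> v 2 = 0"
| "It (Pu q f r n, x, v) (q', i, tp, j) \<longleftrightarrow> treach (q', i, tp, j) \<and> q' = q \<and> input_rel x f i \<and>
     v (pushed r) * g + v 2 + n = stack r tp j \<and>
     v (popped r) = residue r (tp j) + g * stack (\<not> r) tp j"
| "It (C1 q f r n, x, v) (q', i, tp, j) \<longleftrightarrow> treach (q', i, tp, j) \<and> q' = q \<and> input_rel x f i \<and>
     v (pushed r) + v 2 + n = stack r tp j \<and>
     v (popped r) = residue r (tp j) + g * stack (\<not> r) tp j"
| "It (Po q f r d, x, v) (q', i, tp, j) \<longleftrightarrow> treach (q', i, tp, j) \<and> q' = q \<and> input_rel x f i \<and>
     v (pushed r) = stack r tp j \<and> d \<le> g \<and>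
     v 2 * g + d + v (popped r) = residue r (tp j) + g * stack (\<not> r) tp j"
| "It (C2 q f r d n, x, v) (q', i, tp, j) \<longleftrightarrow> treach (q', i, tp, j) \<and> q' = q \<and> input_rel x f i \<and>
     v (pushed r) = stack r tp j \<and> d = residue r (tp j) \<and>
     v (popped r) + v 2 + n = stack (\<not> r) tp j"

fun is_Ready :: "tmst \<times> nat \<times> (nat \<Rightarrow> nat) \<Rightarrow> bool" where
  "is_Ready (Ready q f h, y) \<longleftrightarrow> True"
| "is_Ready _ \<longleftrightarrow> False"

text \<open>Lexicographic: the loop, the counter it empties, the inner countdown. In
  \<open>Po\<close> the last component falls from \<open>g\<close> to 0 whenever the quotient
  grows.\<close>

fun phase :: "tmst \<times> nat \<times> (nat \<Rightarrow> nat) \<Rightarrow> nat \<times> nat \<times> nat" where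
  "phase (Ready q f h, x, v) = (0, 0, 0)"
| "phase (Pu q f r n, x, v) = (4, v (pushed r), n)"
| "phase (C1 q f r n, x, v) = (3, v 2, n)"
| "phase (Po q f r d, x, v) = (2, v (popped r), d)"
| "phase (C2 q f r d n, x, v) = (1, v 2, n)"

lemma tape_less: "treach (q, i, tp, j) \<Longrightarrow> Suc (tp x) < g"
  using symbols treach_facts(2) by blast

lemma residue_less: "treach (q, i, tp, j) \<Longrightarrow> residue r (tp x) < g"
  using tape_less[of q i tp j x] by (simp add: residue_def)

lemma stack_less:
  assumes "treach (q, i, tp, j)"
  shows "stack r tp j < g ^ H"
proof (cases r)
  case True
  have "lft g tp j < g ^ j" by (rule lft_less[OF tape_less[OF assms]])
  also have "\<dots> \<le> g ^ H" using treach_facts(4)[OF assms] by (intro power_increasing) auto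
  finally show ?thesis using True by (simp add: stack_def)
next
  case False
  then show ?thesis using rgt_less[OF tape_less[OF assms]] by (simp add: stack_def)
qed

lemma It_bound:
  assumes "It (s, x, v) C" "X < 3"
  shows "v X < Suc (length w) ^ D"
proof -
  obtain q i tp j where C: "C = (q, i, tp, j)" using prod_cases4 by blast
  have t: "treach (q, i, tp, j)" using assms(1) by (cases s) (auto simp: C)
  have 1: "stack r tp j < g ^ Suc H" for r
    by (rule less_le_trans[OF stack_less[OF t]], rule power_increasing) simp_all
  have 2: "residue r (tp j) + g * stack (\<not> r) tp j < g ^ Suc H" for r
    by (rule digit_append_less[OF stack_less[OF t] residue_less[OF t]])
  have le: "y \<le> y * g" for y by simp
  have cases: "X = pushed r \<or> X = popped r \<or> X = 2" for r
    using assms(2) by (auto simp: pushed_def popped_def)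
  have "v X < g ^ Suc H"
  proof (cases s)
    case (Ready q f h)
    then show ?thesis
      using assms 1[of True] 1[of False] cases[of True] by (auto simp: C stack_def pushed_def popped_def)
  next
    case (Pu q f r n)
    then have eqs: "v (pushed r) * g + v 2 + n = stack r tp j"
      "v (popped r) = residue r (tp j) + g * stack (\<not> r) tp j"
      using assms(1) by (auto simp: C)
    then have "v (pushed r) \<le> stack r tp j" "v 2 \<le> stack r tp j" using le[of "v (pushed r)"] by linarith+
    then show ?thesis using 1[of r] 2[of r] cases[of r] eqs(2) by (metis le_less_trans)
  next
    case (C1 q f r n)
    then show ?thesis using assms(1) 1[of r] 2[of r] cases[of r] by (auto simp: C)
  next
    case (Po q f r d)
    then have eqs: "v (pushed r) = stack r tp j"
      "v 2 * g + d + v (popped r) = residue r (tp j) + g * stack (\<not> r) tp j"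
      using assms(1) by (auto simp: C)
    then have "v 2 \<le> residue r (tp j) + g * stack (\<not> r) tp j"
      "v (popped r) \<le> residue r (tp j) + g * stack (\<not> r) tp j"
      using le[of "v 2"] by linarith+
    then show ?thesis using 1[of r] 2[of r] cases[of r] eqs(1) by (metis le_less_trans)
  next
    case (C2 q f r d n)
    then show ?thesis using assms(1) 1[of r] 1[of "\<not> r"] 2[of r] cases[of r] by (auto simp: C)
  qed
  then show ?thesis using capacity by linarith
qed

abbreviation "steps \<equiv> cstep w prog"

lemma cstep_iff: "((s, x, v), y) \<in> steps \<longleftrightarrow> (\<exists>s' op. (s', op) \<in> prog s (letter w x) (\<lambda>X. X < 3 \<and> v X = 0) \<and>
    y = (s', apply_op (Suc (length w)) op (x, v)))"
  by (cases y) (auto simp: cstep_def)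

lemma busy_progress: "\<not> is_Ready c \<Longrightarrow> \<exists>c'. (c, c') \<in> steps"
proof -
  assume *: "\<not> is_Ready c"
  obtain s x v where c: "c = (s, x, v)" using prod_cases3 by blast
  have "prog s (letter w x) (\<lambda>X. X < 3 \<and> v X = 0) \<noteq> {}"
    using * by (cases s) (auto simp: c)
  then show ?thesis unfolding c cstep_iff by (metis ex_in_conv surj_pair)
qed

lemma busy_step:
  assumes I: "It c C" and busy: "\<not> is_Ready c" and step: "(c, c') \<in> steps"
  shows "It c' C \<and> (c', c) \<in> inv_image (less_than <*lex*> less_than <*lex*> less_than) phase"
proof -
  obtain q i tp j where C: "C = (q, i, tp, j)" using prod_cases4 by blast
  obtain s x v where c: "c = (s, x, v)" using prod_cases3 by blast
  obtain s' op where op: "(s', op) \<in> prog s (letter w x) (\<lambda>X. X < 3 \<and> v X = 0)"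
    and c': "c' = (s', apply_op (Suc (length w)) op (x, v))"
    using step unfolding c cstep_iff by blast
  have t: "treach (q, i, tp, j)" using I by (cases s) (auto simp: C c)
  have g: "0 < g" by simp
  show ?thesis
  proof (cases s)
    case (Ready q f h)
    then show ?thesis using busy by (simp add: c)
  next
    case (Pu q' f r n)
    consider "0 < n" | "n = 0" "v (pushed r) \<noteq> 0" | "n = 0" "v (pushed r) = 0" by blast
    then show ?thesis
    proof cases
      case 2
      then obtain y where "v (pushed r) = Suc y" by (cases "v (pushed r)") auto
      then show ?thesis using I op 2 by (auto simp: C c c' Pu)
    qed (use I op in \<open>auto simp: C c c' Pu\<close>)
  next
    case (C1 q' f r n)
    consider "0 < n" | "n = 0" "v 2 \<noteq> 0" | "n = 0" "v 2 = 0" by blast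
    then show ?thesis
      by cases (use I op in \<open>auto simp: C c c' C1\<close>)
  next
    case (Po q' f r d)
    consider "g \<le> d" | "d < g" "v (popped r) \<noteq> 0" | "d < g" "v (popped r) = 0" by force
    then show ?thesis
    proof cases
      case 1
      then have "d = g" using I by (auto simp: C c Po)
      then show ?thesis using I op g by (auto simp: C c c' Po)
    next
      case 2
      then show ?thesis using I op by (auto simp: C c c' Po)
    next
      case 3
      have res: "residue r (tp j) < g" by (rule residue_less[OF t])
      have eq: "v 2 * g + d = stack (\<not> r) tp j * g + residue r (tp j)"
        using I 3 by (simp add: C c Po ac_simps)
      \<comment> \<open>Uniqueness of division with remainder.\<close>
      have "d = (v 2 * g + d) mod g" "v 2 = (v 2 * g + d) div g" using 3 by simp_all
      then have "d = residue r (tp j)" "v 2 = stack (\<not> r) tp j"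
        using eq res by simp_all
      then show ?thesis using I op 3 by (auto simp: C c c' Po)
    qed
  next
    case (C2 q' f r d n)
    consider "0 < n" | "n = 0" "v 2 \<noteq> 0" | "n = 0" "v 2 = 0" by blast
    then show ?thesis
    proof cases
      case 3
      then show ?thesis using I op
        by (cases r) (auto simp: C c c' C2 residue_def stack_def pushed_def popped_def)
    qed (use I op in \<open>auto simp: C c c' C2\<close>)
  qed
qed

lemma input_rel_letter:
  assumes "input_rel x f i" "i \<le> Suc (length w)"
  shows "inp w i = (if letter w x = Star then None else Some (letter w x))"
    "letter w x = Star \<and> \<not> f \<longleftrightarrow> i = 0" "letter w x = Star \<and> f \<longleftrightarrow> i = Suc (length w)"
proof -
  have x: "x < Suc (length w)" "x = i mod Suc (length w)" using assms by (auto simp: input_rel_def)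
  have "letter w x = Star \<longleftrightarrow> x = 0" by (rule letter_eq_Star[OF w Star x(1)])
  moreover have "x = 0 \<longleftrightarrow> i = 0 \<or> i = Suc (length w)"
    using assms(2) by (cases "i = Suc (length w)") (auto simp: x(2))
  moreover have "x = i" if "i \<noteq> Suc (length w)" using x(2) that assms(2) by simp
  ultimately show "inp w i = (if letter w x = Star then None else Some (letter w x))"
    "letter w x = Star \<and> \<not> f \<longleftrightarrow> i = 0" "letter w x = Star \<and> f \<longleftrightarrow> i = Suc (length w)"
    using assms by (auto simp: inp_def letter_def input_rel_def)
qed

lemma input_rel_move:
  assumes "input_rel x f i" "di \<in> {-1, 0, 1}" "0 \<le> int i + di" "i \<le> Suc (length w)"
  shows "\<exists>x'. apply_op (Suc (length w)) (head_op di) (x, v) = (x', v) \<and>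
    input_rel x' (new_end f di) (nat (int i + di))"
proof -
  have x: "x = i mod Suc (length w)" using assms by (simp add: input_rel_def)
  consider "di = 0" | "di = 1" | "di = -1" using assms(2) by blast
  then show ?thesis
  proof cases
    case 1
    then show ?thesis using assms by (simp add: head_op_def new_end_def)
  next
    case 2
    then have "nat (int i + di) = Suc i" by simp
    then show ?thesis by (simp add: 2 head_op_def new_end_def input_rel_def mv_def x mod_Suc_eq)
  next
    case 3
    then obtain i' where i: "i = Suc i'" using assms(3) by (cases i) auto
    have "(i mod Suc (length w) + Suc (length w) - 1) mod Suc (length w) = (i mod Suc (length w) + length w) mod Suc (length w)"
      by simp
    also have "\<dots> = (i + length w) mod Suc (length w)" by (rule mod_add_left_eq)
    also have "i + length w = i' + Suc (length w)" by (simp add: i)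
    also have "(i' + Suc (length w)) mod Suc (length w) = i' mod Suc (length w)" by (rule mod_add_self2)
    finally have "mv (Suc (length w)) False x = i' mod Suc (length w)" by (simp add: mv_def x)
    moreover have "nat (int i + di) = i'" using 3 i by simp
    ultimately show ?thesis using 3 assms(4) i by (simp add: head_op_def new_end_def input_rel_def)
  qed
qed

lemma ready_move:
  assumes I: "It (Ready q f h, x, v) (q, i, tp, j)"
    and delta: "(q', s, di, dw) \<in> delta M q (inp w i) (tp j)"
    and b: "0 \<le> int i + di" "int i + di \<le> int (length w) + 1" "0 \<le> int j + dw"
  shows "It (after_write q' (new_end f di) s dw, apply_op (Suc (length w)) (head_op di) (x, v))
    (q', nat (int i + di), tp(j := s), nat (int j + dw))"
proof -
  have t: "treach (q, i, tp, j)" and "input_rel x f i"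
    and v: "v 0 = lft g tp j" "v 1 = rgt g tp j H" "v 2 = 0" using I by auto
  have *: "di \<in> {-1, 0, 1}" "dw \<in> {-1, 0, 1}"
    using delta_closed[OF treach_facts(1)[OF t] treach_facts(2)[OF t] delta] by auto
  obtain x' where x': "apply_op (Suc (length w)) (head_op di) (x, v) = (x', v)"
    and inp: "input_rel x' (new_end f di) (nat (int i + di))"
    using input_rel_move[OF \<open>input_rel x f i\<close> *(1) b(1) treach_facts(3)[OF t]] by blast
  have "tm_step M w (q, i, tp, j) (q', nat (int i + di), tp(j := s), nat (int j + dw))"
    using delta b by (auto simp: tm_step_def)
  then have t': "treach (q', nat (int i + di), tp(j := s), nat (int j + dw))"
    by (rule rtranclp.rtrancl_into_rtrancl[OF t])
  note zero = treach_facts(5)[OF t] treach_facts(5)[OF t']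
  consider "dw = 0" | "dw = 1" | "dw = -1" using *(2) by blast
  then show ?thesis
  proof cases
    case 1
    then show ?thesis using t' inp v by (simp add: after_write_def x')
  next
    case 2
    then have j': "nat (int j + dw) = Suc j" by simp
    \<comment> \<open>One blank cell more, so that popping leaves a full window of \<open>H\<close>
      cells at \<open>Suc j\<close>.\<close>
    have "rgt g tp j H = rgt g tp j (Suc H)" by (rule rgt_Suc_eq[symmetric]) (use zero in auto)
    then show ?thesis
      using 2 t' inp v unfolding j' by (simp add: after_write_def x' pushed_def popped_def stack_def residue_def)
  next
    case 3
    then obtain j0 where j: "j = Suc j0" using b(3) by (cases j) auto
    then have j': "nat (int j + dw) = j0" using 3 by simp
    \<comment> \<open>Pushing \<open>s\<close> yields \<open>Suc H\<close> cells to the right of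
      \<open>j0\<close>, the last of them blank.\<close>
    have "rgt g (tp(j := s)) j0 H = rgt g (tp(j := s)) j0 (Suc H)"
      by (rule rgt_Suc_eq[symmetric]) (use zero in auto)
    then show ?thesis
      using 3 t' inp v unfolding j'
      by (simp add: after_write_def x' pushed_def popped_def stack_def residue_def j)
  qed
qed

lemma ready_moves_iff:
  assumes I: "It (Ready q f h, x, v) (q, i, tp, j)"
  shows "(q', s, di, dw) \<in> moves q f h (letter w x) (v 0 = 0) \<longleftrightarrow>
    (q', s, di, dw) \<in> delta M q (inp w i) (tp j) \<and>
    0 \<le> int i + di \<and> int i + di \<le> int (length w) + 1 \<and> 0 \<le> int j + dw"
proof -
  have t: "treach (q, i, tp, j)" and inp: "input_rel x f i" and h: "h = tp j" and v0: "v 0 = 0 \<longleftrightarrow> j = 0"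
    using I by (auto simp: lft_eq_0_iff)
  note f = treach_facts[OF t]
  note il = input_rel_letter[OF inp f(3)]
  show ?thesis
  proof (cases "(q', s, di, dw) \<in> delta M q (inp w i) (tp j)")
    case True
    then have "di \<in> {-1, 0, 1}" "dw \<in> {-1, 0, 1}" using delta_closed[OF f(1,2)] by blast+
    then have "\<not> (di = -1 \<and> i = 0) \<longleftrightarrow> 0 \<le> int i + di" "\<not> (dw = -1 \<and> j = 0) \<longleftrightarrow> 0 \<le> int j + dw"
      "\<not> (di = 1 \<and> i = Suc (length w)) \<longleftrightarrow> int i + di \<le> int (length w) + 1"
      using f(3) by auto
    then show ?thesis
      using True f(1,2) unfolding moves_def il(1)[symmetric] h v0 by (auto simp: il(2,3))
  next
    case False
    then show ?thesis unfolding moves_def il(1)[symmetric] h by simp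
  qed
qed

lemma ready_sim:
  assumes I: "It c C" "is_Ready c" and step: "(c, c') \<in> steps"
  shows "\<exists>C'. tm_step M w C C' \<and> It c' C'"
proof -
  obtain q f h x v i tp j where c: "c = (Ready q f h, x, v)" and C: "C = (q, i, tp, j)"
    using I by (cases "(c, C)" rule: It.cases) auto
  obtain q' s di dw where mvs: "(q', s, di, dw) \<in> moves q f h (letter w x) (v 0 = 0)"
    and c': "c' = (after_write q' (new_end f di) s dw, apply_op (Suc (length w)) (head_op di) (x, v))"
    using step unfolding c cstep_iff by auto
  note * = mvs[unfolded ready_moves_iff[OF I(1)[unfolded c C]]]
  have "tm_step M w C (q', nat (int i + di), tp(j := s), nat (int j + dw))"
    using * by (auto simp: tm_step_def C)
  then show ?thesis
    using ready_move[OF I(1)[unfolded c C]] * unfolding c' by blast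
qed

lemma ready_cosim:
  assumes I: "It c C" "is_Ready c" and step: "tm_step M w C C'"
  shows "\<exists>c'. (c, c') \<in> steps \<and> It c' C'"
proof -
  obtain q f h x v i tp j where c: "c = (Ready q f h, x, v)" and C: "C = (q, i, tp, j)"
    using I by (cases "(c, C)" rule: It.cases) auto
  obtain q' s di dw where *: "(q', s, di, dw) \<in> delta M q (inp w i) (tp j)"
    "0 \<le> int i + di" "int i + di \<le> int (length w) + 1" "0 \<le> int j + dw"
    and C': "C' = (q', nat (int i + di), tp(j := s), nat (int j + dw))"
    using step by (auto simp: tm_step_def C)
  then have mvs: "(q', s, di, dw) \<in> moves q f h (letter w x) (v 0 = 0)"
    using ready_moves_iff[OF I(1)[unfolded c C]] by blast
  have "(after_write q' (new_end f di) s dw, head_op di) \<in>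
      prog (Ready q f h) (letter w x) (\<lambda>X. X < 3 \<and> v X = 0)"
    using mvs by (force simp: image_iff)
  then have "(c, (after_write q' (new_end f di) s dw, apply_op (Suc (length w)) (head_op di) (x, v))) \<in> steps"
    unfolding c cstep_iff by blast
  then show ?thesis
    using ready_move[OF I(1)[unfolded c C] *] unfolding C' by blast
qed

lemma rgt_zero: "rgt g (\<lambda>_. 0) j n = 0"
  by (induction n arbitrary: j) auto

lemma It_init: "It (Ready (q0 M) False 0, 0, \<lambda>_. 0) (tm_init M)"
  by (simp add: tm_init_def input_rel_def rgt_zero)

lemma maccepts_iff_nonempty: "maccepts w \<longleftrightarrow> tm_accepts M w"
proof -
  let ?R = "{(C, C'). tm_step M w C C'}"
  \<comment> \<open>The absence of overflow is what licenses the passage from counters to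
    heads.\<close>
  have safe: "v X < Suc (length w) ^ D" if reach: "creach w (s, x, v)" and "X < 3" for s x v X
  proof -
    have "\<exists>C. (tm_init M, C) \<in> ?R\<^sup>* \<and> It (s, x, v) C"
    proof (rule stuttering_simulation_invariant[where I = It and ready = is_Ready, OF It_init _ _ reach])
      show "\<exists>C'. (C, C') \<in> ?R \<and> It c' C'" if "It c C" "is_Ready c" "(c, c') \<in> steps" for c C c'
        using ready_sim[OF that] by blast
      show "It c' C" if "It c C" "\<not> is_Ready c" "(c, c') \<in> steps" for c C c'
        using busy_step[OF that] by blast
    qed
    then show ?thesis using It_bound \<open>X < 3\<close> by blast
  qed
  have "(\<exists>c. creach w c \<and> prog_acc (fst c)) \<longleftrightarrow> (\<exists>C. (tm_init M, C) \<in> ?R\<^sup>* \<and> fst C = qacc M)"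
  proof (rule stuttering_simulation[where I = It and ready = is_Ready, OF It_init])
    show "\<exists>C'. (C, C') \<in> ?R \<and> It c' C'" if "It c C" "is_Ready c" "(c, c') \<in> steps" for c C c'
      using ready_sim[OF that] by blast
    show "\<exists>c'. (c, c') \<in> steps \<and> It c' C'" if "It c C" "is_Ready c" "(C, C') \<in> ?R" for c C C'
      using ready_cosim[OF that(1,2)] that(3) by blast
    show "\<exists>c'. (c, c') \<in> steps" if "\<not> is_Ready c" for c
      by (rule busy_progress[OF that])
    show "It c' C \<and> (c', c) \<in> inv_image (less_than <*lex*> less_than <*lex*> less_than) phase"
      if "It c C" "\<not> is_Ready c" "(c, c') \<in> steps" for c C c'
      by (rule busy_step[OF that])
    show "wf (inv_image (less_than <*lex*> less_than <*lex*> less_than) phase)"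
      by (intro wf_inv_image wf_lex_prod wf_less_than)
    show "prog_acc (fst c) \<longleftrightarrow> is_Ready c \<and> fst C = qacc M" if "It c C" for c C
      using that by (cases "(c, C)" rule: It.cases) auto
  qed
  also have "\<dots> \<longleftrightarrow> tm_accepts M w"
    unfolding tm_accepts_def rtranclp_rtrancl_eq by force
  finally show ?thesis
    using maccepts_nonempty[OF w nonempty] safe by blast
qed

end

lemma maccepts_iff:
  assumes "set w \<subseteq> Sig"
  shows "maccepts w \<longleftrightarrow> tm_accepts M w"
  using assms maccepts_iff_nonempty maccepts_empty by (cases "w = []") auto

end

section \<open>The observation of a machine\<close>

lemma log_tm_exists:
  assumes "finite Sig" "Star \<notin> Sig" "wf_tm M" "logspace_tm M Sig"
  shows "\<exists>k e. log_tm Sig M k e"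
proof -
  obtain k where k: "\<And>w q i tp j. set w \<subseteq> Sig \<Longrightarrow> (tm_step M w)\<^sup>*\<^sup>* (tm_init M) (q, i, tp, j) \<Longrightarrow>
      2 ^ j \<le> (length w + 2) ^ k"
    using assms(4) unfolding logspace_tm_def by blast
  have fin: "finite (Gam M)" using assms(3) by (simp add: wf_tm_def)
  \<comment> \<open>Makes \<open>Suc s <= e < 2 ^ e\<close> for every symbol
    \<open>s\<close>.\<close>
  define e where "e = Suc (Max (Gam M))"
  have "Suc s < 2 ^ e" if "s \<in> Gam M" for s
  proof -
    have "Suc s \<le> e" using Max_ge[OF fin that] by (simp add: e_def)
    then show ?thesis using less_exp[of e] by linarith
  qed
  then have "log_tm Sig M k e"
    using assms k by unfold_locales auto
  then show ?thesis by blast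
qed

lemma observation_exists:
  assumes "finite Sig" "Star \<notin> Sig" "wf_tm M" "logspace_tm M Sig"
    and again: "again \<or> deterministic_tm M"
  shows "\<exists>Ob. Ob \<in> Matr Sig Obs \<and> (deterministic_tm M \<longrightarrow> deterministic Ob) \<and>
    lang Sig Ob = {w. set w \<subseteq> Sig \<and> (again \<longleftrightarrow> \<not> tm_accepts M w)}"
proof -
  obtain k e where "log_tm Sig M k e" using log_tm_exists assms by blast
  then interpret T: log_tm Sig M k e .
  interpret clocked_mha Sig T.MS T.m T.mwk Boot T.macc again "Suc (card T.MS * card T.MS)" "2 * T.m"
    by unfold_locales auto
  have mwk_det: "x = y" if "deterministic_tm M" "x \<in> T.mwk z l" "y \<in> T.mwk z l" for z l x y
    by (rule T.mwk_deterministic[OF T.prog_deterministic[OF that(1)] that(2,3)])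
  have det: "deterministic clk.observation" if "deterministic_tm M"
  proof (rule clk.deterministic_observation)
    show "x = y" if cwk: "z \<in> CS" "x \<in> cwk z l" "y \<in> cwk z l" for z l x y
      by (rule cwk_deterministic[OF _ cwk]) (rule mwk_det[OF \<open>deterministic_tm M\<close>])
  qed
  have nilpotent: "nilpotent (wprod clk.observation (wordrep w p)) \<longleftrightarrow> (again \<longleftrightarrow> \<not> tm_accepts M w)"
    if w: "set w \<subseteq> Sig" and p: "length p = Suc (length w)" "distinct p" for w p
  proof -
    have acc: "accepts w \<longleftrightarrow> tm_accepts M w"
      using T.maccepts_iff[OF w] by (simp add: accepts_def[OF w p] T.maccepts_def[OF w])
    show ?thesis
    proof (cases again)
      case True
      then show ?thesis
        using bounded_iff_not_accepts[OF w p] acc clk.nilpotent_product_iff[OF w p(1)] by simp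
    next
      case False
      then show ?thesis
        using bounded_iff_accepts[OF w p False] mwk_det assms(5) acc clk.nilpotent_product_iff[OF w p(1)]
        by blast
    qed
  qed
  \<comment> \<open>To exclude a word from the language, at least one representation of it must
    exist.\<close>
  have "\<exists>p :: nat list. length p = Suc (length w) \<and> distinct p" for w :: "con list"
    by (rule exI[of _ "[0..<Suc (length w)]"]) simp
  then have "lang Sig clk.observation = {w. set w \<subseteq> Sig \<and> (again \<longleftrightarrow> \<not> tm_accepts M w)}"
    using nilpotent unfolding lang_def by (simp only: Suc_eq_plus1[symmetric]) blast
  then show ?thesis
    using clk.observation_in_Matr det by blast
qed

theorem mainTheorem1:
  fixes Sig :: "con set" and Lg :: "con list set"
  assumes "finite Sig" and "Star \<notin> Sig" and "Lg \<subseteq> lists Sig"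
  shows "(in_coNL Sig Lg \<longrightarrow> (\<exists>Ob. Ob \<in> Matr Sig Obs \<and> lang Sig Ob = Lg)) \<and>
         (in_L Sig Lg \<longrightarrow> (\<exists>Ob. Ob \<in> Matr Sig Obs \<and> deterministic Ob \<and> lang Sig Ob = Lg))"
proof (intro conjI impI)
  assume "in_coNL Sig Lg"
  then obtain M where M: "wf_tm M" "logspace_tm M Sig"
    and acc: "\<And>w. set w \<subseteq> Sig \<Longrightarrow> w \<in> lists Sig - Lg \<longleftrightarrow> tm_accepts M w"
    by (auto simp: in_coNL_def in_NL_def)
  have "{w. set w \<subseteq> Sig \<and> (True \<longleftrightarrow> \<not> tm_accepts M w)} = Lg"
    using acc assms(3) by (auto simp: in_lists_conv_set subset_iff)
  then show "\<exists>Ob. Ob \<in> Matr Sig Obs \<and> lang Sig Ob = Lg"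
    using observation_exists[OF assms(1,2) M, of True] by auto
next
  assume "in_L Sig Lg"
  then obtain M where M: "wf_tm M" "logspace_tm M Sig" and det: "deterministic_tm M"
    and acc: "\<And>w. set w \<subseteq> Sig \<Longrightarrow> w \<in> Lg \<longleftrightarrow> tm_accepts M w"
    by (auto simp: in_L_def)
  have "{w. set w \<subseteq> Sig \<and> (False \<longleftrightarrow> \<not> tm_accepts M w)} = Lg"
    using acc assms(3) by (auto simp: in_lists_conv_set subset_iff)
  then show "\<exists>Ob. Ob \<in> Matr Sig Obs \<and> deterministic Ob \<and> lang Sig Ob = Lg"
    using observation_exists[OF assms(1,2) M, of False] det by auto
qed

end
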